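(* Let $\mathcal{X}$, $\mathcal{A}$ be Polish spaces, $T$ a positive integer, $\mu_0\in\mathcal{P}(\mathcal{X})$, $\rho:\mathcal{X}\times\mathcal{A}\times\mathcal{P}(\mathcal{A})\times\mathcal{P}(\mathcal{X})\to\mathcal{P}(\mathcal{X})$ a Markov transition kernel, and $c:\mathcal{X}\times\mathcal{A}\times\mathcal{P}(\mathcal{A})\times\mathcal{P}(\mathcal{X})\to[0,\infty)$, $\phi:\mathcal{X}\times\mathcal{P}(\mathcal{A})\times\mathcal{P}(\mathcal{X})\to[0,\infty)$ running and terminal cost functions. Let $w:\mathcal X\to[1,\infty)$ be a continuous moment function and let $v$ be the constant function $1$ if $c$ and $\phi$ are both bounded, and $v=w$ otherwise. Assume: (i) $c$ and $\phi$ are continuous; (ii) $\mathcal{A}$ is compact and $\mathcal{X}$ is locally compact; (iii) there is a constant $\alpha\ge 1$ with $\sup_{(a,\delta^c,\delta^s)\in\mathcal{A}\times\mathcal{P}(\mathcal{A})\times\mathcal{P}(\mathcal{X})}\int_{\mathcal{X}}w(y)\,\rho(dy|x,a,\delta^c,\delta^s)\le\alpha w(x)$ for all $x\in\mathcal{X}$; (iv) $\rho$ is weakly continuous: if $(x_n,a_n,\delta^c_n,\delta^s_n)\to(x,a,\delta^c,\delta^s)$ then $\rho(\cdot|x_n,a_n,\delta_n^c,\delta_n^s)\to\rho(\cdot|x,a,\delta^c,\delta^s)$ weakly; and $\int_{\mathcal{X}}w(y)\,\rho(dy|x,a,\delta^c,\delta^s)$ is continuous in $(x,a,\delta^c,\delta^s)$;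 (v) $\int_{\mathcal{X}}v(x)\,\mu_0(dx)<\infty$; (vi) there is $R\in\mathbb{R}$ such that for all $x\in\mathcal{X}$, $\sup_{(a,\delta)\in\mathcal{A}\times(\mathcal{P}(\mathcal{A})\times\mathcal{P}(\mathcal{X}))}c(x,a,\delta)\le R\,v(x)$ and $\sup_{\delta\in\mathcal{P}(\mathcal{A})\times\mathcal{P}(\mathcal{X})}\phi(x,\delta)\le R\,v(x)$. Then there exists an MFG equilibrium for this finite-horizon discrete-time model.
   Context: For a Polish space $S$, $\mathcal{P}(S)$ is the set of Borel probability measures on $S$ with the topology of weak convergence. A continuous moment function $w:\mathcal{X}\to[1,\infty)$ is a continuous map for which there is an increasing sequence of compact sets $H_n\subseteq\mathcal{X}$ with $\lim_{n\to\infty}\inf_{x\in\mathcal{X}\setminus H_n}w(x)=\infty$, and such that $w(\cdot)\ge 1+d_{\mathcal{X}}(\cdot,x_0)^p$ for some $x_0\in\mathcal{X}$ and $p\ge1$, where $d_{\mathcal{X}}$ is a metric compatible with the topology of $\mathcal{X}$. Reference agent. For a deterministic sequence $\delta=(\delta_t)_{t=0}^{T}$, $\delta_t=(\delta^c_t,\delta^s_t)\in\mathcal{P}(\mathcal{A})\times\mathcal{P}(\mathcal{X})$, the state and action processes satisfy $x_0\sim\mu_0$, $a_t\sim\pi_t$ for $t=0,\dots,T$, and $x_{t+1}\sim\rho(\cdot|x_t,a_t,\delta_t)$ for $t=0,\dots,T-1$. A policy $\pi=(\pi_t)_{t=0}^{T}$ is a sequence of $\mathcal{P}(\mathcal{A})$-valued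 random measures adapted to the filtration of the state process; $\Pi$ is the set of policies. It is Markov if each $\pi_t=\pi_t(\cdot|x_t)$ is measurable with respect to $\sigma(x_t)$; $\mathbb{M}$ is the set of Markov policies. The cost is $J(\pi,\delta)=E^{\pi}\big[\sum_{t=0}^{T-1}c(x_t,a_t,\delta_t)+\phi(x_T,\delta_T)\big]$. $\Phi(\delta)$ is the set of $\pi\in\Pi$ minimizing $J(\cdot,\delta)$ over $\Pi$. For a policy $\pi$, $\Lambda(\pi)=(\delta_t^c,\delta_t^s)_{t=0}^{T}$ is defined iteratively by $\delta^s_0=\mu_0$, $\delta_t^c(\cdot)=\int_{\mathcal{X}}\mathcal{P}^\pi_t(\cdot|x)\,\delta_t^s(dx)$, and $\delta_{t+1}^s(\cdot)=\int_{\mathcal{X}}\int_{\mathcal{A}}\rho(\cdot|x,a,\delta_t)\,\mathcal{P}^\pi_t(da|x)\,\delta^s_t(dx)$, where $\mathcal{P}^\pi_t(\cdot|x)$ is the conditional law of $a_t$ given $x_t=x$ (equal to $\pi_t(\cdot|x)$ for Markov $\pi$). An MFG equilibrium is a pair $(\pi,\delta)\in\mathbb{M}\times(\mathcal{P}(\mathcal{A})\times\mathcal{P}(\mathcal{X}))^{T+1}$ with $\pi\in\Phi(\delta)$ and $\delta=\Lambda(\pi)$. *)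

theory Defs
  imports "HOL-Probability.Probability"
begin

section \<open>Probability measures with the topology of weak convergence\<close>

abbreviation borel_probs :: "'s::topological_space measure set" where
  "borel_probs \<equiv> space (prob_algebra borel)"

text \<open>
  The coarsest topology on the Borel probability measures for which integration of every bounded
  continuous real function is continuous. See \<open>limitin_weak_topology\<close> for its convergent sequences.
\<close>

definition weak_topology :: "'s::topological_space measure topology" where
  "weak_topology = topology_generated_by
     {{M \<in> borel_probs. (\<integral>x. f x \<partial>M) \<in> U} | (f :: 's \<Rightarrow> real) (U :: real set).
        continuous_on UNIV f \<and> bounded (range f) \<and> open U}"

lemma topspace_weak_topology [simp]:
  "topspace (weak_topology :: 's::topological_space measure topology) = borel_probs"
proof -
  have "borel_probs = {M \<in> borel_probs. (\<integral>x. (\<lambda>_::'s. 0::real) x \<partial>M) \<in> UNIV}"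
    by simp
  moreover have "continuous_on UNIV (\<lambda>_::'s. 0::real)" "bounded (range (\<lambda>_::'s. 0::real))"
    "open (UNIV::real set)"
    by (auto simp: image_constant_conv)
  ultimately have "(borel_probs :: 's measure set) \<in>
     {{M \<in> borel_probs. (\<integral>x. f x \<partial>M) \<in> U} | (f :: 's \<Rightarrow> real) (U :: real set).
        continuous_on UNIV f \<and> bounded (range f) \<and> open U}"
    by blast
  then show ?thesis
    unfolding weak_topology_def topology_generated_by_topspace by blast
qed

lemma limitin_weak_topology:
  fixes M :: "'i \<Rightarrow> 's::topological_space measure"
  shows "limitin weak_topology M N F \<longleftrightarrow>
    N \<in> borel_probs \<and> (\<forall>\<^sub>F i in F. M i \<in> borel_probs) \<and>
    (\<forall>f :: 's \<Rightarrow> real. continuous_on UNIV f \<longrightarrow> bounded (range f) \<longrightarrow>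
        ((\<lambda>i. \<integral>x. f x \<partial>M i) \<longlongrightarrow> (\<integral>x. f x \<partial>N)) F)"
    (is "?L \<longleftrightarrow> ?R")
proof
  assume L: ?L
  have N: "N \<in> borel_probs" using limitin_topspace[OF L] by simp
  have "\<forall>\<^sub>F i in F. M i \<in> borel_probs"
    using L openin_topspace[of "weak_topology :: 's measure topology"] N
    unfolding limitin_def by (metis topspace_weak_topology)
  moreover have "((\<lambda>i. \<integral>x. f x \<partial>M i) \<longlongrightarrow> (\<integral>x. f x \<partial>N)) F"
    if f: "continuous_on UNIV f" "bounded (range f)" for f :: "'s \<Rightarrow> real"
  proof (rule topological_tendstoI)
    fix U :: "real set" assume U: "open U" "(\<integral>x. f x \<partial>N) \<in> U"
    have "openin weak_topology {M \<in> borel_probs. (\<integral>x. f x \<partial>M) \<in> U}"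
      unfolding weak_topology_def using f U by (intro topology_generated_by_Basis) blast
    moreover have "N \<in> {M \<in> borel_probs. (\<integral>x. f x \<partial>M) \<in> U}" using N U by simp
    ultimately have "\<forall>\<^sub>F i in F. M i \<in> {M \<in> borel_probs. (\<integral>x. f x \<partial>M) \<in> U}"
      using L unfolding limitin_def by blast
    then show "\<forall>\<^sub>F i in F. (\<integral>x. f x \<partial>M i) \<in> U"
      by (rule eventually_mono) simp
  qed
  ultimately show ?R using N by blast
next
  assume R: ?R
  have "\<forall>\<^sub>F i in F. M i \<in> W"
    if W: "generate_topology_on
        {{M \<in> borel_probs. (\<integral>x. f x \<partial>M) \<in> U} | (f :: 's \<Rightarrow> real) (U :: real set).
        continuous_on UNIV f \<and> bounded (range f) \<and> open U} W" "N \<in> W" for W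
    using W
  proof (induction rule: generate_topology_on.induct)
    case (Int a b)
    then show ?case by (auto intro: eventually_conj)
  next
    case (UN K)
    then obtain k where "k \<in> K" "N \<in> k" by blast
    with UN have "\<forall>\<^sub>F i in F. M i \<in> k" by blast
    then show ?case by (rule eventually_mono) (use \<open>k \<in> K\<close> in blast)
  next
    case (Basis s)
    then obtain f :: "'s \<Rightarrow> real" and U where s: "s = {M \<in> borel_probs. (\<integral>x. f x \<partial>M) \<in> U}"
      and f: "continuous_on UNIV f" "bounded (range f)" and U: "open U" by blast
    have "((\<lambda>i. \<integral>x. f x \<partial>M i) \<longlongrightarrow> (\<integral>x. f x \<partial>N)) F" using R f by blast
    then have "\<forall>\<^sub>F i in F. (\<integral>x. f x \<partial>M i) \<in> U"
      by (rule topological_tendstoD) (use Basis s U in auto)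
    moreover have "\<forall>\<^sub>F i in F. M i \<in> borel_probs" using R by blast
    ultimately show ?case unfolding s by eventually_elim simp
  qed auto
  then show ?L
    using R unfolding limitin_def topspace_weak_topology
    by (simp add: weak_topology_def openin_topology_generated_by_iff)
qed

section \<open>Moment functions\<close>

text \<open>
  The infimum is taken in the extended reals, so it is \<open>\<infinity>\<close> when \<open>H n\<close> is the whole space. The metric
  \<open>d\<close> is any metric inducing the topology, not necessarily the one of the type class.
\<close>

definition continuous_moment_function :: "('x::polish_space \<Rightarrow> real) \<Rightarrow> bool" where
  "continuous_moment_function w \<longleftrightarrow>
     continuous_on UNIV w \<and> (\<forall>x. 1 \<le> w x) \<and>
     (\<exists>H :: nat \<Rightarrow> 'x set. incseq H \<and> (\<forall>n. compact (H n)) \<and>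
        (\<lambda>n. INF x \<in> - H n. ereal (w x)) \<longlonglongrightarrow> \<infinity>) \<and>
     (\<exists>d x0 p. Metric_space UNIV d \<and> Metric_space.mtopology UNIV d = (euclidean :: 'x topology) \<and>
        1 \<le> p \<and> (\<forall>x. 1 + d x x0 powr p \<le> w x))"

section \<open>The model\<close>

text \<open>
  Only the values at times up to the horizon \<open>T\<close> of a flow \<open>\<delta>\<close> or a policy \<open>\<pi>\<close> are ever used. The
  first component of \<open>\<delta> t\<close> is the law \<open>\<delta>\<^sup>c\<close> on actions, the second the law \<open>\<delta>\<^sup>s\<close> on states. Since a
  policy is adapted to the filtration of the state process, \<open>\<pi> t\<close> is a function of the states up
  to time \<open>t\<close>.
\<close>

type_synonym ('x, 'a) flow = "nat \<Rightarrow> 'a measure \<times> 'x measure"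
type_synonym ('x, 'a) policy = "nat \<Rightarrow> (nat \<Rightarrow> 'x) \<Rightarrow> 'a measure"
type_synonym ('x, 'a) kernel = "'x \<times> 'a \<times> 'a measure \<times> 'x measure \<Rightarrow> 'x measure"
type_synonym ('x, 'a) running_cost = "'x \<times> 'a \<times> 'a measure \<times> 'x measure \<Rightarrow> real"
type_synonym ('x, 'a) terminal_cost = "'x \<times> 'a measure \<times> 'x measure \<Rightarrow> real"

definition transition_kernel ::
  "('x::polish_space, 'a::polish_space) kernel \<Rightarrow> bool" where
  "transition_kernel \<rho> \<longleftrightarrow>
     \<rho> \<in> (borel \<Otimes>\<^sub>M borel \<Otimes>\<^sub>M prob_algebra borel \<Otimes>\<^sub>M prob_algebra borel)
          \<rightarrow>\<^sub>M prob_algebra borel"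

definition arg_topology ::
  "('x::polish_space \<times> 'a::polish_space \<times> 'a measure \<times> 'x measure) topology" where
  "arg_topology = prod_topology euclidean (prod_topology euclidean
                    (prod_topology weak_topology weak_topology))"

definition terminal_arg_topology ::
  "('x::polish_space \<times> 'a::polish_space measure \<times> 'x measure) topology" where
  "terminal_arg_topology = prod_topology euclidean (prod_topology weak_topology weak_topology)"

definition policies :: "nat \<Rightarrow> ('x::polish_space, 'a::polish_space) policy set" where
  "policies T = {\<pi>. \<forall>t\<le>T. \<pi> t \<in> PiM {..t} (\<lambda>_. borel) \<rightarrow>\<^sub>M prob_algebra borel}"

definition markov_policies :: "nat \<Rightarrow> ('x::polish_space, 'a::polish_space) policy set" where
  "markov_policies T = {\<pi> \<in> policies T. \<forall>t\<le>T. \<exists>\<kappa> \<in> borel \<rightarrow>\<^sub>M prob_algebra borel.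
     \<forall>h \<in> space (PiM {..t} (\<lambda>_. borel)). \<pi> t h = \<kappa> (h t)}"

abbreviation path_algebra ::
  "nat \<Rightarrow> ((nat \<Rightarrow> 'x::polish_space) \<times> (nat \<Rightarrow> 'a::polish_space)) measure" where
  "path_algebra t \<equiv> PiM {..t} (\<lambda>_. borel) \<Otimes>\<^sub>M PiM {..t} (\<lambda>_. borel)"

text \<open>
  The joint law of the states \<open>x\<^sub>0, \<dots>, x\<^sub>t\<close> and actions \<open>a\<^sub>0, \<dots>, a\<^sub>t\<close> of the reference agent.
\<close>

primrec path_law ::
  "'x::polish_space measure \<Rightarrow> ('x, 'a::polish_space) kernel \<Rightarrow> ('x, 'a) flow \<Rightarrow> ('x, 'a) policy \<Rightarrow>
   nat \<Rightarrow> ((nat \<Rightarrow> 'x) \<times> (nat \<Rightarrow> 'a)) measure" where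
  "path_law \<mu>0 \<rho> \<delta> \<pi> 0 =
     \<mu>0 \<bind> (\<lambda>x. \<pi> 0 (\<lambda>i\<in>{..0}. x) \<bind> (\<lambda>a.
       return (path_algebra 0) (\<lambda>i\<in>{..0}. x, \<lambda>i\<in>{..0}. a)))"
| "path_law \<mu>0 \<rho> \<delta> \<pi> (Suc t) =
     path_law \<mu>0 \<rho> \<delta> \<pi> t \<bind> (\<lambda>(xs, as). \<rho> (xs t, as t, \<delta> t) \<bind> (\<lambda>x.
       \<pi> (Suc t) (xs(Suc t := x)) \<bind> (\<lambda>a.
         return (path_algebra (Suc t)) (xs(Suc t := x), as(Suc t := a)))))"

definition cost ::
  "nat \<Rightarrow> 'x::polish_space measure \<Rightarrow> ('x, 'a::polish_space) kernel \<Rightarrow>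
   ('x, 'a) running_cost \<Rightarrow> ('x, 'a) terminal_cost \<Rightarrow>
   ('x, 'a) policy \<Rightarrow> ('x, 'a) flow \<Rightarrow> ennreal" where
  "cost T \<mu>0 \<rho> c \<phi> \<pi> \<delta> =
     (\<integral>\<^sup>+ (xs, as). ennreal ((\<Sum>t<T. c (xs t, as t, \<delta> t)) + \<phi> (xs T, \<delta> T))
        \<partial>path_law \<mu>0 \<rho> \<delta> \<pi> T)"

definition optimal_policies ::
  "nat \<Rightarrow> 'x::polish_space measure \<Rightarrow> ('x, 'a::polish_space) kernel \<Rightarrow>
   ('x, 'a) running_cost \<Rightarrow> ('x, 'a) terminal_cost \<Rightarrow>
   ('x, 'a) flow \<Rightarrow> ('x, 'a) policy set" where
  "optimal_policies T \<mu>0 \<rho> c \<phi> \<delta> =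
     {\<pi> \<in> policies T. \<forall>\<pi>' \<in> policies T. cost T \<mu>0 \<rho> c \<phi> \<pi> \<delta> \<le> cost T \<mu>0 \<rho> c \<phi> \<pi>' \<delta>}"

definition state_action_law ::
  "'x::polish_space measure \<Rightarrow> ('x, 'a::polish_space) kernel \<Rightarrow> ('x, 'a) flow \<Rightarrow> ('x, 'a) policy \<Rightarrow>
   nat \<Rightarrow> ('x \<times> 'a) measure" where
  "state_action_law \<mu>0 \<rho> \<delta> \<pi> t =
     distr (path_law \<mu>0 \<rho> \<delta> \<pi> t) (borel \<Otimes>\<^sub>M borel) (\<lambda>(xs, as). (xs t, as t))"

text \<open>\<open>K\<close> is a regular version of the conditional law of \<open>a\<^sub>t\<close> given \<open>x\<^sub>t\<close>.\<close>

definition is_conditional_action_law ::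
  "'x::polish_space measure \<Rightarrow> ('x, 'a::polish_space) kernel \<Rightarrow> ('x, 'a) flow \<Rightarrow> ('x, 'a) policy \<Rightarrow>
   nat \<Rightarrow> ('x \<Rightarrow> 'a measure) \<Rightarrow> bool" where
  "is_conditional_action_law \<mu>0 \<rho> \<delta> \<pi> t K \<longleftrightarrow>
     K \<in> borel \<rightarrow>\<^sub>M prob_algebra borel \<and>
     state_action_law \<mu>0 \<rho> \<delta> \<pi> t =
       distr (state_action_law \<mu>0 \<rho> \<delta> \<pi> t) borel fst \<bind>
         (\<lambda>x. K x \<bind> (\<lambda>a. return (borel \<Otimes>\<^sub>M borel) (x, a)))"

text \<open>
  The graph of the map \<open>\<Lambda>\<close>: the equations below determine \<open>\<delta> 0, \<dots>, \<delta> T\<close> iteratively, because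
  the law of \<open>(x\<^sub>t, a\<^sub>t)\<close>, hence \<open>K t\<close>, involves only \<open>\<delta> 0, \<dots>, \<delta> (t - 1)\<close>.
\<close>

definition is_mean_field_flow ::
  "nat \<Rightarrow> 'x::polish_space measure \<Rightarrow> ('x, 'a::polish_space) kernel \<Rightarrow>
   ('x, 'a) policy \<Rightarrow> ('x, 'a) flow \<Rightarrow> bool" where
  "is_mean_field_flow T \<mu>0 \<rho> \<pi> \<delta> \<longleftrightarrow>
     (\<exists>K. (\<forall>t\<le>T. is_conditional_action_law \<mu>0 \<rho> \<delta> \<pi> t (K t)) \<and>
        snd (\<delta> 0) = \<mu>0 \<and>
        (\<forall>t\<le>T. fst (\<delta> t) = snd (\<delta> t) \<bind> K t) \<and>
        (\<forall>t<T. snd (\<delta> (Suc t)) =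
           snd (\<delta> t) \<bind> (\<lambda>x. K t x \<bind> (\<lambda>a. \<rho> (x, a, \<delta> t)))))"

definition mfg_equilibrium ::
  "nat \<Rightarrow> 'x::polish_space measure \<Rightarrow> ('x, 'a::polish_space) kernel \<Rightarrow>
   ('x, 'a) running_cost \<Rightarrow> ('x, 'a) terminal_cost \<Rightarrow>
   ('x, 'a) policy \<Rightarrow> ('x, 'a) flow \<Rightarrow> bool" where
  "mfg_equilibrium T \<mu>0 \<rho> c \<phi> \<pi> \<delta> \<longleftrightarrow>
     \<pi> \<in> markov_policies T \<and>
     (\<forall>t\<le>T. \<delta> t \<in> borel_probs \<times> borel_probs) \<and>
     \<pi> \<in> optimal_policies T \<mu>0 \<rho> c \<phi> \<delta> \<and>
     is_mean_field_flow T \<mu>0 \<rho> \<pi> \<delta>"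

end

theory Submission
  imports Defs
begin

text \<open>
  An equilibrium is obtained as a limit of approximate equilibria that come from Brouwer's theorem.
  Write \<open>Q\<close> and \<open>V\<close> for the action values and the values of the dynamic programming recursion against a
  flow. At level \<open>m\<close> the agent mixes over those of the first \<open>m\<close> points of a dense sequence of actions whose
  \<open>Q\<close>-value is within \<open>1 / m\<close> of the minimum, with weights that are continuous in the state and the flow,
  and sees only a discretization of the flow, which is given by finitely many numbers
  \<open>\<integral> \<psi> \<partial>\<nu> t\<close> for a partition of unity \<open>\<psi>\<close>. So the response is a continuous self-map of a finite-dimensional cube
  and has a fixed point. Along a subsequence the joint laws \<open>\<nu> t\<close> of state and action converge, one time after
  the other: convergence up to time \<open>t\<close> makes the next state law converge, and actions are compact. Fatou's
  lemma for weakly convergent measures shows that \<open>Q = V\<close> holds almost surely under the limit, which is then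
  disintegrated into a Markov policy; dynamic programming shows that this policy is optimal among all policies.
\<close>

section \<open>Brouwer's fixed point theorem on the cube\<close>

text \<open>Exact best responses are set-valued, and neither policies nor laws on a noncompact state
  space range over an evidently compact set; hence a continuous finite-dimensional substitute and a
  limit. The unknowns are joint laws of state and action and not policies: kernels have no useful
  pointwise limits, whereas laws have weak limits from which a kernel can be recovered. In the limit
  the flow, the transitions, the costs and the values vary together. Values are therefore tracked by
  continuous convergence (\<open>cont_conv\<close>), which survives integration against weakly
  convergent measures and minimization over a compact set. Costs may be unbounded, and then weak
  convergence alone does not carry expectations to the limit; the bound by a multiple of
  \<open>v\<close>, together with convergence of the integrals of \<open>v\<close>, does. For the
  regret, which is nonnegative, a one-sided estimate is enough. The function \<open>w\<close> serves
  compactness: its sublevel sets are compact, and tightness is inherited from state laws known to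
  converge.\<close>

lemma finite_diagonal_subsequence:
  fixes P :: "nat \<Rightarrow> (nat \<Rightarrow> nat) \<Rightarrow> bool"
  assumes refine: "\<And>i r. i < n \<Longrightarrow> strict_mono r \<Longrightarrow> (\<And>j. j < i \<Longrightarrow> P j r) \<Longrightarrow>
      \<exists>s. strict_mono s \<and> P i (r \<circ> s)"
    and inherit: "\<And>i r s. P i r \<Longrightarrow> strict_mono s \<Longrightarrow> P i (r \<circ> s)"
  shows "\<exists>r. strict_mono r \<and> (\<forall>i<n. P i r)"
  using refine
proof (induction n)
  case 0
  show ?case by (auto intro!: exI[of _ id] simp: strict_mono_def)
next
  case (Suc n)
  then obtain r where r: "strict_mono r" "\<And>i. i < n \<Longrightarrow> P i r"
    by (metis less_SucI)
  \<comment> \<open>The refinement at \<open>n\<close> may rely on the properties secured below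
    \<open>n\<close>; this later allows compactness to be proved one time at a time.\<close>
  then obtain s where "strict_mono s" "P n (r \<circ> s)"
    using Suc.prems[of n r] by blast
  with r show ?case
    by (intro exI[of _ "r \<circ> s"] conjI strict_mono_o) (auto simp only: less_Suc_eq intro: inherit)
qed

lemma unit_cube_convergent_subsequence:
  fixes x :: "nat \<Rightarrow> nat \<Rightarrow> real"
  assumes "\<And>k i. i < n \<Longrightarrow> x k i \<in> {0..1}"
  shows "\<exists>r l. strict_mono r \<and> (\<forall>i<n. l i \<in> {0..1} \<and> (\<lambda>k. x (r k) i) \<longlonglongrightarrow> l i)"
proof -
  define P where "P i r \<longleftrightarrow> (\<exists>l\<in>{0..1}. (\<lambda>k. x (r k) i) \<longlonglongrightarrow> l)" for i and r :: "nat \<Rightarrow> nat"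
  have "\<exists>r. strict_mono r \<and> (\<forall>i<n. P i r)"
  proof (rule finite_diagonal_subsequence)
    fix i and r :: "nat \<Rightarrow> nat" assume "i < n"
    then have "\<forall>k. x (r k) i \<in> {0..1}" using assms by blast
    then obtain l s where "l \<in> {0..1}" "strict_mono s" "((\<lambda>k. x (r k) i) \<circ> s) \<longlonglongrightarrow> l"
      using compact_Icc[of 0 "1::real"] unfolding compact_def by meson
    then show "\<exists>s. strict_mono s \<and> P i (r \<circ> s)"
      unfolding P_def o_def by blast
  next
    fix i and r s :: "nat \<Rightarrow> nat" assume "P i r" "strict_mono s"
    then show "P i (r \<circ> s)"
      unfolding P_def using LIMSEQ_subseq_LIMSEQ by (fastforce simp: o_def)
  qed
  then show ?thesis unfolding P_def by metis
qed

text \<open>Kuhn's labelling lemma yields, for each mesh, a cell on which every coordinate is pushed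
  both up and down by \<open>G\<close>. The cells shrink to a point along a subsequence, and there
  continuity forces \<open>G l i - l i\<close> to be both nonnegative and nonpositive. The dimension
  is a number and not a type because it grows with the level of approximation.\<close>

theorem brouwer_unit_cube:
  fixes G :: "(nat \<Rightarrow> real) \<Rightarrow> nat \<Rightarrow> real"
  assumes into: "\<And>q i. (\<And>j. j < n \<Longrightarrow> q j \<in> {0..1}) \<Longrightarrow> i < n \<Longrightarrow> G q i \<in> {0..1}"
    and cont: "\<And>Q q i. (\<And>k j. j < n \<Longrightarrow> Q k j \<in> {0..1}) \<Longrightarrow> (\<And>j. j < n \<Longrightarrow> q j \<in> {0..1}) \<Longrightarrow>
      (\<And>j. j < n \<Longrightarrow> (\<lambda>k. Q k j) \<longlonglongrightarrow> q j) \<Longrightarrow> i < n \<Longrightarrow> (\<lambda>k. G (Q k) i) \<longlonglongrightarrow> G q i"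
  shows "\<exists>q. \<forall>i<n. q i \<in> {0..1} \<and> G q i = q i"
proof -
  define sc where "sc p x i = real (x i) / real p" for p :: nat and x :: "nat \<Rightarrow> nat" and i :: nat
  \<comment> \<open>Label 0 marks a coordinate that \<open>G\<close> does not decrease, label 1 one
    that it does not increase. The first two cases impose the face labels that Kuhn's lemma asks
    for; they agree with this reading because \<open>G\<close> stays in the cube.\<close>
  define label where "label p x i =
      (if x i = 0 then 0 else if x i = p then 1 else if sc p x i \<le> G (sc p x) i then 0 else (1::nat))"
    for p x i
  have lab: "(label p x i = 0 \<longrightarrow> sc p x i \<le> G (sc p x) i) \<and> (label p x i \<noteq> 0 \<longrightarrow> G (sc p x) i \<le> sc p x i)"
    if "0 < p" "\<And>j. j < n \<Longrightarrow> x j \<le> p" "i < n" for p x i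
  proof -
    have "sc p x j \<in> {0..1}" if "j < n" for j
      using that \<open>0 < p\<close> \<open>\<And>j. j < n \<Longrightarrow> x j \<le> p\<close>[of j] by (simp add: sc_def)
    then have "G (sc p x) i \<in> {0..1}" using into that by blast
    then show ?thesis using that by (auto simp: label_def sc_def)
  qed
  define cell where "cell p q i r s \<longleftrightarrow> label (Suc p) r i = 0 \<and> label (Suc p) s i \<noteq> 0 \<and>
       (\<forall>j<n. q j \<le> r j \<and> r j \<le> q j + 1 \<and> q j \<le> s j \<and> s j \<le> q j + 1)" for p q i r s
  have "\<exists>q. (\<forall>i<n. q i < Suc p) \<and> (\<forall>i<n. \<exists>r s. cell p q i r s)" for p
  proof -
    obtain q where q: "\<forall>i<n. q i < Suc p"
      and *: "\<forall>i<n. \<exists>r s. (\<forall>j<n. q j \<le> r j \<and> r j \<le> q j + 1) \<and> (\<forall>j<n. q j \<le> s j \<and> s j \<le> q j + 1) \<and>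
          label (Suc p) r i \<noteq> label (Suc p) s i"
      by (rule kuhn_lemma[of "Suc p" n "label (Suc p)"]) (auto simp: label_def)
    have "\<exists>r s. cell p q i r s" if i: "i < n" for i
    proof -
      obtain r s where rs: "\<forall>j<n. q j \<le> r j \<and> r j \<le> q j + 1" "\<forall>j<n. q j \<le> s j \<and> s j \<le> q j + 1"
          "label (Suc p) r i \<noteq> label (Suc p) s i"
        using * i by blast
      show ?thesis
      proof (cases "label (Suc p) r i = 0")
        case True
        with rs have "cell p q i r s" by (simp add: cell_def)
        then show ?thesis by blast
      next
        case False
        then have "label (Suc p) s i = 0" using rs(3) by (auto simp: label_def split: if_splits)
        with False rs have "cell p q i s r" by (simp add: cell_def)
        then show ?thesis by blast
      qed
    qed
    with q show ?thesis by blast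
  qed
  then obtain q where q: "\<And>p i. i < n \<Longrightarrow> q p i < Suc p"
    and "\<forall>p i. \<exists>r s. i < n \<longrightarrow> cell p (q p) i r s"
    by metis
  then obtain r s where rs: "\<And>p i. i < n \<Longrightarrow> cell p (q p) i (r p i) (s p i)"
    by metis
  have lr: "\<And>p i. i < n \<Longrightarrow> label (Suc p) (r p i) i = 0"
    and ls: "\<And>p i. i < n \<Longrightarrow> label (Suc p) (s p i) i \<noteq> 0"
    and br: "\<And>p i j. i < n \<Longrightarrow> j < n \<Longrightarrow> q p j \<le> r p i j \<and> r p i j \<le> q p j + 1"
    and bs: "\<And>p i j. i < n \<Longrightarrow> j < n \<Longrightarrow> q p j \<le> s p i j \<and> s p i j \<le> q p j + 1"
    using rs unfolding cell_def by blast+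
  have "sc (Suc p) (q p) i \<in> {0..1}" if "i < n" for p i
    using q[OF that, of p] by (simp add: sc_def)
  then obtain u l where u: "strict_mono u"
    and l: "\<And>i. i < n \<Longrightarrow> l i \<in> {0..1} \<and> (\<lambda>k. sc (Suc (u k)) (q (u k)) i) \<longlonglongrightarrow> l i"
    using unit_cube_convergent_subsequence[of n "\<lambda>p. sc (Suc p) (q p)"] by metis
  have close: "(\<lambda>k. sc (Suc (u k)) (y (u k)) j) \<longlonglongrightarrow> l j"
    if y: "\<And>p. q p j \<le> y p j \<and> y p j \<le> q p j + 1" and j: "j < n" for y j
  proof (rule tendsto_sandwich[OF _ _ conjunct2[OF l[OF j]]])
    show "\<forall>\<^sub>F k in sequentially. sc (Suc (u k)) (q (u k)) j \<le> sc (Suc (u k)) (y (u k)) j"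
      using y by (intro always_eventually allI) (simp add: sc_def divide_right_mono)
    have "sc (Suc (u k)) (y (u k)) j \<le> sc (Suc (u k)) (q (u k)) j + inverse (real (Suc (u k)))" for k
    proof -
      have "real (y (u k) j) \<le> real (q (u k) j) + 1" using y[of "u k"] by linarith
      then show ?thesis unfolding sc_def inverse_eq_divide add_divide_distrib[symmetric]
        by (rule divide_right_mono) simp
    qed
    then show "\<forall>\<^sub>F k in sequentially. sc (Suc (u k)) (y (u k)) j
        \<le> sc (Suc (u k)) (q (u k)) j + inverse (real (Suc (u k)))" by simp
    have "(\<lambda>k. inverse (real (Suc (u k)))) \<longlonglongrightarrow> 0"
      using LIMSEQ_subseq_LIMSEQ[OF LIMSEQ_inverse_real_of_nat u] by (simp add: o_def)
    then show "(\<lambda>k. sc (Suc (u k)) (q (u k)) j + inverse (real (Suc (u k)))) \<longlonglongrightarrow> l j"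
      using tendsto_add[OF conjunct2[OF l[OF j]]] by fastforce
  qed
  have "G l i = l i" if i: "i < n" for i
  proof (rule antisym)
    have grid: "y p j \<le> Suc p" "sc (Suc p) (y p) j \<in> {0..1}"
      if "j < n" "\<And>p. q p j \<le> y p j \<and> y p j \<le> q p j + 1" for y p j
    proof -
      show "y p j \<le> Suc p" using that(2)[of p] q[OF that(1), of p] by linarith
      then show "sc (Suc p) (y p) j \<in> {0..1}" by (simp add: sc_def)
    qed
    have lim: "(\<lambda>k. G (sc (Suc (u k)) (y (u k))) i) \<longlonglongrightarrow> G l i"
      if "\<And>p j. j < n \<Longrightarrow> q p j \<le> y p j \<and> y p j \<le> q p j + 1" for y
      using that i l close[of _ y] grid[of _ y] by (intro cont) auto
    show "G l i \<le> l i"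
    proof (rule LIMSEQ_le[OF lim[of "\<lambda>p. s p i"] close[of i "\<lambda>p. s p i"]])
      show "\<exists>N. \<forall>k\<ge>N. G (sc (Suc (u k)) (s (u k) i)) i \<le> sc (Suc (u k)) (s (u k) i) i"
        using lab[of "Suc (u _)" "s (u _) i" i] ls i bs grid(1)[of _ "\<lambda>p. s p i"] by auto
    qed (use bs i in auto)
    show "l i \<le> G l i"
    proof (rule LIMSEQ_le[OF close[of i "\<lambda>p. r p i"] lim[of "\<lambda>p. r p i"]])
      show "\<exists>N. \<forall>k\<ge>N. sc (Suc (u k)) (r (u k) i) i \<le> G (sc (Suc (u k)) (r (u k) i)) i"
        using lab[of "Suc (u _)" "r (u _) i" i] lr i br grid(1)[of _ "\<lambda>p. r p i"] by auto
    qed (use br i in auto)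
  qed
  with l show ?thesis by blast
qed

section \<open>Weak convergence and continuous convergence\<close>

text \<open>Continuous convergence: the argument moves along with the index. For a constant sequence
  on a metric space it amounts to continuity, and unlike pointwise convergence it passes through
  integrals and minima in which everything varies.\<close>

definition cont_conv :: "(nat \<Rightarrow> 's::topological_space \<Rightarrow> 'b::topological_space) \<Rightarrow> ('s \<Rightarrow> 'b) \<Rightarrow> bool" where
  "cont_conv F f \<longleftrightarrow> (\<forall>x l. x \<longlonglongrightarrow> l \<longrightarrow> (\<lambda>k. F k (x k)) \<longlonglongrightarrow> f l)"

lemma cont_convD: "cont_conv F f \<Longrightarrow> x \<longlonglongrightarrow> l \<Longrightarrow> (\<lambda>k. F k (x k)) \<longlonglongrightarrow> f l"
  by (simp add: cont_conv_def)

lemma cont_conv_const: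
  "continuous_on UNIV f \<Longrightarrow> cont_conv (\<lambda>_. f) f"
  by (auto simp: cont_conv_def intro: continuous_on_tendsto_compose)

lemma continuous_on_cont_conv:
  fixes f :: "'s::metric_space \<Rightarrow> 'b::topological_space"
  shows "cont_conv (\<lambda>_. f) f \<Longrightarrow> continuous_on UNIV f"
  by (simp add: cont_conv_def continuous_on_sequentially o_def)

lemma cont_conv_subseq:
  fixes r :: "nat \<Rightarrow> nat"
  assumes F: "cont_conv F f" and r: "strict_mono r" and x: "x \<longlonglongrightarrow> l"
  shows "(\<lambda>k. F (r k) (x k)) \<longlonglongrightarrow> f l"
proof -
  \<comment> \<open>The indices skipped by \<open>r\<close> receive the value \<open>l\<close>, so
    that \<open>y\<close> converges along the whole sequence and takes the value \<open>x k\<close>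
    at \<open>r k\<close>.\<close>
  define y where "y n = (if n \<in> range r then x (inv r n) else l)" for n
  have inj: "inj r" using r strict_mono_imp_inj_on by blast
  have "y \<longlonglongrightarrow> l"
  proof (rule topological_tendstoI)
    fix U assume "open U" "l \<in> U"
    then obtain N where N: "\<And>k. N \<le> k \<Longrightarrow> x k \<in> U"
      using topological_tendstoD[OF x] unfolding eventually_sequentially by blast
    have "y n \<in> U" if "r N \<le> n" for n
      using that N \<open>l \<in> U\<close> inj strict_mono_less_eq[OF r] by (auto simp: y_def)
    then show "\<forall>\<^sub>F n in sequentially. y n \<in> U" unfolding eventually_sequentially by blast
  qed
  from LIMSEQ_subseq_LIMSEQ[OF cont_convD[OF F this] r]
  show ?thesis by (simp add: o_def y_def inj)
qed

text \<open>If uniformity near \<open>l\<close> failed, counterexamples with strictly increasing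
  indices could be chosen ever closer to \<open>l\<close>; they would tend to \<open>l\<close> along
  a subsequence of the indices, against continuous convergence.\<close>

lemma cont_conv_locally_uniform:
  fixes F :: "nat \<Rightarrow> 's::metric_space \<Rightarrow> 'b::metric_space"
  assumes F: "cont_conv F f" and "0 < e"
  shows "\<exists>d>0. \<exists>N. \<forall>k\<ge>N. \<forall>y. dist y l < d \<longrightarrow> dist (F k y) (f l) < e"
proof (rule ccontr)
  assume "\<not> ?thesis"
  then have *: "\<exists>k\<ge>N. \<exists>y. dist y l < d \<and> \<not> dist (F k y) (f l) < e" if "0 < d" for d N
    using that by meson
  define P where "P n p \<longleftrightarrow> dist (snd p) l < inverse (real (Suc n)) \<and> \<not> dist (F (fst p) (snd p)) (f l) < e"
    for n and p :: "nat \<times> 's"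
  have "\<exists>p. P 0 p" using *[of "inverse (real (Suc 0))" 0] by (auto simp: P_def)
  moreover have "\<exists>q. P (Suc n) q \<and> fst p < fst q" for n p
    using *[of "inverse (real (Suc (Suc n)))" "Suc (fst p)"] unfolding P_def
    by (metis Suc_le_lessD fst_conv snd_conv inverse_positive_iff_positive of_nat_0_less_iff zero_less_Suc)
  ultimately obtain p where p: "\<And>n. P n (p n)" "\<And>n. fst (p n) < fst (p (Suc n))"
    using dependent_nat_choice[of P "\<lambda>_ x y. fst x < fst y"] by metis
  have "(\<lambda>n. snd (p n)) \<longlonglongrightarrow> l"
  proof (rule metric_LIMSEQ_I)
    fix d :: real assume "0 < d"
    then obtain n0 where n0: "inverse (real (Suc n0)) < d" using reals_Archimedean by blast
    have "dist (snd (p n)) l < d" if "n0 \<le> n" for n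
    proof -
      have "dist (snd (p n)) l < inverse (real (Suc n))" using p(1)[of n] by (simp add: P_def)
      also have "\<dots> \<le> inverse (real (Suc n0))" using that by (intro le_imp_inverse_le) auto
      finally show ?thesis using n0 by simp
    qed
    then show "\<exists>n0. \<forall>n\<ge>n0. dist (snd (p n)) l < d" by blast
  qed
  moreover have "strict_mono (\<lambda>n. fst (p n))" using p(2) by (simp add: strict_mono_Suc_iff)
  ultimately have "(\<lambda>n. F (fst (p n)) (snd (p n))) \<longlonglongrightarrow> f l"
    using cont_conv_subseq[OF F] by blast
  from metric_LIMSEQ_D[OF this \<open>0 < e\<close>] show False
    using p(1) by (auto simp: P_def)
qed

section \<open>Limit theorems for integrals under weak convergence\<close>

lemma prob_space_borel_probs: "M \<in> borel_probs \<Longrightarrow> prob_space M"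
  and sets_borel_probs: "M \<in> borel_probs \<Longrightarrow> sets M = sets borel"
  by (simp_all add: space_prob_algebra)

lemma borel_probs_integrable:
  fixes f :: "'s::topological_space \<Rightarrow> real"
  assumes "M \<in> borel_probs" "f \<in> borel_measurable borel" "\<And>x. \<bar>f x\<bar> \<le> B"
  shows "integrable M f"
proof -
  interpret prob_space M using assms prob_space_borel_probs by blast
  have "f \<in> borel_measurable M"
    using assms(2) sets_borel_probs[OF assms(1)] by (simp cong: measurable_cong_sets)
  then show ?thesis using assms(3) by (intro integrable_const_bound[where B=B]) auto
qed

lemma limitin_weak_topology_bounded:
  fixes f :: "'s::topological_space \<Rightarrow> real"
  assumes "limitin weak_topology M N F" "continuous_on UNIV f" "\<And>x. \<bar>f x\<bar> \<le> B"
  shows "((\<lambda>i. \<integral>x. f x \<partial>M i) \<longlongrightarrow> (\<integral>x. f x \<partial>N)) F"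
proof -
  have "bounded (range f)" using assms(3) by (auto simp: bounded_iff)
  then show ?thesis using assms unfolding limitin_weak_topology by blast
qed

lemma limitin_weak_topologyI:
  fixes M :: "nat \<Rightarrow> 's::topological_space measure"
  assumes "\<And>k. M k \<in> borel_probs" "N \<in> borel_probs"
    and "\<And>(f :: 's \<Rightarrow> real) B. continuous_on UNIV f \<Longrightarrow> (\<And>x. \<bar>f x\<bar> \<le> B) \<Longrightarrow>
      (\<lambda>k. \<integral>x. f x \<partial>M k) \<longlonglongrightarrow> (\<integral>x. f x \<partial>N)"
  shows "limitin weak_topology M N sequentially"
  unfolding limitin_weak_topology using assms by (auto simp: bounded_iff)

lemma limitin_weak_topology_const:
  fixes M :: "'s::topological_space measure"
  shows "M \<in> borel_probs \<Longrightarrow> limitin weak_topology (\<lambda>_::nat. M) M sequentially"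
  by (simp add: limitin_weak_topology)

lemma limitin_subseq:
  "limitin X M N sequentially \<Longrightarrow> strict_mono (r :: nat \<Rightarrow> nat) \<Longrightarrow> limitin X (M \<circ> r) N sequentially"
  unfolding limitin_def o_def using eventually_subseq[of r] by blast

text \<open>
  The functions \<open>h k\<close> below are \<open>k\<close>-Lipschitz minorants of all \<open>F m\<close> with \<open>m \<ge> k\<close>; continuous convergence
  makes them increase to a function above \<open>f\<close>.
\<close>

lemma weak_fatou:
  fixes F :: "nat \<Rightarrow> 's::metric_space \<Rightarrow> real"
  assumes F: "cont_conv F f" and nonneg: "\<And>k x. 0 \<le> F k x"
    and M: "\<And>k. M k \<in> borel_probs" and lim: "limitin weak_topology M N sequentially"
  shows "(\<integral>\<^sup>+x. ennreal (f x) \<partial>N) \<le> liminf (\<lambda>k. \<integral>\<^sup>+x. ennreal (F k x) \<partial>M k)"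
proof -
  have N: "N \<in> borel_probs" using limitin_topspace[OF lim] by simp
  define J where "J k = {k..} \<times> (UNIV :: 's set)" for k :: nat
  define g where "g k x = (INF p\<in>J k. F (fst p) (snd p) + real k * dist x (snd p))" for k x
  define h where "h k x = min (real k) (g k x)" for k x
  have bdd: "bdd_below ((\<lambda>p. F (fst p) (snd p) + real k * dist x (snd p)) ` J k)" for k x
    by (intro bdd_belowI[of _ 0]) (auto simp: nonneg)
  have ne: "J k \<noteq> {}" for k by (auto simp: J_def)
  have g_le: "g k x \<le> F m y + real k * dist x y" if "k \<le> m" for k m x y
    unfolding g_def using cINF_lower[OF bdd, of "(m, y)" k x] that by (auto simp: J_def)
  have g_nonneg: "0 \<le> g k x" for k x
    unfolding g_def by (intro cINF_greatest ne) (auto simp: nonneg)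
  have g_lip: "g k x \<le> g k y + real k * dist x y" for k x y
  proof -
    have "g k x - real k * dist x y \<le> g k y"
      unfolding g_def[of k y]
    proof (intro cINF_greatest ne)
      fix p assume "p \<in> J k"
      then have "g k x \<le> F (fst p) (snd p) + real k * dist x (snd p)"
        using g_le[of k "fst p" x "snd p"] by (auto simp: J_def)
      also have "\<dots> \<le> F (fst p) (snd p) + real k * (dist x y + dist y (snd p))"
        by (intro add_left_mono mult_left_mono dist_triangle) auto
      finally show "g k x - real k * dist x y \<le> F (fst p) (snd p) + real k * dist y (snd p)"
        by (simp add: algebra_simps)
    qed
    then show ?thesis by simp
  qed
  have "continuous_on UNIV (g k)" for k
  proof (rule lipschitz_on_continuous_on[where L="real k"], rule lipschitz_onI)
    show "dist (g k x) (g k y) \<le> real k * dist x y" for x y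
      using g_lip[of k x y] g_lip[of k y x] by (auto simp: dist_real_def dist_commute)
  qed simp
  then have h_cont: "continuous_on UNIV (h k)" for k
    unfolding h_def by (intro continuous_intros)
  then have h_meas: "h k \<in> borel_measurable borel" for k
    by (rule borel_measurable_continuous_onI)
  have h_bd: "0 \<le> h k x" "\<bar>h k x\<bar> \<le> real k" for k x
    using g_nonneg[of k x] by (auto simp: h_def)
  have h_le: "h k x \<le> F m x" if "k \<le> m" for k m x
    using g_le[OF that, of x x] by (simp add: h_def)
  have g_mono: "g k x \<le> g l x" if "k \<le> l" for k l x
    unfolding g_def[of l]
  proof (intro cINF_greatest ne)
    fix p assume "p \<in> J l"
    then have "g k x \<le> F (fst p) (snd p) + real k * dist x (snd p)"
      using that g_le[of k "fst p" x "snd p"] by (auto simp: J_def)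
    also have "\<dots> \<le> F (fst p) (snd p) + real l * dist x (snd p)"
      using that by (intro add_left_mono mult_right_mono) auto
    finally show "g k x \<le> F (fst p) (snd p) + real l * dist x (snd p)" .
  qed
  then have h_mono: "h k x \<le> h l x" if "k \<le> l" for k l x
    using that unfolding h_def by (meson min.mono of_nat_le_iff)
  have f_le: "ennreal (f x) \<le> (SUP k. ennreal (h k x))" for x
  proof (cases "f x \<le> 0")
    case True
    then show ?thesis by (simp add: ennreal_neg)
  next
    case False
    have "ennreal b \<le> (SUP k. ennreal (h k x))" if b: "0 < b" "b < f x" for b
    proof -
      have "0 < f x - b" using b by simp
      from cont_conv_locally_uniform[OF F this, of x] obtain d n0
        where d: "0 < d" "\<And>k y. n0 \<le> k \<Longrightarrow> dist y x < d \<Longrightarrow> dist (F k y) (f x) < f x - b"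
        by blast
      obtain n1 :: nat where n1: "b / d \<le> real n1" using real_arch_simple by blast
      obtain n2 :: nat where n2: "b \<le> real n2" using real_arch_simple by blast
      \<comment> \<open>This \<open>k\<close> is past the index of local uniformity, its slope lifts
        the penalty to at least \<open>b\<close> for points at distance \<open>d\<close> or more,
        and the cap \<open>k\<close> in \<open>h\<close> does not cut below
        \<open>b\<close>.\<close>
      define k where "k = max n0 (max n1 n2)"
      have k: "n0 \<le> k" "n1 \<le> k" "n2 \<le> k" by (auto simp: k_def)
      have "b \<le> real n1 * d" using n1 d(1) by (simp add: field_simps)
      also have "\<dots> \<le> real k * d" using k d(1) by (intro mult_right_mono) auto
      finally have k: "n0 \<le> k" "b \<le> real k * d" "b \<le> real k" using k n2 by auto
      have "b \<le> g k x" unfolding g_def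
      proof (intro cINF_greatest ne)
        fix p assume p: "p \<in> J k"
        show "b \<le> F (fst p) (snd p) + real k * dist x (snd p)"
        proof (cases "dist (snd p) x < d")
          case True
          have "n0 \<le> fst p" using p k(1) by (auto simp: J_def)
          from d(2)[OF this True] have "b \<le> F (fst p) (snd p)" by (simp add: dist_real_def abs_if split: if_splits)
          then show ?thesis by (smt (verit) mult_nonneg_nonneg of_nat_0_le_iff zero_le_dist)
        next
          case False
          then have "real k * d \<le> real k * dist x (snd p)"
            by (intro mult_left_mono) (auto simp: dist_commute)
          with k(2) nonneg[of "fst p" "snd p"] show ?thesis by linarith
        qed
      qed
      then have "b \<le> h k x" using k by (simp add: h_def)
      then show ?thesis by (meson SUP_upper2 UNIV_I ennreal_leI)
    qed
    note below = this
    show ?thesis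
    proof (rule dense_le)
      fix b assume b: "b < ennreal (f x)"
      then obtain r where r: "b = ennreal r" "0 \<le> r" by (cases b) auto
      then show "b \<le> (SUP k. ennreal (h k x))"
        using below[of r] b by (cases "r = 0") (auto simp: ennreal_less_iff)
    qed
  qed
  have step: "(\<integral>\<^sup>+x. ennreal (h k x) \<partial>N) \<le> liminf (\<lambda>k. \<integral>\<^sup>+x. ennreal (F k x) \<partial>M k)" for k
  proof -
    have eq: "(\<integral>\<^sup>+x. ennreal (h k x) \<partial>K) = ennreal (\<integral>x. h k x \<partial>K)" if "K \<in> borel_probs" for K
      by (intro nn_integral_eq_integral borel_probs_integrable[OF that h_meas h_bd(2)]) (simp add: h_bd)
    have "(\<lambda>m. \<integral>x. h k x \<partial>M m) \<longlonglongrightarrow> (\<integral>x. h k x \<partial>N)"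
      by (rule limitin_weak_topology_bounded[OF lim h_cont h_bd(2)])
    then have "(\<lambda>m. \<integral>\<^sup>+x. ennreal (h k x) \<partial>M m) \<longlonglongrightarrow> (\<integral>\<^sup>+x. ennreal (h k x) \<partial>N)"
      unfolding eq[OF M] eq[OF N] by (rule tendsto_ennrealI)
    then have "(\<integral>\<^sup>+x. ennreal (h k x) \<partial>N) = liminf (\<lambda>m. \<integral>\<^sup>+x. ennreal (h k x) \<partial>M m)"
      by (metis lim_imp_Liminf sequentially_bot)
    also have "\<dots> \<le> liminf (\<lambda>k. \<integral>\<^sup>+x. ennreal (F k x) \<partial>M k)"
      using h_le by (intro Liminf_mono eventually_sequentiallyI[of k] nn_integral_mono ennreal_leI)
    finally show ?thesis .
  qed
  have "(\<integral>\<^sup>+x. ennreal (f x) \<partial>N) \<le> (\<integral>\<^sup>+x. (SUP k. ennreal (h k x)) \<partial>N)"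
    by (intro nn_integral_mono f_le)
  also have "\<dots> = (SUP k. \<integral>\<^sup>+x. ennreal (h k x) \<partial>N)"
  proof (rule nn_integral_monotone_convergence_SUP)
    show "incseq (\<lambda>k x. ennreal (h k x))"
      using h_mono by (auto simp: incseq_def le_fun_def intro!: ennreal_leI)
    show "(\<lambda>x. ennreal (h k x)) \<in> borel_measurable N" for k
      using h_meas[of k] sets_borel_probs[OF N] by (simp cong: measurable_cong_sets)
  qed
  also have "\<dots> \<le> liminf (\<lambda>k. \<integral>\<^sup>+x. ennreal (F k x) \<partial>M k)"
    by (intro SUP_least step)
  finally show ?thesis .
qed

lemma weak_fatou_eventually:
  fixes F :: "nat \<Rightarrow> 's::metric_space \<Rightarrow> real"
  assumes F: "cont_conv F f" and nonneg: "\<And>k x. 0 \<le> F k x" "\<And>x. 0 \<le> f x"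
    and M: "\<And>k. M k \<in> borel_probs" and lim: "limitin weak_topology M N sequentially"
    and int: "\<And>k. integrable (M k) (F k)" "integrable N f" and b: "0 \<le> b" "b < (\<integral>x. f x \<partial>N)"
  shows "\<forall>\<^sub>F k in sequentially. b < (\<integral>x. F k x \<partial>M k)"
proof -
  have "ennreal (\<integral>x. f x \<partial>N) \<le> liminf (\<lambda>k. ennreal (\<integral>x. F k x \<partial>M k))"
    using weak_fatou[OF F nonneg(1) M lim] int nonneg by (simp add: nn_integral_eq_integral)
  moreover have "ennreal b < ennreal (\<integral>x. f x \<partial>N)" using b by (simp add: ennreal_less_iff)
  ultimately have "\<forall>\<^sub>F k in sequentially. ennreal b < ennreal (\<integral>x. F k x \<partial>M k)"
    unfolding le_Liminf_iff by blast
  then show ?thesis by eventually_elim (use b in \<open>simp add: ennreal_less_iff\<close>)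
qed

text \<open>The dominating function \<open>B\<close> may be unbounded, so convergence of its own
  integrals is part of the hypotheses. Fatou's lemma for \<open>B + F\<close> and
  \<open>B - F\<close>, nonnegative up to a harmless constant, gives the lower and the upper
  estimate.\<close>

lemma cont_conv_integral_dominated:
  fixes F :: "nat \<Rightarrow> 's::metric_space \<Rightarrow> real"
  assumes F: "cont_conv F f" and meas: "\<And>k. F k \<in> borel_measurable borel" "f \<in> borel_measurable borel"
    and dom: "\<And>k x. \<bar>F k x\<bar> \<le> B x" and B: "continuous_on UNIV B"
    and M: "\<And>k. M k \<in> borel_probs" and lim: "limitin weak_topology M N sequentially"
    and intB: "\<And>k. integrable (M k) B" "integrable N B"
    and limB: "(\<lambda>k. \<integral>x. B x \<partial>M k) \<longlonglongrightarrow> (\<integral>x. B x \<partial>N)"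
  shows "(\<lambda>k. \<integral>x. F k x \<partial>M k) \<longlonglongrightarrow> (\<integral>x. f x \<partial>N)"
proof -
  have N: "N \<in> borel_probs" using limitin_topspace[OF lim] by simp
  have dom': "\<bar>f x\<bar> \<le> B x" for x
    using cont_convD[OF F tendsto_const, of x] dom
    by (intro tendsto_upperbound[where F=sequentially and f="\<lambda>k. \<bar>F k x\<bar>"] tendsto_rabs) auto
  have int: "integrable (M k) (F k)" for k
    by (rule Bochner_Integration.integrable_bound[OF intB(1)])
       (use meas sets_borel_probs[OF M] dom in \<open>auto intro!: AE_I2 order_trans[OF dom] cong: measurable_cong_sets\<close>)
  have int': "integrable N f"
    by (rule Bochner_Integration.integrable_bound[OF intB(2)])
       (use meas sets_borel_probs[OF N] dom' in \<open>auto intro!: AE_I2 order_trans[OF dom'] cong: measurable_cong_sets\<close>)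
  have lower: "\<forall>\<^sub>F k in sequentially. (\<integral>x. g x \<partial>N) - e < (\<integral>x. G k x \<partial>M k)"
    if G: "cont_conv G g" "\<And>k. integrable (M k) (G k)" "integrable N g" "\<And>k x. \<bar>G k x\<bar> \<le> B x" "\<And>x. \<bar>g x\<bar> \<le> B x"
      and e: "0 < e" for G g e
  proof -
    \<comment> \<open>The constant 1 added below keeps the threshold, an integral minus
      \<open>d\<close>, nonnegative because \<open>d \<le> 1\<close>; the remaining
      \<open>e - d\<close> absorbs the error in the integral of \<open>B\<close>.\<close>
    define d where "d = min 1 (e / 2)"
    have d: "0 < d" "d \<le> 1" "d < e" using e by (auto simp: d_def)
    have one: "integrable K (\<lambda>_. 1::real)" "(\<integral>x. 1 \<partial>K) = (1::real)" if "K \<in> borel_probs" for K :: "'s measure"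
    proof -
      interpret prob_space K using prob_space_borel_probs[OF that] .
      show "integrable K (\<lambda>_. 1::real)" "(\<integral>x. 1 \<partial>K) = (1::real)" by (simp_all add: prob_space)
    qed
    have K: "(\<integral>x. u x + B x + 1 \<partial>K) = (\<integral>x. u x \<partial>K) + (\<integral>x. B x \<partial>K) + 1"
      if "K \<in> borel_probs" "integrable K u" "integrable K B" for K u
      using that one[OF that(1)] by simp
    have "cont_conv (\<lambda>k x. G k x + B x + 1) (\<lambda>x. g x + B x + 1)"
      using G(1) cont_conv_const[OF B] unfolding cont_conv_def by (auto intro!: tendsto_intros)
    moreover have nn: "0 \<le> G k x + B x + 1" "0 \<le> g x + B x" for k x
      using G(4)[of k x] G(5)[of x] by linarith+
    moreover have "0 \<le> (\<integral>x. g x \<partial>N) + (\<integral>x. B x \<partial>N)"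
      using nn(2) G(3) intB(2) Bochner_Integration.integral_nonneg[of N "\<lambda>x. g x + B x"] by simp
    ultimately have "\<forall>\<^sub>F k in sequentially. (\<integral>x. g x + B x + 1 \<partial>N) - d < (\<integral>x. G k x + B x + 1 \<partial>M k)"
      using d G(2,3) intB one M N nn
      by (intro weak_fatou_eventually[where f="\<lambda>x. g x + B x + 1" and N=N] lim) (auto simp: K add_nonneg_nonneg)
    then have "\<forall>\<^sub>F k in sequentially. (\<integral>x. g x \<partial>N) + (\<integral>x. B x \<partial>N) - d < (\<integral>x. G k x \<partial>M k) + (\<integral>x. B x \<partial>M k)"
      using G(2,3) intB M N by (auto simp: K add_diff_eq)
    moreover have "\<forall>\<^sub>F k in sequentially. (\<integral>x. B x \<partial>M k) < (\<integral>x. B x \<partial>N) + (e - d)"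
      using d by (intro order_tendstoD(2)[OF limB]) simp
    ultimately show ?thesis by eventually_elim linarith
  qed
  show ?thesis
  proof (rule order_tendstoI)
    fix a assume "a < (\<integral>x. f x \<partial>N)"
    then show "\<forall>\<^sub>F k in sequentially. a < (\<integral>x. F k x \<partial>M k)"
      using lower[OF F int int' dom dom', of "(\<integral>x. f x \<partial>N) - a"] by simp
  next
    fix a assume a: "(\<integral>x. f x \<partial>N) < a"
    have "cont_conv (\<lambda>k x. - F k x) (\<lambda>x. - f x)"
      using F unfolding cont_conv_def by (auto intro!: tendsto_intros)
    from lower[OF this, of "a - (\<integral>x. f x \<partial>N)"]
    show "\<forall>\<^sub>F k in sequentially. (\<integral>x. F k x \<partial>M k) < a"
      using a int int' dom dom' by simp
  qed
qed

lemma cont_conv_integral_bounded: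
  fixes F :: "nat \<Rightarrow> 's::metric_space \<Rightarrow> real"
  assumes F: "cont_conv F f" and meas: "\<And>k. F k \<in> borel_measurable borel" "f \<in> borel_measurable borel"
    and dom: "\<And>k x. \<bar>F k x\<bar> \<le> B"
    and M: "\<And>k. M k \<in> borel_probs" and lim: "limitin weak_topology M N sequentially"
  shows "(\<lambda>k. \<integral>x. F k x \<partial>M k) \<longlonglongrightarrow> (\<integral>x. f x \<partial>N)"
proof -
  have N: "N \<in> borel_probs" using limitin_topspace[OF lim] by simp
  show ?thesis
    using limitin_weak_topology_bounded[OF lim continuous_on_const, of B "\<bar>B\<bar>"]
    by (intro cont_conv_integral_dominated[OF F meas dom continuous_on_const M lim])
       (auto intro: borel_probs_integrable[OF M] borel_probs_integrable[OF N])
qed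

text \<open>Indicators of closed sets are bounded limits of the continuous functions
  \<open>h C n\<close>, so closed sets have equal measure; they generate the Borel sets and are
  stable under intersection.\<close>

lemma borel_probs_eqI:
  fixes M N :: "'s::metric_space measure"
  assumes M: "M \<in> borel_probs" and N: "N \<in> borel_probs"
    and eq: "\<And>(f :: 's \<Rightarrow> real) B. continuous_on UNIV f \<Longrightarrow> (\<And>x. \<bar>f x\<bar> \<le> B) \<Longrightarrow> (\<integral>x. f x \<partial>M) = (\<integral>x. f x \<partial>N)"
  shows "M = N"
proof -
  define h where "h C n x = max 0 (1 - real n * infdist x C)" for C :: "'s set" and n x
  have hc: "continuous_on UNIV (h C n)" for C n
    unfolding h_def by (intro continuous_intros)
  have hb: "\<bar>h C n x\<bar> \<le> 1" for C n x
    by (simp add: h_def infdist_nonneg)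
  have hl: "(\<lambda>n. h C n x) \<longlonglongrightarrow> indicat_real C x" if C: "closed C" "C \<noteq> {}" for C x
  proof (cases "x \<in> C")
    case False
    then have pos: "0 < infdist x C"
      using in_closed_iff_infdist_zero[OF C, of x] infdist_nonneg[of x C] by linarith
    obtain n0 :: nat where "1 / infdist x C \<le> real n0" using real_arch_simple by blast
    then have "h C n x = 0" if "n0 \<le> n" for n
    proof -
      have "1 / infdist x C \<le> real n" using that \<open>1 / infdist x C \<le> real n0\<close> by (meson of_nat_mono order_trans)
      then have "1 \<le> real n * infdist x C" using pos by (simp add: field_simps)
      then show ?thesis by (simp add: h_def)
    qed
    then show ?thesis using False
      by (intro tendsto_eventually eventually_sequentiallyI[of n0]) simp
  qed (simp add: h_def)
  have lim: "(\<lambda>n. \<integral>x. h C n x \<partial>K) \<longlonglongrightarrow> measure K C" if C: "closed C" "C \<noteq> {}" and K: "K \<in> borel_probs" for C K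
  proof -
    interpret prob_space K using prob_space_borel_probs[OF K] .
    note [measurable_cong] = sets_borel_probs[OF K]
    have [measurable]: "C \<in> sets borel" "\<And>n. h C n \<in> borel_measurable borel"
      using C(1) hc borel_measurable_continuous_onI by auto
    have "(\<lambda>n. \<integral>x. h C n x \<partial>K) \<longlonglongrightarrow> (\<integral>x. indicat_real C x \<partial>K)"
      by (rule integral_dominated_convergence[where w="\<lambda>_. 1"]) (auto simp: hb hl[OF C])
    then show ?thesis using sets_borel_probs[OF K] by simp
  qed
  have closed_eq: "measure M C = measure N C" if "closed C" for C
    using LIMSEQ_unique[OF lim[OF that _ M]] lim[OF that _ N] eq[OF hc hb, of C]
    by (cases "C = {}") auto
  interpret M: prob_space M using prob_space_borel_probs[OF M] .
  interpret N: prob_space N using prob_space_borel_probs[OF N] .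
  show ?thesis
  proof (rule measure_eqI_generator_eq[where E="Collect closed" and \<Omega>=UNIV and A="\<lambda>_. UNIV"])
    show "Int_stable (Collect closed :: 's set set)" by (auto simp: Int_stable_def)
    show "sets M = sigma_sets UNIV (Collect closed)" "sets N = sigma_sets UNIV (Collect closed)"
      using sets_borel_probs[OF M] sets_borel_probs[OF N] by (simp_all add: borel_eq_closed)
  qed (auto simp: M.emeasure_eq_measure N.emeasure_eq_measure closed_eq)
qed

lemma limitin_weak_topology_unique:
  fixes N :: "'s::metric_space measure"
  assumes "limitin weak_topology M N sequentially" "limitin weak_topology M N' sequentially"
  shows "N = N'"
  using limitin_topspace[OF assms(1)] limitin_topspace[OF assms(2)]
    LIMSEQ_unique[OF limitin_weak_topology_bounded[OF assms(1)] limitin_weak_topology_bounded[OF assms(2)]]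
  by (intro borel_probs_eqI) auto

lemma borel_probs_distr:
  "M \<in> borel_probs \<Longrightarrow> h \<in> borel_measurable borel \<Longrightarrow> distr M borel h \<in> borel_probs"
  using measurable_space[OF measurable_distr_prob_space, of h borel borel M] by simp

lemma limitin_weak_topology_distr:
  fixes h :: "'s::topological_space \<Rightarrow> 't::topological_space"
  assumes M: "\<And>k. M k \<in> borel_probs" and lim: "limitin weak_topology M N sequentially"
    and h: "continuous_on UNIV h"
  shows "limitin weak_topology (\<lambda>k. distr (M k) borel h) (distr N borel h) sequentially"
proof (rule limitin_weak_topologyI)
  have N: "N \<in> borel_probs" using limitin_topspace[OF lim] by simp
  have hm: "h \<in> borel_measurable borel" using h by (rule borel_measurable_continuous_onI)
  show "distr (M k) borel h \<in> borel_probs" for k using borel_probs_distr[OF M hm] .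
  show "distr N borel h \<in> borel_probs" using borel_probs_distr[OF N hm] .
  fix f :: "'t \<Rightarrow> real" and B assume f: "continuous_on UNIV f" "\<And>x. \<bar>f x\<bar> \<le> B"
  have "(\<integral>x. f x \<partial>distr K borel h) = (\<integral>x. f (h x) \<partial>K)" if "K \<in> borel_probs" for K
    using f(1) hm sets_borel_probs[OF that]
    by (intro integral_distr) (auto intro: borel_measurable_continuous_onI cong: measurable_cong_sets)
  moreover have "(\<lambda>k. \<integral>x. f (h x) \<partial>M k) \<longlonglongrightarrow> (\<integral>x. f (h x) \<partial>N)"
    using f h by (intro limitin_weak_topology_bounded[OF lim, where B=B])
      (auto intro: continuous_on_compose2[OF f(1)])
  ultimately show "(\<lambda>k. \<integral>x. f x \<partial>distr (M k) borel h) \<longlonglongrightarrow> (\<integral>x. f x \<partial>distr N borel h)"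
    using M N by simp
qed

section \<open>Relative compactness\<close>

definition cantor_code :: "(nat \<Rightarrow> bool) \<Rightarrow> real" where
  "cantor_code b = (\<Sum>i. 2 * of_bool (b i) / 3 ^ Suc i)"

lemma cantor_code_summable: "summable (\<lambda>i. 2 * of_bool (b i) / (3::real) ^ Suc i)"
proof (rule summable_comparison_test'[where N=0])
  show "summable (\<lambda>i. 2 / 3 * (1 / 3 :: real) ^ i)" by (intro summable_mult summable_geometric) simp
qed (auto simp: power_divide of_bool_def)

lemma cantor_code_rec: "cantor_code b = (2 * of_bool (b 0) + cantor_code (\<lambda>i. b (Suc i))) / 3"
proof -
  have "cantor_code b = 2 * of_bool (b 0) / 3 + (\<Sum>i. 2 * of_bool (b (Suc i)) / 3 ^ Suc (Suc i))"
    using suminf_split_head[OF cantor_code_summable[of b]] by (simp add: cantor_code_def)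
  also have "(\<Sum>i. 2 * of_bool (b (Suc i)) / (3::real) ^ Suc (Suc i)) = (\<Sum>i. 1 / 3 * (2 * of_bool (b (Suc i)) / 3 ^ Suc i))"
    by (intro suminf_cong) simp
  also have "\<dots> = 1 / 3 * cantor_code (\<lambda>i. b (Suc i))"
    unfolding cantor_code_def by (rule suminf_mult[OF cantor_code_summable])
  finally show ?thesis by simp
qed

lemma cantor_code_bounds: "0 \<le> cantor_code b" "cantor_code b \<le> 1"
proof -
  show "0 \<le> cantor_code b"
    unfolding cantor_code_def by (intro suminf_nonneg cantor_code_summable) simp
  have s: "summable (\<lambda>i. 2 / 3 * (1 / 3 :: real) ^ i)" by (intro summable_mult summable_geometric) simp
  have "cantor_code b \<le> (\<Sum>i. 2 / 3 * (1 / 3) ^ i)"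
    unfolding cantor_code_def
    by (intro suminf_le cantor_code_summable s) (auto simp: power_divide of_bool_def)
  also have "\<dots> = 2 / 3 * (\<Sum>i. (1 / 3) ^ i)" by (intro suminf_mult summable_geometric) simp
  finally show "cantor_code b \<le> 1" by (simp add: suminf_geometric)
qed

text \<open>The ternary digits are only 0 and 2. The head digit thus puts the code into the lower or
  the upper third of the unit interval, and these lie at distance \<open>1 / 3\<close>.\<close>

lemma cantor_code_separates_head:
  assumes "\<bar>cantor_code a - cantor_code b\<bar> < 1 / 3"
  shows "a 0 = b 0"
proof (rule ccontr)
  define A B where "A = cantor_code (\<lambda>i. a (Suc i))" and "B = cantor_code (\<lambda>i. b (Suc i))"
  have *: "0 \<le> A" "A \<le> 1" "0 \<le> B" "B \<le> 1"
    by (simp_all add: A_def B_def cantor_code_bounds)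
  assume "a 0 \<noteq> b 0"
  then have "3 * cantor_code a = 2 + A \<and> 3 * cantor_code b = B \<or>
      3 * cantor_code a = A \<and> 3 * cantor_code b = 2 + B"
    using cantor_code_rec[of a] cantor_code_rec[of b] by (auto simp: A_def B_def)
  moreover have "cantor_code a - cantor_code b < 1 / 3" "cantor_code b - cantor_code a < 1 / 3"
    using assms by (simp_all only: abs_less_iff minus_diff_eq)
  ultimately show False using * by linarith
qed

text \<open>Equal head digits cancel in the difference, and dropping them multiplies it by
  3.\<close>

lemma cantor_code_separates:
  "\<bar>cantor_code a - cantor_code b\<bar> < 1 / 3 ^ Suc n \<Longrightarrow> i \<le> n \<Longrightarrow> a i = b i"
proof (induction n arbitrary: a b i)
  case (0 a b i)
  then show ?case using cantor_code_separates_head[of a b] by simp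
next
  case (Suc n a b i)
  have "(1::real) / 3 ^ Suc (Suc n) \<le> 1 / 3"
    using power_increasing[of 1 "Suc (Suc n)" "3::real"] by (simp add: field_simps)
  with Suc.prems have a0: "a 0 = b 0"
    by (intro cantor_code_separates_head) linarith
  then have "cantor_code a - cantor_code b = (cantor_code (\<lambda>i. a (Suc i)) - cantor_code (\<lambda>i. b (Suc i))) / 3"
    using cantor_code_rec[of a] cantor_code_rec[of b] by (simp add: field_simps)
  then have "\<bar>cantor_code (\<lambda>i. a (Suc i)) - cantor_code (\<lambda>i. b (Suc i))\<bar> < 1 / 3 ^ Suc n"
    using Suc.prems(1) by simp
  from Suc.IH[OF this] a0 Suc.prems(2) show ?case by (cases i) auto
qed

text \<open>
  The integer part of the code \<open>s x\<close> records the level of \<open>w\<close>, and its ternary digits record which sets of a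
  countable base contain \<open>x\<close>. Since sublevel sets are compact, convergence of the codes forces convergence
  of the points, so the inverse of \<open>s\<close> extends continuously to the closure of its range.
\<close>

lemma real_coding:
  fixes w :: "'s::{metric_space, second_countable_topology} \<Rightarrow> real"
  assumes w: "w \<in> borel_measurable borel" and compact: "\<And>r. compact {x. w x \<le> r}" and nonneg: "\<And>x. 0 \<le> w x"
  shows "\<exists>(s :: 's \<Rightarrow> real) g D. s \<in> borel_measurable borel \<and> closed D \<and> range s \<subseteq> D \<and>
    continuous_on D g \<and> (\<forall>x. g (s x) = x) \<and> (\<forall>x. 0 \<le> s x \<and> s x \<le> 2 * w x + 1)"
proof -
  obtain \<B> :: "'s set set" where \<B>: "countable \<B>" "topological_basis \<B>"
    using ex_countable_basis by blast
  define U where "U = from_nat_into (insert {} \<B>)"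
  have rangeU: "range U = insert {} \<B>"
    unfolding U_def using \<B>(1) by (intro range_from_nat_into) auto
  have openU: "open (U i)" for i
    using rangeU topological_basis_open[OF \<B>(2)] by (metis insertE open_empty rangeI)
  have baseU: "\<exists>i. x \<in> U i \<and> U i \<subseteq> V" if V: "open V" "x \<in> V" for x V
  proof -
    obtain B where "B \<in> \<B>" "x \<in> B" "B \<subseteq> V" using topological_basisE[OF \<B>(2) V] by metis
    then show ?thesis using rangeU by (metis insertCI rangeE)
  qed
  define cc where "cc x = cantor_code (\<lambda>i. x \<in> U i)" for x
  \<comment> \<open>Doubling the integer part leaves a gap of length at least 1 between the codes of
    different levels, since \<open>cc\<close> stays in the unit interval.\<close>
  define s where "s x = 2 * real_of_int \<lfloor>w x\<rfloor> + cc x" for x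
  have cc: "0 \<le> cc x" "cc x \<le> 1" for x by (simp_all add: cc_def cantor_code_bounds)
  have s_bounds: "0 \<le> s x" "s x \<le> 2 * w x + 1" for x
    using cc[of x] nonneg[of x] by (auto simp: s_def intro!: add_nonneg_nonneg add_mono)
  have w_le: "w x \<le> (s x + 2) / 2" for x
    using cc[of x] real_of_int_floor_add_one_gt[of "w x"] unfolding s_def le_divide_eq_numeral1 by argo
  have s_meas: "s \<in> borel_measurable borel"
  proof -
    have [measurable]: "U i \<in> sets borel" "w \<in> borel_measurable borel" for i using openU w by auto
    have "(\<lambda>x. 2 * of_bool (x \<in> U i) / (3::real) ^ Suc i) = (\<lambda>x. 2 * indicator (U i) x / 3 ^ Suc i)" for i
      by (auto simp: indicator_def)
    then have "(\<lambda>x. 2 * of_bool (x \<in> U i) / (3::real) ^ Suc i) \<in> borel_measurable borel" for i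
      by simp
    then show ?thesis unfolding s_def cc_def cantor_code_def by measurable
  qed
  \<comment> \<open>Finitely many base sets of small diameter cover the compact sublevel set. A
    point whose digits agree with those of \<open>x\<close> up to the largest of their indices lies
    in the same base set as \<open>x\<close>, hence close to it.\<close>
  have unif: "\<exists>d>0. \<forall>x y. w x \<le> r \<longrightarrow> \<bar>s x - s y\<bar> < d \<longrightarrow> dist x y < e" if "0 < e" for e r
  proof -
    have "\<forall>x. \<exists>i. x \<in> U i \<and> U i \<subseteq> ball x (e / 2)"
      using baseU \<open>0 < e\<close> by (metis centre_in_ball half_gt_zero open_ball)
    then obtain I where I: "\<And>x. x \<in> U (I x) \<and> U (I x) \<subseteq> ball x (e / 2)" by metis
    have "{x. w x \<le> r} \<subseteq> (\<Union>x\<in>UNIV. U (I x))" using I by blast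
    then obtain F where F: "finite F" "{x. w x \<le> r} \<subseteq> (\<Union>x\<in>F. U (I x))"
      using compactE_image[OF compact[of r], of UNIV "\<lambda>x. U (I x)"] openU by metis
    obtain n where n: "\<And>x. x \<in> F \<Longrightarrow> I x \<le> n"
      using F(1) by (metis Max_ge finite_imageI imageI)
    have "dist x y < e" if "w x \<le> r" "\<bar>s x - s y\<bar> < 1 / 3 ^ Suc n" for x y
    proof -
      have "(1::real) / 3 ^ Suc n \<le> 1 / 3"
        using power_increasing[of 1 "Suc n" "3::real"] by (simp add: field_simps)
      then have lt: "\<bar>s x - s y\<bar> < 1" using that(2) by linarith
      have "\<lfloor>w x\<rfloor> = \<lfloor>w y\<rfloor>"
      proof (rule ccontr)
        assume "\<lfloor>w x\<rfloor> \<noteq> \<lfloor>w y\<rfloor>"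
        then have "1 \<le> \<bar>\<lfloor>w x\<rfloor> - \<lfloor>w y\<rfloor>\<bar>" by linarith
        then have "1 \<le> \<bar>real_of_int \<lfloor>w x\<rfloor> - real_of_int \<lfloor>w y\<rfloor>\<bar>" by linarith
        then show False using lt cc[of x] cc[of y] unfolding s_def by linarith
      qed
      then have "cc x - cc y = s x - s y" unfolding s_def by linarith
      with that(2) have "\<bar>cc x - cc y\<bar> < 1 / 3 ^ Suc n" by (simp only:)
      then have bits: "x \<in> U i \<longleftrightarrow> y \<in> U i" if "i \<le> n" for i
        unfolding cc_def using that by (rule cantor_code_separates)
      obtain z where z: "z \<in> F" "x \<in> U (I z)" using F \<open>w x \<le> r\<close> by auto
      then have "y \<in> U (I z)" using bits n by blast
      then have "dist z x < e / 2" "dist z y < e / 2" using z I by (auto simp: subset_iff)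
      then show ?thesis by (rule dist_triangle_half_r)
    qed
    then show ?thesis by (intro exI[of _ "1 / 3 ^ Suc n"]) auto
  qed
  define D where "D = closure (range s)"
  have "\<exists>l. \<forall>e>0. \<exists>d>0. \<forall>x. \<bar>s x - y\<bar> < d \<longrightarrow> dist x l < e" if y: "y \<in> D" for y
  proof -
    \<comment> \<open>Points whose code is within 1 of \<open>y\<close> satisfy
      \<open>w x \<le> (s x + 2) / 2 \<le> r\<close>, so they all lie in one compact set. Points
      whose codes tend to \<open>y\<close> therefore form a Cauchy sequence, and its limit is the
      value of the extended inverse at \<open>y\<close>.\<close>
    define r where "r = (y + 3) / 2"
    have w_r: "w x \<le> r" if "\<bar>s x - y\<bar> < 1" for x using w_le[of x] that by (simp add: r_def abs_if split: if_splits)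
    have "\<forall>n. \<exists>x. dist (s x) y < inverse (real (Suc n))"
      using y unfolding D_def closure_approachable by (metis inverse_positive_iff_positive of_nat_0_less_iff rangeE zero_less_Suc)
    then obtain x where x: "\<And>n. \<bar>s (x n) - y\<bar> < inverse (real (Suc n))" by (auto simp: dist_real_def) metis
    have inv1: "inverse (real (Suc n)) \<le> 1" for n by (simp add: inverse_eq_divide)
    have xr: "x n \<in> {x. w x \<le> r}" for n using w_r x[of n] inv1[of n] by force
    have small: "\<exists>N. \<forall>n\<ge>N. \<bar>s (x n) - y\<bar> < d" if "0 < d" for d
    proof -
      obtain N where N: "inverse (real (Suc N)) < d" using reals_Archimedean[OF \<open>0 < d\<close>] by blast
      have "\<bar>s (x n) - y\<bar> < d" if "N \<le> n" for n
      proof -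
        have "inverse (real (Suc n)) \<le> inverse (real (Suc N))" using that by (intro le_imp_inverse_le) auto
        then show ?thesis using x[of n] N by linarith
      qed
      then show ?thesis by blast
    qed
    have "Cauchy x"
    proof (rule metric_CauchyI)
      fix e :: real assume "0 < e"
      then obtain d where d: "0 < d" "\<And>x y. w x \<le> r \<Longrightarrow> \<bar>s x - s y\<bar> < d \<Longrightarrow> dist x y < e" using unif by metis
      obtain N where N: "\<And>n. N \<le> n \<Longrightarrow> \<bar>s (x n) - y\<bar> < d / 2" using small[of "d / 2"] d(1) by auto
      have "dist (x m) (x n) < e" if "N \<le> m" "N \<le> n" for m n
        using N[OF that(1)] N[OF that(2)] xr[of m] by (intro d(2)) (auto simp: abs_if split: if_splits)
      then show "\<exists>M. \<forall>m\<ge>M. \<forall>n\<ge>M. dist (x m) (x n) < e" by blast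
    qed
    then obtain l where l: "x \<longlonglongrightarrow> l"
      using compact_imp_complete[OF compact[of r]] xr unfolding complete_def by meson
    have "\<exists>d>0. \<forall>z. \<bar>s z - y\<bar> < d \<longrightarrow> dist z l < e" if "0 < e" for e
    proof -
      obtain d where d: "0 < d" "\<And>x y. w x \<le> r \<Longrightarrow> \<bar>s x - s y\<bar> < d \<Longrightarrow> dist x y < e / 2"
        using unif[of "e / 2"] \<open>0 < e\<close> by (metis half_gt_zero)
      have "dist z l < e" if z: "\<bar>s z - y\<bar> < min 1 (d / 2)" for z
      proof -
        obtain N where N: "\<And>n. N \<le> n \<Longrightarrow> \<bar>s (x n) - y\<bar> < d / 2" using small[of "d / 2"] d(1) by auto
        obtain N' where N': "\<And>n. N' \<le> n \<Longrightarrow> dist (x n) l < e / 2"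
          using metric_LIMSEQ_D[OF l, of "e / 2"] \<open>0 < e\<close> by auto
        define n where "n = max N N'"
        have "dist z (x n) < e / 2"
          using N[of n] z w_r[of z] by (intro d(2)) (auto simp: n_def abs_if split: if_splits)
        moreover have "dist (x n) l < e / 2" using N' by (simp add: n_def)
        ultimately show ?thesis using dist_triangle[of z l "x n"] by linarith
      qed
      then show ?thesis using d(1) by (intro exI[of _ "min 1 (d / 2)"]) auto
    qed
    then show ?thesis by blast
  qed
  then obtain g where g: "\<And>y e. y \<in> D \<Longrightarrow> 0 < e \<Longrightarrow> \<exists>d>0. \<forall>x. \<bar>s x - y\<bar> < d \<longrightarrow> dist x (g y) < e"
    by metis
  have "continuous_on D g"
    unfolding continuous_on_iff
  proof (intro ballI allI impI)
    fix y and e :: real assume y: "y \<in> D" and "0 < e"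
    then obtain d where d: "0 < d" "\<And>x. \<bar>s x - y\<bar> < d \<Longrightarrow> dist x (g y) < e / 2" using g[of y "e / 2"] by auto
    have "dist (g y') (g y) < e" if y': "y' \<in> D" "dist y' y < d / 2" for y'
    proof -
      obtain d' where d': "0 < d'" "\<And>x. \<bar>s x - y'\<bar> < d' \<Longrightarrow> dist x (g y') < e / 2"
        using g[of y' "e / 2"] y' \<open>0 < e\<close> by auto
      obtain x where x: "dist (s x) y' < min d' (d / 2)"
        using y'(1) d d' unfolding D_def closure_approachable by (metis half_gt_zero min_less_iff_conj rangeE)
      then have "dist x (g y') < e / 2" by (intro d'(2)) (auto simp: dist_real_def)
      moreover have "dist x (g y) < e / 2"
        using x y'(2) by (intro d(2)) (auto simp: dist_real_def abs_if split: if_splits)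
      ultimately show ?thesis by (rule dist_triangle_half_r)
    qed
    then show "\<exists>d>0. \<forall>y'\<in>D. dist y' y < d \<longrightarrow> dist (g y') (g y) < e"
      using d(1) by (intro exI[of _ "d / 2"]) auto
  qed
  moreover have "range s \<subseteq> D" unfolding D_def by (rule closure_subset)
  moreover have "g (s x) = x" for x
  proof (rule ccontr)
    assume "g (s x) \<noteq> x"
    then obtain d where "0 < d" "\<And>z. \<bar>s z - s x\<bar> < d \<Longrightarrow> dist z (g (s x)) < dist x (g (s x))"
      using g[of "s x" "dist x (g (s x))"] \<open>range s \<subseteq> D\<close> by auto
    from this(2)[of x] this(1) show False by simp
  qed
  ultimately show ?thesis
    using s_meas s_bounds unfolding D_def by (intro exI[of _ s] exI[of _ g] exI[of _ "closure (range s)"]) auto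
qed

text \<open>The coding transports Helly's selection theorem from the real line to \<open>'s\<close>.\<close>

theorem prokhorov_compact_sublevels:
  fixes w :: "'s::{metric_space, second_countable_topology} \<Rightarrow> real" and M :: "nat \<Rightarrow> 's measure"
  assumes w: "w \<in> borel_measurable borel" and compact: "\<And>r. compact {x. w x \<le> r}" and nonneg: "\<And>x. 0 \<le> w x"
    and M: "\<And>k. M k \<in> borel_probs"
    and tight: "\<And>e. 0 < e \<Longrightarrow> \<exists>r. \<forall>k. 1 - e < measure (M k) {x. w x \<le> r}"
  shows "\<exists>r N. strict_mono (r :: nat \<Rightarrow> nat) \<and> limitin weak_topology (M \<circ> r) N sequentially"
proof -
  obtain s :: "'s \<Rightarrow> real" and g D where s: "s \<in> borel_measurable borel" and D: "closed D" "range s \<subseteq> D"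
    and g: "continuous_on D g" "\<And>x. g (s x) = x" and s_bounds: "\<And>x. 0 \<le> s x \<and> s x \<le> 2 * w x + 1"
    using real_coding[OF w compact nonneg] by blast
  have sM: "s \<in> borel_measurable (M k)" for k
    using s sets_borel_probs[OF M] by (simp cong: measurable_cong_sets)
  define \<mu> where "\<mu> k = distr (M k) borel s" for k
  have rd: "real_distribution (\<mu> k)" for k
    unfolding \<mu>_def using prob_space_borel_probs[OF M] sM by (intro prob_space.real_distribution_distr)
  have "Helly_Selection.tight \<mu>"
    unfolding tight_def
  proof (intro conjI allI impI rd)
    fix e :: real assume "0 < e"
    then obtain r where r: "\<And>k. 1 - e < measure (M k) {x. w x \<le> r}" using tight by blast
    \<comment> \<open>The right end comes from \<open>s x \<le> 2 * w x + 1\<close>; the maximum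
      with 0 keeps the interval nonempty, and the left end -1 is below every code.\<close>
    define b where "b = max 0 (2 * r + 1)"
    have "1 - e < measure (\<mu> k) {-1<..b}" for k
    proof -
      interpret M: prob_space "M k" using prob_space_borel_probs[OF M] .
      have "measure (M k) {x. w x \<le> r} \<le> measure (M k) (s -` {-1<..b} \<inter> space (M k))"
      proof (rule M.finite_measure_mono)
        have "s x \<in> {-1<..b}" if "w x \<le> r" for x
          using s_bounds[of x] that by (auto simp: b_def)
        then show "{x. w x \<le> r} \<subseteq> s -` {-1<..b} \<inter> space (M k)"
          using sets_eq_imp_space_eq[OF sets_borel_probs[OF M]] by auto
        show "s -` {-1<..b} \<inter> space (M k) \<in> sets (M k)" using sM by (rule measurable_sets) simp
      qed
      also have "\<dots> = measure (\<mu> k) {-1<..b}" unfolding \<mu>_def using sM by (simp add: measure_distr)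
      finally show ?thesis using r[of k] by linarith
    qed
    then show "\<exists>a b. a < b \<and> (\<forall>n. 1 - e < measure (\<mu> n) {a<..b})"
      by (intro exI[of _ "-1"] exI[of _ b]) (auto simp: b_def)
  qed
  then obtain r L where r: "strict_mono r" and L: "real_distribution L" "weak_conv_m (\<mu> \<circ> r) L"
    using tight_imp_convergent_subsubsequence[of \<mu> id] by (auto simp: strict_mono_id)
  interpret L: real_distribution L by fact
  have conv: "(\<lambda>k. \<integral>x. f (s x) \<partial>M (r k)) \<longlonglongrightarrow> (\<integral>y. f y \<partial>L)"
    if f: "continuous_on UNIV f" "\<And>y. \<bar>f y\<bar> \<le> B" for f :: "real \<Rightarrow> real" and B
  proof -
    have "(\<lambda>k. \<integral>y. f y \<partial>(\<mu> \<circ> r) k) \<longlonglongrightarrow> (\<integral>y. f y \<partial>L)"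
      using rd L f unfolding o_def
      by (intro weak_conv_imp_integral_bdd_continuous_conv[where B=B and M=L]) (auto simp: continuous_on_eq_continuous_at)
    moreover have "(\<integral>y. f y \<partial>(\<mu> \<circ> r) k) = (\<integral>x. f (s x) \<partial>M (r k))" for k
      unfolding \<mu>_def o_def using sM f(1) by (intro integral_distr borel_measurable_continuous_onI)
    ultimately show ?thesis by simp
  qed
  have D_ne: "D \<noteq> {}" using D(2) by auto
  \<comment> \<open>A truncated distance to \<open>D\<close> is a bounded continuous test function
    that vanishes on all codes. Its integral under the limit is therefore 0, and the limit law is
    carried by the closed set \<open>D\<close>.\<close>
  define dD where "dD y = min 1 (infdist y D)" for y
  have dD: "continuous_on UNIV dD" "\<And>y. \<bar>dD y\<bar> \<le> 1" "\<And>y. 0 \<le> dD y"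
    unfolding dD_def by (auto intro!: continuous_intros simp: infdist_nonneg)
  have "dD (s x) = 0" for x
    using D(2) by (auto simp: dD_def infdist_nonneg subset_iff)
  then have "(\<integral>y. dD y \<partial>L) = 0"
    using LIMSEQ_unique[OF conv[OF dD(1,2)]] by simp
  moreover have "integrable L dD"
    using dD(2) borel_measurable_continuous_onI[OF dD(1)] by (intro L.integrable_const_bound[where B=1]) auto
  ultimately have "AE y in L. dD y = 0"
    using integral_nonneg_eq_0_iff_AE[of L dD] dD(3) by auto
  then have AE_D: "AE y in L. y \<in> D"
    by eventually_elim (use in_closed_iff_infdist_zero[OF D(1) D_ne] in \<open>auto simp: dD_def min_def split: if_splits\<close>)
  define g' where "g' y = (if y \<in> D then g y else g (s undefined))" for y
  have g'_meas: "g' \<in> borel_measurable borel"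
    unfolding g'_def using D(1) g(1) by (intro borel_measurable_continuous_on_if) auto
  then have g'L: "g' \<in> borel_measurable L" by simp
  have "limitin weak_topology (M \<circ> r) (distr L borel g') sequentially"
  proof (rule limitin_weak_topologyI)
    show "(M \<circ> r) k \<in> borel_probs" for k using M by simp
    show "distr L borel g' \<in> borel_probs"
      using L.prob_space_distr[OF g'L] by (simp add: space_prob_algebra)
    fix f :: "'s \<Rightarrow> real" and B assume f: "continuous_on UNIV f" "\<And>x. \<bar>f x\<bar> \<le> B"
    have fm: "f \<in> borel_measurable borel" using f(1) by (rule borel_measurable_continuous_onI)
    have "continuous_on D (\<lambda>y. f (g y))" using continuous_on_compose2[OF f(1) g(1)] by simp
    moreover have "0 \<le> B" using f(2)[of undefined] by linarith
    \<comment> \<open>Convergence on the line needs a test function on the whole line; Tietze's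
      theorem extends \<open>f\<close> composed with \<open>g\<close> from \<open>D\<close> without
      enlarging its bound.\<close>
    ultimately obtain h where h: "continuous_on UNIV h" "\<And>y. y \<in> D \<Longrightarrow> h y = f (g y)" "\<And>y. \<bar>h y\<bar> \<le> B"
      using Tietze[of D "\<lambda>y. f (g y)" UNIV B] D(1) f(2) by auto
    have hm: "h \<in> borel_measurable borel" using h(1) by (rule borel_measurable_continuous_onI)
    have "h (s x) = f x" for x using h(2)[of "s x"] D(2) g(2) by auto
    then have "(\<lambda>k. \<integral>x. f x \<partial>M (r k)) \<longlonglongrightarrow> (\<integral>y. h y \<partial>L)" using conv[OF h(1,3)] by simp
    also have "(\<integral>y. h y \<partial>L) = (\<integral>y. f (g' y) \<partial>L)"
    proof (rule integral_cong_AE)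
      show "AE y in L. h y = f (g' y)"
        using AE_D by eventually_elim (simp add: g'_def h(2))
    qed (use hm fm g'L in \<open>auto intro: measurable_compose[OF _ fm]\<close>)
    also have "\<dots> = (\<integral>x. f x \<partial>distr L borel g')" using g'L fm by (simp add: integral_distr)
    finally show "(\<lambda>k. \<integral>x. f x \<partial>(M \<circ> r) k) \<longlonglongrightarrow> (\<integral>x. f x \<partial>distr L borel g')" by simp
  qed
  with r show ?thesis by blast
qed

text \<open>A continuous cutoff between \<open>{x. w x \<le> r0}\<close> and
  \<open>{x. w x \<le> r0 + 1}\<close> transfers the tightness of the limit to all large indices;
  the finitely many others are tight one by one.\<close>

lemma weak_limit_tight:
  fixes w :: "'s::topological_space \<Rightarrow> real"
  assumes w: "continuous_on UNIV w"
    and M: "\<And>k. M k \<in> borel_probs" and lim: "limitin weak_topology M N sequentially" and e: "0 < e"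
  shows "\<exists>r. \<forall>k. 1 - e < measure (M k) {x. w x \<le> r}"
proof -
  have N: "N \<in> borel_probs" using limitin_topspace[OF lim] by simp
  have wm: "w \<in> borel_measurable borel" using w by (rule borel_measurable_continuous_onI)
  have single: "\<exists>r. 1 - d < measure K {x. w x \<le> r}" if K: "K \<in> borel_probs" and d: "0 < d" for K d
  proof -
    interpret prob_space K using prob_space_borel_probs[OF K] .
    note [measurable_cong] = sets_borel_probs[OF K]
    note [measurable] = wm
    have sp: "space K = UNIV" using sets_eq_imp_space_eq[OF sets_borel_probs[OF K]] by simp
    have meas: "{x. w x \<le> r} \<in> sets K" for r
      using wm sets_borel_probs[OF K] by auto
    have "(\<lambda>n. measure K {x. w x \<le> real n}) \<longlonglongrightarrow> measure K (\<Union>n. {x. w x \<le> real n})"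
      by (rule finite_Lim_measure_incseq) (auto simp: incseq_def meas)
    also have "(\<Union>n. {x. w x \<le> real n}) = space K" using real_arch_simple sp by auto
    finally have "(\<lambda>n. measure K {x. w x \<le> real n}) \<longlonglongrightarrow> 1" by (simp add: prob_space)
    from order_tendstoD(1)[OF this, of "1 - d"] d show ?thesis by (auto simp: eventually_sequentially)
  qed
  obtain r0 where r0: "1 - e < measure N {x. w x \<le> r0}" using single[OF N e] by blast
  define f where "f x = max 0 (min 1 (r0 + 1 - w x))" for x
  have f: "continuous_on UNIV f" "\<And>x. \<bar>f x\<bar> \<le> 1"
    unfolding f_def by (auto intro!: continuous_intros w)
  have fm: "f \<in> borel_measurable borel" using f(1) by (rule borel_measurable_continuous_onI)
  have between: "measure K {x. w x \<le> r0} \<le> (\<integral>x. f x \<partial>K)" "(\<integral>x. f x \<partial>K) \<le> measure K {x. w x \<le> r0 + 1}"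
    if K: "K \<in> borel_probs" for K
  proof -
    interpret prob_space K using prob_space_borel_probs[OF K] .
    have [simp]: "{x. w x \<le> r} \<in> sets K" for r
      using wm sets_borel_probs[OF K] by auto
    have [simp]: "space K = UNIV" using sets_eq_imp_space_eq[OF sets_borel_probs[OF K]] by simp
    have i: "integrable K f" by (rule borel_probs_integrable[OF K fm f(2)])
    have "(\<integral>x. indicat_real {x. w x \<le> r0} x \<partial>K) \<le> (\<integral>x. f x \<partial>K)"
      by (rule integral_mono[OF _ i]) (simp_all add: f_def less_top[symmetric] split: split_indicator)
    then show "measure K {x. w x \<le> r0} \<le> (\<integral>x. f x \<partial>K)" by simp
    have "(\<integral>x. f x \<partial>K) \<le> (\<integral>x. indicat_real {x. w x \<le> r0 + 1} x \<partial>K)"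
      by (rule integral_mono[OF i]) (simp_all add: f_def less_top[symmetric] split: split_indicator)
    then show "(\<integral>x. f x \<partial>K) \<le> measure K {x. w x \<le> r0 + 1}" by simp
  qed
  have "\<forall>\<^sub>F k in sequentially. 1 - e < (\<integral>x. f x \<partial>M k)"
    using r0 between(1)[OF N] by (intro order_tendstoD(1)[OF limitin_weak_topology_bounded[OF lim f]]) linarith
  then obtain n where n: "\<And>k. n \<le> k \<Longrightarrow> 1 - e < measure (M k) {x. w x \<le> r0 + 1}"
    using between(2)[OF M] unfolding eventually_sequentially by (meson less_le_trans)
  obtain q where q: "\<And>k. 1 - e < measure (M k) {x. w x \<le> q k}" using single[OF M e] by metis
  define r where "r = Max (insert (r0 + 1) (q ` {..<n}))"
  have "1 - e < measure (M k) {x. w x \<le> r}" for k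
  proof -
    interpret prob_space "M k" using prob_space_borel_probs[OF M] .
    have "\<exists>r'\<le>r. 1 - e < measure (M k) {x. w x \<le> r'}"
    proof (cases "k < n")
      case True
      then show ?thesis using q[of k] by (intro exI[of _ "q k"]) (auto simp: r_def)
    next
      case False
      then show ?thesis using n[of k] by (intro exI[of _ "r0 + 1"]) (auto simp: r_def)
    qed
    then obtain r' where r': "r' \<le> r" "1 - e < measure (M k) {x. w x \<le> r'}" by blast
    have "measure (M k) {x. w x \<le> r'} \<le> measure (M k) {x. w x \<le> r}"
      using r'(1) wm sets_borel_probs[OF M] by (intro finite_measure_mono) auto
    with r'(2) show ?thesis by linarith
  qed
  then show ?thesis by blast
qed

text \<open>Tightness of the laws on the product only requires it of the first marginals, as \<open>'a\<close> is compact.\<close>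

lemma fst_marginal_convergent_subsequence:
  fixes w :: "'x::{metric_space, second_countable_topology} \<Rightarrow> real"
    and M :: "nat \<Rightarrow> ('x \<times> 'a::{metric_space, second_countable_topology}) measure"
  assumes w: "continuous_on UNIV w" and compact: "\<And>r. compact {x. w x \<le> r}" and nonneg: "\<And>x. 0 \<le> w x"
    and A: "compact (UNIV :: 'a set)"
    and M: "\<And>k. M k \<in> borel_probs"
    and lim: "limitin weak_topology (\<lambda>k. distr (M k) borel fst) \<mu> sequentially"
  shows "\<exists>r N. strict_mono (r :: nat \<Rightarrow> nat) \<and> limitin weak_topology (M \<circ> r) N sequentially"
proof (rule prokhorov_compact_sublevels[where w="\<lambda>z. w (fst z)"])
  have wf: "continuous_on UNIV (\<lambda>z :: 'x \<times> 'a. w (fst z))"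
    by (rule continuous_on_compose2[OF w]) (auto intro: continuous_intros)
  then show "(\<lambda>z :: 'x \<times> 'a. w (fst z)) \<in> borel_measurable borel" by (rule borel_measurable_continuous_onI)
  have "{z :: 'x \<times> 'a. w (fst z) \<le> r} = {x. w x \<le> r} \<times> UNIV" for r by auto
  then show "compact {z :: 'x \<times> 'a. w (fst z) \<le> r}" for r using compact_Times[OF compact A] by simp
  have fst_meas: "fst \<in> borel_measurable (borel :: ('x \<times> 'a) measure)"
    by (intro borel_measurable_continuous_onI continuous_intros)
  have D: "distr (M k) borel fst \<in> borel_probs" for k using borel_probs_distr[OF M fst_meas] .
  fix e :: real assume "0 < e"
  from weak_limit_tight[OF w D lim this]
  obtain r where r: "\<And>k. 1 - e < measure (distr (M k) borel fst) {x. w x \<le> r}" by blast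
  have "measure (distr (M k) borel fst) {x. w x \<le> r} = measure (M k) {z. w (fst z) \<le> r}" for k
  proof -
    have "{x. w x \<le> r} \<in> sets borel" using borel_measurable_continuous_onI[OF w] by simp
    moreover have "fst \<in> borel_measurable (M k)"
      using fst_meas sets_borel_probs[OF M[of k]] by (simp cong: measurable_cong_sets)
    ultimately show ?thesis
      using sets_eq_imp_space_eq[OF sets_borel_probs[OF M[of k]]] by (simp add: measure_distr vimage_def)
  qed
  with r show "\<exists>r. \<forall>k. 1 - e < measure (M k) {z. w (fst z) \<le> r}" by metis
qed (use nonneg M in auto)

section \<open>Disintegration\<close>

text \<open>The set where a Radon-Nikodym density exceeds 1 is null, as \<open>N\<close> is
  dominated by \<open>M\<close> on it. Cutting the density at 1 makes it real-valued and lets the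
  bounds hold everywhere.\<close>

lemma dominated_measure_density:
  assumes M: "finite_measure M" and sets: "sets N = sets M" and le: "\<And>A. A \<in> sets M \<Longrightarrow> emeasure N A \<le> emeasure M A"
  shows "\<exists>f. f \<in> borel_measurable M \<and> (\<forall>x. f x \<in> {0..1::real}) \<and>
    (\<forall>A\<in>sets M. emeasure N A = (\<integral>\<^sup>+x. ennreal (f x) * indicator A x \<partial>M))"
proof -
  interpret M: finite_measure M by fact
  have "absolutely_continuous M N"
    unfolding absolutely_continuous_def
  proof
    fix A assume "A \<in> null_sets M"
    then show "A \<in> null_sets N" using le[of A] sets by (auto simp: null_sets_def)
  qed
  then obtain h where h: "h \<in> borel_measurable M" "density M h = N"
    using M.Radon_Nikodym[OF _ sets] by blast
  have "AE x in M. h x \<le> 1"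
  proof -
    define A where "A = {x \<in> space M. 1 < h x}"
    have A: "A \<in> sets M" unfolding A_def using h(1) by measurable
    have "AE x in M. \<not> (x \<in> A)"
    proof -
      have "(\<integral>\<^sup>+x. (h x - 1) * indicator A x \<partial>M) = (\<integral>\<^sup>+x. h x * indicator A x - indicator A x \<partial>M)"
        by (intro nn_integral_cong) (auto simp: indicator_def)
      also have "\<dots> = (\<integral>\<^sup>+x. h x * indicator A x \<partial>M) - (\<integral>\<^sup>+x. indicator A x \<partial>M)"
      proof (rule nn_integral_diff)
        show "AE x in M. indicator A x \<le> h x * indicator A x"
          by (auto simp: A_def indicator_def)
      qed (use h(1) A M.emeasure_finite in auto)
      also have "(\<integral>\<^sup>+x. h x * indicator A x \<partial>M) = emeasure N A"
        using h A emeasure_density by metis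
      also have "emeasure N A - (\<integral>\<^sup>+x. indicator A x \<partial>M) = 0"
      proof -
        have "emeasure M A < top" using M.emeasure_finite[of A] by (simp add: less_top[symmetric])
        then have "emeasure N A < top" using le[OF A] by (rule le_less_trans[rotated])
        then show ?thesis using le[OF A] A by (simp add: diff_eq_0_iff_ennreal)
      qed
      finally have "AE x in M. (h x - 1) * indicator A x = 0"
        using h(1) A by (subst (asm) nn_integral_0_iff_AE) auto
      then show ?thesis
        by eventually_elim (auto simp: A_def indicator_def diff_eq_0_iff_ennreal split: if_splits)
    qed
    with AE_space show ?thesis by eventually_elim (auto simp: A_def not_less)
  qed
  note h1 = this
  define f where "f x = enn2real (min 1 (h x))" for x
  have f1: "f x \<in> {0..1}" for x
  proof -
    have "enn2real (min 1 (h x)) \<le> enn2real 1" by (intro enn2real_mono) auto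
    then show ?thesis by (simp add: f_def)
  qed
  have "emeasure N A = (\<integral>\<^sup>+x. ennreal (f x) * indicator A x \<partial>M)" if A: "A \<in> sets M" for A
  proof -
    have "emeasure N A = (\<integral>\<^sup>+x. h x * indicator A x \<partial>M)" using h A emeasure_density by metis
    also have "\<dots> = (\<integral>\<^sup>+x. ennreal (f x) * indicator A x \<partial>M)"
      by (rule nn_integral_cong_AE, use h1 in eventually_elim)
         (auto simp: f_def min_absorb2 ennreal_enn2real_if top_unique)
    finally show ?thesis .
  qed
  moreover have "f \<in> borel_measurable M" unfolding f_def using h(1) by measurable
  ultimately show ?thesis using f1 by blast
qed

lemma AE_le_if_set_integrals_le:
  assumes M: "finite_measure M" and f: "f \<in> borel_measurable M" "\<And>x. f x \<in> {0..1::real}"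
    and g: "g \<in> borel_measurable M" "\<And>x. g x \<in> {0..1::real}"
    and le: "\<And>A. A \<in> sets M \<Longrightarrow> (\<integral>\<^sup>+x. ennreal (f x) * indicator A x \<partial>M) \<le> (\<integral>\<^sup>+x. ennreal (g x) * indicator A x \<partial>M)"
  shows "AE x in M. f x \<le> g x"
proof -
  interpret M: finite_measure M by fact
  define A where "A = {x \<in> space M. g x < f x}"
  have A: "A \<in> sets M" unfolding A_def using f(1) g(1) by measurable
  have fin: "(\<integral>\<^sup>+x. ennreal (g x) * indicator A x \<partial>M) \<noteq> \<infinity>"
  proof -
    have "(\<integral>\<^sup>+x. ennreal (g x) * indicator A x \<partial>M) \<le> (\<integral>\<^sup>+x. 1 \<partial>M)"
      using g(2) by (intro nn_integral_mono) (auto simp: indicator_def)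
    also have "\<dots> < \<infinity>" using M.emeasure_finite by (simp add: less_top[symmetric])
    finally show ?thesis by simp
  qed
  have "(\<integral>\<^sup>+x. (ennreal (f x) - ennreal (g x)) * indicator A x \<partial>M)
      = (\<integral>\<^sup>+x. ennreal (f x) * indicator A x - ennreal (g x) * indicator A x \<partial>M)"
    by (intro nn_integral_cong) (auto simp: indicator_def)
  also have "\<dots> = (\<integral>\<^sup>+x. ennreal (f x) * indicator A x \<partial>M) - (\<integral>\<^sup>+x. ennreal (g x) * indicator A x \<partial>M)"
    using f(1) g(1) A fin
    by (intro nn_integral_diff) (auto simp: A_def indicator_def intro!: ennreal_leI)
  also have "\<dots> = 0" using le[OF A] fin by (simp add: diff_eq_0_iff_ennreal top.not_eq_extremum)
  finally have "AE x in M. (ennreal (f x) - ennreal (g x)) * indicator A x = 0"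
    using f(1) g(1) A by (subst (asm) nn_integral_0_iff_AE) auto
  then have "AE x in M. x \<notin> A"
  proof eventually_elim
    case (elim x)
    show ?case
    proof
      assume x: "x \<in> A"
      with elim have "ennreal (f x) \<le> ennreal (g x)" by (simp add: diff_eq_0_iff_ennreal)
      then have "f x \<le> g x" using g(2)[of x] by (subst (asm) ennreal_le_iff) auto
      with x show False by (simp add: A_def)
    qed
  qed
  with AE_space show ?thesis by eventually_elim (auto simp: A_def not_less)
qed

text \<open>
  The kernel at \<open>x\<close> is the interval measure of the right-continuous regularization of the densities, at
  rational levels \<open>q\<close>, of \<open>A \<mapsto> N (A \<times> {..q})\<close> with respect to the first marginal.
\<close>

lemma disintegration_unit_interval:
  fixes N :: "('a \<times> real) measure"
  assumes N: "prob_space N" and sets: "sets N = sets (M \<Otimes>\<^sub>M borel)"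
    and supp: "emeasure N (space M \<times> {0..1}) = 1"
  shows "\<exists>K. K \<in> M \<rightarrow>\<^sub>M prob_algebra borel \<and>
    (\<forall>A\<in>sets M. \<forall>C\<in>sets borel. emeasure N (A \<times> C) = (\<integral>\<^sup>+x. emeasure (K x) C * indicator A x \<partial>distr N M fst))"
proof -
  interpret N: prob_space N by fact
  note [measurable_cong] = sets
  have spN: "space N = space M \<times> UNIV" using sets_eq_imp_space_eq[OF sets] by (simp add: space_pair_measure)
  define \<mu> where "\<mu> = distr N M fst"
  interpret \<mu>: prob_space \<mu> unfolding \<mu>_def by (rule N.prob_space_distr) measurable
  have sets_\<mu>: "sets \<mu> = sets M" by (simp add: \<mu>_def)
  have space_\<mu>: "space \<mu> = space M" by (simp add: \<mu>_def)
  note [measurable_cong] = sets_\<mu>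
  have \<mu>_eq: "emeasure \<mu> A = emeasure N (A \<times> UNIV)" if A: "A \<in> sets M" for A
  proof -
    have "fst -` A \<inter> space N = A \<times> UNIV" using sets.sets_into_space[OF A] by (auto simp: spN)
    then show ?thesis unfolding \<mu>_def using A by (subst emeasure_distr) auto
  qed
  have rect: "A \<times> C \<in> sets N" if "A \<in> sets M" "C \<in> sets borel" for A C
    using that sets by simp
  define \<eta> where "\<eta> q = distr (density N (indicator (space M \<times> {..q}))) M fst" for q :: real
  have \<eta>_eq: "emeasure (\<eta> q) A = emeasure N (A \<times> {..q})" if A: "A \<in> sets M" for A q
  proof -
    have "fst -` A \<inter> space N = A \<times> UNIV" using sets.sets_into_space[OF A] by (auto simp: spN)
    moreover have "(\<lambda>z. indicator (space M \<times> {..q}) z * indicator (A \<times> UNIV) z)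
        = (indicator (A \<times> {..q}) :: _ \<Rightarrow> ennreal)"
      using sets.sets_into_space[OF A] by (auto simp: indicator_def fun_eq_iff)
    ultimately show ?thesis
      unfolding \<eta>_def using A rect[OF A]
      by (subst emeasure_distr) (auto simp: emeasure_density rect)
  qed
  have "\<exists>f. f \<in> borel_measurable \<mu> \<and> (\<forall>x. f x \<in> {0..1::real}) \<and>
    (\<forall>A\<in>sets \<mu>. emeasure (\<eta> q) A = (\<integral>\<^sup>+x. ennreal (f x) * indicator A x \<partial>\<mu>))" for q
  proof (rule dominated_measure_density)
    show "sets (\<eta> q) = sets \<mu>" by (simp add: \<eta>_def sets_\<mu>)
    show "emeasure (\<eta> q) A \<le> emeasure \<mu> A" if "A \<in> sets \<mu>" for A
      using that rect[of A UNIV] by (auto simp: \<eta>_eq \<mu>_eq sets_\<mu> intro!: emeasure_mono)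
  qed unfold_locales
  then obtain f where f: "\<And>q. f q \<in> borel_measurable \<mu>" "\<And>q x. f q x \<in> {0..1::real}"
    "\<And>q A. A \<in> sets M \<Longrightarrow> emeasure N (A \<times> {..q}) = (\<integral>\<^sup>+x. ennreal (f q x) * indicator A x \<partial>\<mu>)"
    unfolding sets_\<mu> using \<eta>_eq by metis
  have fin: "finite_measure \<mu>" by unfold_locales
  have ae_mono: "AE x in \<mu>. f q x \<le> f q' x" if "q \<le> q'" for q q'
    using that rect by (intro AE_le_if_set_integrals_le[OF fin f(1,2) f(1,2)])
      (auto simp: f(3)[symmetric] sets_\<mu> intro!: emeasure_mono)
  have ae_0: "AE x in \<mu>. f q x \<le> 0" if "q < 0" for q
  proof (rule AE_le_if_set_integrals_le[OF fin f(1,2)])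
    fix A assume A: "A \<in> sets \<mu>"
    have "emeasure N (A \<times> {..q}) \<le> emeasure N (space N - space M \<times> {0..1})"
      using A that sets.sets_into_space[of A M] by (intro emeasure_mono) (auto simp: sets_\<mu> spN rect)
    also have "\<dots> = 0"
      using supp N.emeasure_space_1 rect[of "space M" "{0..1}"] by (subst emeasure_compl) auto
    finally show "(\<integral>\<^sup>+x. ennreal (f q x) * indicator A x \<partial>\<mu>) \<le> (\<integral>\<^sup>+x. ennreal 0 * indicator A x \<partial>\<mu>)"
      using A by (simp add: f(3)[symmetric] sets_\<mu>)
  qed auto
  have ae_1: "AE x in \<mu>. 1 \<le> f q x" if "1 \<le> q" for q
  proof (rule AE_le_if_set_integrals_le[OF fin _ _ f(1,2)])
    fix A assume A: "A \<in> sets \<mu>"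
    have "emeasure \<mu> A = emeasure N (A \<times> UNIV)" using A by (simp add: \<mu>_eq sets_\<mu>)
    also have "\<dots> \<le> emeasure N (A \<times> {..q} \<union> (space N - space M \<times> {0..1}))"
      using A that sets.sets_into_space[of A M] by (intro emeasure_mono) (auto simp: sets_\<mu> spN rect)
    also have "\<dots> \<le> emeasure N (A \<times> {..q}) + emeasure N (space N - space M \<times> {0..1})"
      using A by (intro emeasure_subadditive) (auto simp: sets_\<mu> rect)
    also have "emeasure N (space N - space M \<times> {0..1}) = 0"
      using supp N.emeasure_space_1 rect[of "space M" "{0..1}"] by (subst emeasure_compl) auto
    finally show "(\<integral>\<^sup>+x. ennreal 1 * indicator A x \<partial>\<mu>) \<le> (\<integral>\<^sup>+x. ennreal (f q x) * indicator A x \<partial>\<mu>)"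
      using A by (simp add: f(3)[symmetric] sets_\<mu>)
  qed auto
  define P where "P x \<longleftrightarrow> (\<forall>q\<in>\<rat>. \<forall>q'\<in>\<rat>. q \<le> q' \<longrightarrow> f q x \<le> f q' x) \<and> (\<forall>q\<in>\<rat>. q < 0 \<longrightarrow> f q x \<le> 0) \<and>
      (\<forall>q\<in>\<rat>. 1 \<le> q \<longrightarrow> 1 \<le> f q x)" for x
  have cQ: "countable (\<rat> :: real set)" by (rule countable_rat)
  have ae_P: "AE x in \<mu>. P x"
    unfolding P_def using ae_mono ae_0 ae_1 by (auto simp: AE_ball_countable[OF cQ] AE_conj_iff AE_impI)
  have [measurable]: "f q \<in> borel_measurable M" for q using f(1)[of q] by measurable
  have P_meas[measurable]: "Measurable.pred M P"
    unfolding P_def using cQ by measurable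
  \<comment> \<open>Off the almost sure set \<open>P\<close> the densities are replaced by the
    distribution function of the point mass at 0, so that every \<open>x\<close> without exception
    yields a probability measure.\<close>
  define h where "h q x = (if P x then f q x else indicat_real {0..} q)" for q x
  have h_mono: "h q x \<le> h q' x" if "q \<in> \<rat>" "q' \<in> \<rat>" "q \<le> q'" for q q' x
    using that by (auto simp: h_def P_def indicator_def)
  have h_0: "h q x = 0" if "q \<in> \<rat>" "q < 0" for q x
    using that f(2)[of q x] by (auto simp: h_def P_def indicator_def intro!: antisym)
  have h_1: "h q x = 1" if "q \<in> \<rat>" "1 \<le> q" for q x
    using that f(2)[of q x] by (auto simp: h_def P_def indicator_def intro!: antisym)
  have h_01: "0 \<le> h q x" "h q x \<le> 1" for q x using f(2)[of q x] by (auto simp: h_def indicator_def)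
  have h_meas[measurable]: "h q \<in> borel_measurable M" for q unfolding h_def by measurable
  define F where "F x t = (INF q\<in>\<rat> \<inter> {t<..}. h q x)" for x and t :: real
  have neQ: "\<rat> \<inter> {t<..} \<noteq> {}" for t :: real using Rats_dense_in_real[of t "t + 1"] by auto
  have bddQ: "bdd_below ((\<lambda>q. h q x) ` (\<rat> \<inter> {t<..}))" for x t
    by (rule bdd_belowI[of _ 0]) (auto simp: h_01)
  have F_le: "F x t \<le> h q x" if "q \<in> \<rat>" "t < q" for x t q
    unfolding F_def using that by (intro cINF_lower bddQ) auto
  have F_ge: "h q x \<le> F x t" if "q \<in> \<rat>" "q \<le> t" for x t q
    unfolding F_def using that by (intro cINF_greatest neQ h_mono) auto
  have F_mono: "F x t \<le> F x t'" if "t \<le> t'" for x t t'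
    unfolding F_def using that by (intro cINF_superset_mono neQ bddQ) auto
  have F_near: "\<exists>q\<in>\<rat>. t < q \<and> h q x < F x t + e" if "0 < e" for x t e
  proof -
    have "(INF q\<in>\<rat> \<inter> {t<..}. h q x) < F x t + e" using that by (simp add: F_def)
    then show ?thesis unfolding cINF_less_iff[OF neQ bddQ] by blast
  qed
  have F_cont: "continuous (at_right t) (F x)" for x t
    unfolding continuous_within
  proof (rule tendstoI)
    fix e :: real assume "0 < e"
    then obtain q where q: "q \<in> \<rat>" "t < q" "h q x < F x t + e" using F_near by blast
    have "dist (F x u) (F x t) < e" if "t < u" "u < q" for u
      using F_mono[of t u x] F_le[OF q(1) that(2), of x] q(3) that by (simp add: dist_real_def)
    then show "\<forall>\<^sub>F u in at_right t. dist (F x u) (F x t) < e"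
      using q(2) by (auto simp: eventually_at_right)
  qed
  have F_neg: "F x t = 0" if "t < 0" for x t
  proof (rule antisym)
    obtain q where "q \<in> \<rat>" "t < q" "q < 0" using Rats_dense_in_real[OF \<open>t < 0\<close>] by blast
    then show "F x t \<le> 0" using F_le[of q t x] h_0[of q x] by simp
    show "0 \<le> F x t" unfolding F_def by (intro cINF_greatest neQ h_01)
  qed
  have F_top: "F x t = 1" if "1 \<le> t" for x t
  proof (rule antisym)
    obtain q where "q \<in> \<rat>" "t < q" using neQ[of t] by blast
    then show "F x t \<le> 1" using F_le[of q t x] h_01(2)[of q x] by linarith
    show "1 \<le> F x t" unfolding F_def using that by (intro cINF_greatest neQ) (simp add: h_1)
  qed
  have lim_bot: "(F x \<longlongrightarrow> 0) at_bot" for x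
    by (intro tendsto_eventually) (auto simp: eventually_at_bot_dense intro!: exI[of _ 0] F_neg)
  have lim_top: "(F x \<longlongrightarrow> 1) at_top" for x
    by (intro tendsto_eventually) (auto simp: eventually_at_top_linorder intro!: exI[of _ 1] F_top)
  define K where "K x = interval_measure (F x)" for x
  have rdK: "real_distribution (K x)" for x
    unfolding K_def using F_mono F_cont lim_bot lim_top by (rule real_distribution_interval_measure)
  have K_atMost: "emeasure (K x) {..t} = ennreal (F x t)" for x t
    unfolding K_def using F_mono F_cont lim_bot by (rule emeasure_interval_measure_Iic)
  have F_meas[measurable]: "(\<lambda>x. F x t) \<in> borel_measurable M" for t
    unfolding F_def using cQ
    by (intro borel_measurable_cINF[where I="\<rat> \<inter> {t<..}"] countable_Int1 bddQ) auto
  have K_meas: "K \<in> M \<rightarrow>\<^sub>M prob_algebra borel"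
  proof (rule measurable_prob_algebra_generated[where G="range atMost" and \<Omega>=UNIV])
    show "sets (borel :: real measure) = sigma_sets UNIV (range atMost)"
      by (simp add: borel_eq_atMost)
    show "Int_stable (range (atMost :: real \<Rightarrow> _))"
      by (auto simp: Int_stable_def)
    show "prob_space (K x)" for x using rdK by (simp add: real_distribution_def)
    show "sets (K x) = sets borel" for x by (simp add: K_def)
    show "(\<lambda>x. emeasure (K x) A) \<in> borel_measurable M" if "A \<in> range atMost" for A
      using that by (auto simp: K_atMost)
  qed simp
  have atMost_eq: "emeasure N (A \<times> {..t}) = (\<integral>\<^sup>+x. emeasure (K x) {..t} * indicator A x \<partial>\<mu>)"
    if A: "A \<in> sets M" for A t
  proof -
    \<comment> \<open>The regularized function is built from rational levels only. Rationals
      strictly above \<open>t\<close> and tending to \<open>t\<close> carry the identity over to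
      \<open>t\<close>, both sides being continuous from the right.\<close>
    have "\<exists>q\<in>\<rat>. t < q \<and> q < t + inverse (real (Suc n))" for n
      by (intro Rats_dense_in_real) simp
    then obtain q where q: "\<And>n. q n \<in> \<rat>" "\<And>n. t < q n" "\<And>n. q n < t + inverse (real (Suc n))"
      by metis
    have q_lim: "q \<longlonglongrightarrow> t"
    proof (rule tendsto_sandwich[of "\<lambda>_. t" q _ "\<lambda>n. t + inverse (real (Suc n))"])
      show "(\<lambda>n. t + inverse (real (Suc n))) \<longlonglongrightarrow> t"
        using tendsto_add[OF tendsto_const LIMSEQ_inverse_real_of_nat, of t] by simp
    qed (use q(2,3) in \<open>simp_all add: less_imp_le del: of_nat_Suc\<close>)
    have ev: "\<forall>\<^sub>F n in sequentially. q n < u" if "t < u" for u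
      using order_tendstoD(2)[OF q_lim that] .
    have "(\<lambda>n. \<integral>\<^sup>+z. indicator (A \<times> {..q n}) z \<partial>N) \<longlonglongrightarrow> (\<integral>\<^sup>+z. indicator (A \<times> {..t}) z \<partial>N)"
    proof (rule nn_integral_dominated_convergence[where w="\<lambda>_. 1"])
      show "AE z in N. (\<lambda>n. indicator (A \<times> {..q n}) z :: ennreal) \<longlonglongrightarrow> indicator (A \<times> {..t}) z"
      proof (intro AE_I2 tendsto_eventually)
        fix z
        show "\<forall>\<^sub>F n in sequentially. indicator (A \<times> {..q n}) z = (indicator (A \<times> {..t}) z :: ennreal)"
        proof (cases "snd z \<le> t")
          case True
          then show ?thesis
            by (intro always_eventually allI) (auto simp: indicator_def intro: order_trans[OF _ less_imp_le[OF q(2)]])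
        next
          case False
          then show ?thesis using ev[of "snd z"] by (auto elim!: eventually_mono simp: indicator_def)
        qed
      qed
    qed (use A rect in \<open>auto simp: indicator_def N.emeasure_space_1\<close>)
    then have lim1: "(\<lambda>n. emeasure N (A \<times> {..q n})) \<longlonglongrightarrow> emeasure N (A \<times> {..t})"
      using A rect by simp
    have h_lim: "(\<lambda>n. h (q n) x) \<longlonglongrightarrow> F x t" for x
    proof (rule order_tendstoI)
      fix a assume "a < F x t"
      then show "\<forall>\<^sub>F n in sequentially. a < h (q n) x"
        using F_le[OF q(1,2), of x] by (auto intro: always_eventually less_le_trans)
    next
      fix a assume "F x t < a"
      then obtain u where u: "u \<in> \<rat>" "t < u" "h u x < a" using F_near[of "a - F x t" t x] by auto
      show "\<forall>\<^sub>F n in sequentially. h (q n) x < a"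
        using ev[OF u(2)] by eventually_elim (use h_mono[OF q(1) u(1)] u(3) in \<open>meson less_imp_le le_less_trans\<close>)
    qed
    have "(\<lambda>n. \<integral>\<^sup>+x. ennreal (h (q n) x) * indicator A x \<partial>\<mu>) \<longlonglongrightarrow> (\<integral>\<^sup>+x. ennreal (F x t) * indicator A x \<partial>\<mu>)"
    proof (rule nn_integral_dominated_convergence[where w="\<lambda>_. 1"])
      show "AE x in \<mu>. (\<lambda>n. ennreal (h (q n) x) * indicator A x) \<longlonglongrightarrow> ennreal (F x t) * indicator A x"
        using h_lim by (intro AE_I2) (auto simp: indicator_def intro: tendsto_ennrealI)
    qed (use A h_01 in \<open>auto simp: indicator_def \<mu>.emeasure_space_1 sets_\<mu>\<close>)
    moreover have "(\<integral>\<^sup>+x. ennreal (h (q n) x) * indicator A x \<partial>\<mu>) = emeasure N (A \<times> {..q n})" for n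
      unfolding f(3)[OF A] by (rule nn_integral_cong_AE, use ae_P in eventually_elim) (simp add: h_def)
    ultimately show ?thesis using LIMSEQ_unique[OF lim1] by (simp add: K_atMost)
  qed
  have "emeasure N (A \<times> C) = (\<integral>\<^sup>+x. emeasure (K x) C * indicator A x \<partial>\<mu>)"
    if A: "A \<in> sets M" and C: "C \<in> sets borel" for A C
  proof -
    \<comment> \<open>For fixed \<open>A\<close> both sides are finite measures in \<open>C\<close>
      on the line, so it suffices that they agree on half-lines.\<close>
    define L1 where "L1 = distr (density N (indicator (A \<times> UNIV))) borel snd"
    define L2 where "L2 = density \<mu> (indicator A) \<bind> K"
    have K\<mu>: "K \<in> density \<mu> (indicator A) \<rightarrow>\<^sub>M subprob_algebra borel"
      using measurable_prob_algebraD[OF K_meas] by measurable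
    have L1: "emeasure L1 C = emeasure N (A \<times> C)" if "C \<in> sets borel" for C
    proof -
      have "snd -` C \<inter> space N = space M \<times> C" by (auto simp: spN)
      moreover have "(\<lambda>z. indicator (A \<times> UNIV) z * indicator (space M \<times> C) z) = (indicator (A \<times> C) :: _ \<Rightarrow> ennreal)"
        using sets.sets_into_space[OF A] by (auto simp: indicator_def fun_eq_iff)
      ultimately show ?thesis
        unfolding L1_def using A that rect by (subst emeasure_distr) (auto simp: emeasure_density)
    qed
    have L2: "emeasure L2 C = (\<integral>\<^sup>+x. emeasure (K x) C * indicator A x \<partial>\<mu>)" if C: "C \<in> sets borel" for C
    proof -
      have [measurable]: "(\<lambda>x. emeasure (K x) C) \<in> borel_measurable \<mu>"
        using measurable_compose[OF measurable_prob_algebraD[OF K_meas] measurable_emeasure_subprob_algebra[OF C]]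
        by measurable
      have "emeasure L2 C = (\<integral>\<^sup>+x. emeasure (K x) C \<partial>density \<mu> (indicator A))"
        unfolding L2_def using K\<mu> C \<mu>.not_empty by (intro emeasure_bind) auto
      also have "\<dots> = (\<integral>\<^sup>+x. indicator A x * emeasure (K x) C \<partial>\<mu>)"
        using A by (intro nn_integral_density) (auto simp: sets_\<mu>)
      finally show ?thesis by (simp add: mult.commute)
    qed
    have "L1 = L2"
    proof (rule measure_eqI_generator_eq[where E="range atMost" and \<Omega>=UNIV and A="\<lambda>n. {..real n}"])
      show "Int_stable (range (atMost :: real \<Rightarrow> _))" by (auto simp: Int_stable_def)
      show "sets L1 = sigma_sets UNIV (range atMost)" by (simp add: L1_def borel_eq_atMost)
      have "sets L2 = sets borel" unfolding L2_def
        using K\<mu> \<mu>.not_empty by (intro sets_bind) (auto simp: K_def)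
      then show "sets L2 = sigma_sets UNIV (range atMost)" by (simp add: borel_eq_atMost)
      show "emeasure L1 X = emeasure L2 X" if "X \<in> range atMost" for X
        using that by (auto simp: L1 L2 atMost_eq[OF A])
      show "(\<Union>n. {..real n}) = UNIV" using real_arch_simple by auto
      show "emeasure L1 {..real n} \<noteq> \<infinity>" for n by (simp add: L1)
    qed auto
    then show ?thesis using L1[OF C] L2[OF C] by simp
  qed
  with K_meas show ?thesis unfolding \<mu>_def by blast
qed

text \<open>The coding with \<open>w = 0\<close>, whose sublevel sets are empty or the whole compact
  space, maps the actions into the unit interval and has a measurable left inverse
  \<open>g'\<close>. The kernel obtained on the reals is transported back by
  \<open>g'\<close>.\<close>

theorem disintegration:
  fixes \<nu> :: "('x::second_countable_topology \<times> 'a::{metric_space, second_countable_topology}) measure"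
  assumes A: "compact (UNIV :: 'a set)" and \<nu>: "\<nu> \<in> borel_probs"
  shows "\<exists>K. K \<in> borel \<rightarrow>\<^sub>M prob_algebra borel \<and>
    \<nu> = distr \<nu> borel fst \<bind> (\<lambda>x. K x \<bind> (\<lambda>a. return (borel \<Otimes>\<^sub>M borel) (x, a)))"
proof -
  have "compact {x::'a. (0::real) \<le> r}" for r using A by (cases "0 \<le> r") auto
  from real_coding[of "\<lambda>_::'a. 0::real", OF _ this]
  obtain s :: "'a \<Rightarrow> real" and g D where s: "s \<in> borel_measurable borel" and D: "closed D" "range s \<subseteq> D"
    and g: "continuous_on D g" "\<And>x. g (s x) = x" and s01: "\<And>x. 0 \<le> s x \<and> s x \<le> 1"
    by auto
  define g' where "g' y = (if y \<in> D then g y else undefined)" for y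
  have g'_meas[measurable]: "g' \<in> borel_measurable borel"
    unfolding g'_def using D(1) g(1) by (intro borel_measurable_continuous_on_if) auto
  have g's: "g' (s a) = a" for a using D(2) g(2) by (auto simp: g'_def)
  note s[measurable]
  have sets_\<nu>: "sets \<nu> = sets (borel \<Otimes>\<^sub>M borel)" using sets_borel_probs[OF \<nu>] by (simp only: borel_prod)
  note [measurable_cong] = sets_\<nu>
  have sp: "space \<nu> = UNIV" using sets_eq_imp_space_eq[OF sets_borel_probs[OF \<nu>]] by simp
  interpret \<nu>: prob_space \<nu> using prob_space_borel_probs[OF \<nu>] .
  define N where "N = distr \<nu> (borel \<Otimes>\<^sub>M borel) (\<lambda>(x, a). (x, s a))"
  have N_eq: "emeasure N (B \<times> C) = emeasure \<nu> (B \<times> s -` C)" if "B \<in> sets borel" "C \<in> sets borel" for B C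
  proof -
    have "(\<lambda>(x, a). (x, s a)) -` (B \<times> C) \<inter> space \<nu> = B \<times> s -` C" by (auto simp: sp)
    then show ?thesis unfolding N_def using that by (subst emeasure_distr) auto
  qed
  have "prob_space N" unfolding N_def by (rule \<nu>.prob_space_distr) measurable
  moreover have "emeasure N (space borel \<times> {0..1}) = 1"
  proof -
    have "UNIV \<times> s -` {0..1} = space \<nu>" using s01 by (auto simp: sp)
    then show ?thesis using \<nu>.emeasure_space_1 by (simp add: N_eq)
  qed
  ultimately obtain K where K: "K \<in> borel \<rightarrow>\<^sub>M prob_algebra borel"
    and NK: "\<And>B C. B \<in> sets borel \<Longrightarrow> C \<in> sets borel \<Longrightarrow>
      emeasure N (B \<times> C) = (\<integral>\<^sup>+x. emeasure (K x) C * indicator B x \<partial>distr N borel fst)"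
    using disintegration_unit_interval[of N borel] unfolding N_def sets_distr by blast
  have fst_N: "distr N borel fst = distr \<nu> borel fst"
    unfolding N_def by (subst distr_distr) (auto simp: o_def split_beta' intro!: distr_cong)
  define K' where "K' x = distr (K x) borel g'" for x
  have K': "K' \<in> borel \<rightarrow>\<^sub>M prob_algebra borel"
    unfolding K'_def using measurable_compose[OF K measurable_distr_prob_space[OF g'_meas]] by simp
  define \<mu> where "\<mu> = distr \<nu> borel fst"
  have \<mu>: "\<mu> \<in> borel_probs" unfolding \<mu>_def by (simp add: space_prob_algebra \<nu>.prob_space_distr)
  interpret \<mu>: prob_space \<mu> using prob_space_borel_probs[OF \<mu>] .
  define R where "R = (\<lambda>x. K' x \<bind> (\<lambda>a. return (borel \<Otimes>\<^sub>M borel) (x, a)))"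
  have R: "R \<in> borel \<rightarrow>\<^sub>M prob_algebra (borel \<Otimes>\<^sub>M borel)"
    unfolding R_def by (intro measurable_bind_prob_space2[OF K']) measurable
  have Rx: "emeasure (R x) (B \<times> C) = emeasure (K' x) C * indicator B x"
    if "B \<in> sets borel" "C \<in> sets borel" for x B C
  proof -
    have Kx: "K' x \<in> space (prob_algebra borel)" using measurable_space[OF K'] by simp
    have ret: "(\<lambda>a. return (borel \<Otimes>\<^sub>M borel) (x, a)) \<in> borel \<rightarrow>\<^sub>M prob_algebra (borel \<Otimes>\<^sub>M borel)"
      by measurable
    have "emeasure (R x) (B \<times> C) = (\<integral>\<^sup>+a. emeasure (return (borel \<Otimes>\<^sub>M borel) (x, a)) (B \<times> C) \<partial>K' x)"
      unfolding R_def using that by (intro emeasure_bind_prob_algebra[OF Kx ret]) auto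
    also have "\<dots> = (\<integral>\<^sup>+a. indicator B x * indicator C a \<partial>K' x)"
      using that by (intro nn_integral_cong) (auto simp: indicator_def)
    also have "\<dots> = emeasure (K' x) C * indicator B x"
      using that Kx by (subst nn_integral_cmult) (auto simp: space_prob_algebra mult.commute)
    finally show ?thesis .
  qed
  have eq: "emeasure \<nu> (B \<times> C) = emeasure (\<mu> \<bind> R) (B \<times> C)" if B: "B \<in> sets borel" and C: "C \<in> sets borel" for B C
  proof -
    have gC: "g' -` C \<in> sets borel" using measurable_sets[OF g'_meas C] by simp
    have "emeasure \<nu> (B \<times> C) = emeasure N (B \<times> g' -` C)"
      using B gC by (simp add: N_eq vimage_def g's)
    also have "\<dots> = (\<integral>\<^sup>+x. emeasure (K x) (g' -` C) * indicator B x \<partial>\<mu>)"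
      using NK[OF B gC] by (simp add: fst_N \<mu>_def)
    also have "\<dots> = (\<integral>\<^sup>+x. emeasure (R x) (B \<times> C) \<partial>\<mu>)"
    proof (intro nn_integral_cong)
      fix x
      have "K x \<in> space (prob_algebra borel)" using measurable_space[OF K] by simp
      then have "sets (K x) = sets borel" "space (K x) = UNIV"
        by (auto simp: space_prob_algebra dest: sets_eq_imp_space_eq)
      then have "emeasure (K' x) C = emeasure (K x) (g' -` C)"
        unfolding K'_def using C by (subst emeasure_distr) (auto cong: measurable_cong_sets)
      then show "emeasure (K x) (g' -` C) * indicator B x = emeasure (R x) (B \<times> C)"
        by (simp add: Rx[OF B C])
    qed
    also have "\<dots> = emeasure (\<mu> \<bind> R) (B \<times> C)"
      using B C by (intro emeasure_bind_prob_algebra[OF \<mu> R, symmetric]) auto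
    finally show ?thesis .
  qed
  have "\<nu> = \<mu> \<bind> R"
  proof (rule measure_eqI_generator_eq[where \<Omega>=UNIV and A="\<lambda>_. UNIV"
        and E="{B \<times> C | B C. B \<in> sets (borel :: 'x measure) \<and> C \<in> sets (borel :: 'a measure)}"])
    let ?E = "{B \<times> C | B C. B \<in> sets (borel :: 'x measure) \<and> C \<in> sets (borel :: 'a measure)}"
    show "Int_stable ?E" using Int_stable_pair_measure_generator .
    show "sets \<nu> = sigma_sets UNIV ?E" using sets_\<nu> by (simp add: sets_pair_measure)
    show "sets (\<mu> \<bind> R) = sigma_sets UNIV ?E" by (simp add: sets_bind'[OF \<mu> R] sets_pair_measure)
    show "emeasure \<nu> X = emeasure (\<mu> \<bind> R) X" if "X \<in> ?E" for X using that eq by blast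
    show "range (\<lambda>_. UNIV) \<subseteq> ?E" by (auto intro!: exI[of _ UNIV])
  qed auto
  with K' show ?thesis unfolding \<mu>_def R_def by blast
qed

section \<open>Fixed points of discretized maps on measures\<close>

definition fin_meas :: "nat \<Rightarrow> (nat \<Rightarrow> real) \<Rightarrow> (nat \<Rightarrow> 's::topological_space) \<Rightarrow> 's measure" where
  "fin_meas m p z = distr (point_measure {..<m} (\<lambda>i. ennreal (p i))) borel z"

lemma sets_fin_meas [simp]: "sets (fin_meas m p z) = sets borel"
  by (simp add: fin_meas_def)

lemma nn_integral_fin_meas:
  "f \<in> borel_measurable borel \<Longrightarrow> (\<integral>\<^sup>+x. f x \<partial>fin_meas m p z) = (\<Sum>i<m. f (z i) * ennreal (p i))"
  unfolding fin_meas_def by (subst nn_integral_distr) (auto simp: nn_integral_point_measure_finite mult.commute)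

lemma emeasure_fin_meas:
  "B \<in> sets borel \<Longrightarrow> emeasure (fin_meas m p z) B = (\<Sum>i<m. indicator B (z i) * ennreal (p i))"
  using nn_integral_fin_meas[of "indicator B" m p z] by simp

lemma integral_fin_meas:
  fixes f :: "'s::topological_space \<Rightarrow> real"
  assumes "\<And>i. i < m \<Longrightarrow> 0 \<le> p i" "f \<in> borel_measurable borel"
  shows "(\<integral>x. f x \<partial>fin_meas m p z) = (\<Sum>i<m. p i * f (z i))"
  unfolding fin_meas_def using assms
  using lebesgue_integral_point_measure_finite[of "{..<m}" p "\<lambda>i. f (z i)"]
  by (subst integral_distr) auto

lemma fin_meas_borel_probs:
  assumes "\<And>i. i < m \<Longrightarrow> 0 \<le> p i" "(\<Sum>i<m. p i) = 1"
  shows "fin_meas m p z \<in> borel_probs"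
proof -
  have "emeasure (fin_meas m p z) UNIV = 1"
    using assms sum_ennreal[of "{..<m}" p] by (simp add: emeasure_fin_meas)
  then show ?thesis
    by (auto simp: space_prob_algebra sets_eq_imp_space_eq[OF sets_fin_meas] intro!: prob_spaceI)
qed

lemma fin_meas_kernel:
  assumes "\<And>i x. i < m \<Longrightarrow> 0 \<le> p x i" "\<And>x. (\<Sum>i<m. p x i) = 1" "\<And>i. i < m \<Longrightarrow> (\<lambda>x. p x i) \<in> borel_measurable M"
    and z: "\<And>i. i < m \<Longrightarrow> (\<lambda>x. z x i) \<in> borel_measurable M"
  shows "(\<lambda>x. fin_meas m (p x) (z x)) \<in> M \<rightarrow>\<^sub>M prob_algebra borel"
proof (rule measurable_prob_algebra_generated[where G="sets borel" and \<Omega>=UNIV])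
  show "sets borel = sigma_sets UNIV (sets borel)"
    by (metis sets.sigma_sets_eq space_borel)
  show "Int_stable (sets borel)" by (rule sets.Int_stable)
  show "prob_space (fin_meas m (p x) (z x))" for x
    using fin_meas_borel_probs[OF assms(1,2)] by (auto simp: space_prob_algebra)
  show "(\<lambda>x. emeasure (fin_meas m (p x) (z x)) A) \<in> borel_measurable M" if A: "A \<in> sets borel" for A
    unfolding emeasure_fin_meas[OF A]
  proof (intro borel_measurable_sum borel_measurable_times_ennreal)
    fix i assume "i \<in> {..<m}"
    then show "(\<lambda>x. indicator A (z x i) :: ennreal) \<in> borel_measurable M"
      using measurable_compose[OF z borel_measurable_indicator[OF A]] by simp
    show "(\<lambda>x. ennreal (p x i)) \<in> borel_measurable M" using \<open>i \<in> {..<m}\<close> assms(3) by simp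
  qed
qed auto

text \<open>Weights proportional to how far \<open>q i\<close> stays below the minimum plus
  \<open>1 / m\<close>: a continuous substitute for choosing a minimizer, with a tolerance that
  vanishes as the number of candidates grows. It serves both for actions, with \<open>q\<close> the
  action values, and for points, with \<open>q\<close> the distances.\<close>

definition soft_argmin :: "nat \<Rightarrow> (nat \<Rightarrow> real) \<Rightarrow> nat \<Rightarrow> real" where
  "soft_argmin m q i =
     max 0 (Min (q ` {..<m}) + 1 / real m - q i) / (\<Sum>j<m. max 0 (Min (q ` {..<m}) + 1 / real m - q j))"

lemma soft_argmin_denominator:
  assumes "0 < m"
  shows "0 < (\<Sum>j<m. max 0 (Min (q ` {..<m}) + 1 / real m - q j))"
proof -
  have "Min (q ` {..<m}) \<in> q ` {..<m}" using assms by (intro Min_in) auto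
  then obtain j where "j < m" "Min (q ` {..<m}) = q j" by auto
  then show ?thesis using assms by (intro sum_pos2[of _ j]) auto
qed

lemma soft_argmin_nonneg: "0 \<le> soft_argmin m q i"
  unfolding soft_argmin_def by (intro divide_nonneg_nonneg sum_nonneg) auto

lemma sum_soft_argmin: "0 < m \<Longrightarrow> (\<Sum>i<m. soft_argmin m q i) = 1"
  using soft_argmin_denominator[of m q] by (simp add: soft_argmin_def sum_divide_distrib[symmetric])

lemma soft_argmin_le_1: "i < m \<Longrightarrow> soft_argmin m q i \<le> 1"
  using sum_soft_argmin[of m q] member_le_sum[of i "{..<m}" "soft_argmin m q"] soft_argmin_nonneg[of m q]
  by simp

text \<open>A nonzero weight means that the positive part in the numerator is not cut off.\<close>

lemma soft_argmin_near_minimal: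
  assumes "soft_argmin m q i \<noteq> 0" "j < m"
  shows "q i < q j + 1 / real m"
proof -
  have "q i < Min (q ` {..<m}) + 1 / real m"
    using assms(1) by (auto simp: soft_argmin_def max_def split: if_splits)
  also have "\<dots> \<le> q j + 1 / real m" using assms(2) by simp
  finally show ?thesis .
qed

lemma tendsto_Min_image:
  fixes q :: "'i \<Rightarrow> nat \<Rightarrow> real"
  assumes "0 < m" "\<And>i. i < m \<Longrightarrow> ((\<lambda>k. q k i) \<longlongrightarrow> l i) F"
  shows "((\<lambda>k. Min (q k ` {..<m})) \<longlongrightarrow> Min (l ` {..<m})) F"
  using assms
proof (induction m)
  case (Suc m)
  show ?case
  proof (cases "m = 0")
    case False
    then have "Min (u ` {..<Suc m}) = min (u m) (Min (u ` {..<m}))" for u :: "nat \<Rightarrow> real"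
      by (subst lessThan_Suc, subst image_insert, subst Min_insert) auto
    moreover have "((\<lambda>k. min (q k m) (Min (q k ` {..<m}))) \<longlongrightarrow> min (l m) (Min (l ` {..<m}))) F"
      using Suc False by (intro tendsto_min) auto
    ultimately show ?thesis by simp
  qed (use Suc in \<open>simp add: lessThan_Suc\<close>)
qed simp

lemma tendsto_soft_argmin:
  fixes q :: "'i \<Rightarrow> nat \<Rightarrow> real"
  assumes "i < m" and q: "\<And>i. i < m \<Longrightarrow> ((\<lambda>k. q k i) \<longlongrightarrow> l i) F"
  shows "((\<lambda>k. soft_argmin m (q k) i) \<longlongrightarrow> soft_argmin m l i) F"
proof -
  have m: "0 < m" using assms(1) by simp
  have "((\<lambda>k. max 0 (Min (q k ` {..<m}) + 1 / real m - q k j)) \<longlongrightarrow> max 0 (Min (l ` {..<m}) + 1 / real m - l j)) F"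
    if "j < m" for j
    using that by (intro tendsto_intros tendsto_max tendsto_Min_image m q)
  then show ?thesis
    unfolding soft_argmin_def using assms(1) soft_argmin_denominator[OF m, of l]
    by (intro tendsto_divide tendsto_sum) auto
qed

lemma continuous_soft_argmin:
  fixes q :: "'s::topological_space \<Rightarrow> nat \<Rightarrow> real"
  assumes "i < m" "\<And>i. i < m \<Longrightarrow> continuous_on UNIV (\<lambda>x. q x i)"
  shows "continuous_on UNIV (\<lambda>x. soft_argmin m (q x) i)"
  using assms unfolding continuous_on_def by (auto intro: tendsto_soft_argmin)

section \<open>Discretization of measures along a dense sequence\<close>

lemma dense_sequence_exists:
  "\<exists>z :: nat \<Rightarrow> 's::{metric_space, second_countable_topology}. \<forall>x e. 0 < e \<longrightarrow> (\<exists>i. dist x (z i) < e)"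
proof -
  obtain D :: "'s set" where D: "countable D" "\<And>X. open X \<Longrightarrow> X \<noteq> {} \<Longrightarrow> \<exists>d\<in>D. d \<in> X"
    using countable_dense_setE by blast
  then have "D \<noteq> {}" using D(2)[of UNIV] by auto
  then have r: "range (from_nat_into D) = D" using D(1) by (rule range_from_nat_into)
  have "\<exists>i. dist x (from_nat_into D i) < e" if "0 < e" for x e
  proof -
    have "ball x e \<noteq> {}" using that by simp
    then obtain d where "d \<in> D" "dist x d < e" using D(2)[OF open_ball] by (auto simp: mem_ball)
    moreover from this obtain i where "d = from_nat_into D i" using r by (metis rangeE)
    ultimately show ?thesis by blast
  qed
  then show ?thesis by blast
qed

text \<open>A continuous partition of unity for \<open>0 < m\<close>: among the first
  \<open>m\<close> points, only those whose distance from \<open>x\<close> is almost minimal carry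
  weight.\<close>

definition proximity :: "nat \<Rightarrow> (nat \<Rightarrow> 's::metric_space) \<Rightarrow> 's \<Rightarrow> nat \<Rightarrow> real" where
  "proximity m z x = soft_argmin m (\<lambda>i. dist x (z i))"

lemma proximity_continuous: "i < m \<Longrightarrow> continuous_on UNIV (\<lambda>x. proximity m z x i)"
  unfolding proximity_def by (intro continuous_soft_argmin continuous_intros)

lemma proximity_bounds: "i < m \<Longrightarrow> \<bar>proximity m z x i\<bar> \<le> 1"
  using soft_argmin_nonneg soft_argmin_le_1 by (simp add: proximity_def)

lemma proximity_integrable: "M \<in> borel_probs \<Longrightarrow> i < m \<Longrightarrow> integrable M (\<lambda>x. proximity m z x i)"
  by (intro borel_probs_integrable[where B=1] borel_measurable_continuous_onI proximity_continuous)
    (auto simp: proximity_bounds)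

text \<open>The dual of replacing a test function \<open>f\<close> by its averages
  \<open>\<Sum>i<m. proximity m z x i * f (z i)\<close>. It depends on \<open>M\<close> through
  \<open>m\<close> numbers only, which brings Brouwer's theorem within reach.\<close>

definition discretize :: "nat \<Rightarrow> (nat \<Rightarrow> 's::metric_space) \<Rightarrow> 's measure \<Rightarrow> 's measure" where
  "discretize m z M = fin_meas m (\<lambda>i. \<integral>x. proximity m z x i \<partial>M) z"

lemma proximity_integral_nonneg: "0 \<le> (\<integral>x. proximity m z x i \<partial>M)"
  unfolding proximity_def by (intro Bochner_Integration.integral_nonneg soft_argmin_nonneg)

lemma sum_proximity_integral:
  assumes "M \<in> borel_probs" "0 < m"
  shows "(\<Sum>i<m. \<integral>x. proximity m z x i \<partial>M) = 1"
proof -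
  have "(\<Sum>i<m. \<integral>x. proximity m z x i \<partial>M) = (\<integral>x. (\<Sum>i<m. proximity m z x i) \<partial>M)"
    using assms by (intro Bochner_Integration.integral_sum[symmetric] proximity_integrable) auto
  also have "\<dots> = 1"
    using prob_space.prob_space[OF prob_space_borel_probs[OF assms(1)]] assms(2)
    by (simp add: proximity_def sum_soft_argmin)
  finally show ?thesis .
qed

lemma discretize_borel_probs: "M \<in> borel_probs \<Longrightarrow> 0 < m \<Longrightarrow> discretize m z M \<in> borel_probs"
  unfolding discretize_def
  by (intro fin_meas_borel_probs proximity_integral_nonneg sum_proximity_integral)

lemma proximity_average_cont_conv:
  fixes f :: "'s::metric_space \<Rightarrow> real"
  assumes dense: "\<And>x e. 0 < e \<Longrightarrow> \<exists>i. dist x (z i) < e" and m: "filterlim m at_top sequentially"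
    and f: "continuous_on UNIV f"
  shows "cont_conv (\<lambda>k x. \<Sum>i<m k. proximity (m k) z x i * f (z i)) f"
  unfolding cont_conv_def
proof (intro allI impI)
  fix x l assume x: "x \<longlonglongrightarrow> (l :: 's)"
  show "(\<lambda>k. \<Sum>i<m k. proximity (m k) z (x k) i * f (z i)) \<longlonglongrightarrow> f l"
  proof (rule tendstoI)
    fix e :: real assume e: "0 < e"
    then have "0 < e / 2" by simp
    then obtain d where d: "0 < d" "\<And>y. dist y l < d \<Longrightarrow> dist (f y) (f l) < e / 2"
      using f unfolding continuous_on_iff by (metis UNIV_I)
    \<comment> \<open>Of the four quarters of \<open>d\<close>, two go to the distance of
      \<open>x k\<close> from \<open>l\<close>, which enters twice, one to the distance of
      \<open>z i\<close> from \<open>l\<close>, and one to the tolerance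
      \<open>1 / m k\<close>.\<close>
    obtain i where i: "dist l (z i) < d / 4" using dense[of "d / 4" l] d(1) by auto
    obtain n :: nat where n: "4 / d < real n" using reals_Archimedean2 by blast
    have "\<forall>\<^sub>F k in sequentially. dist (x k) l < d / 4"
      using d(1) by (intro tendstoD[OF x]) simp
    moreover have "\<forall>\<^sub>F k in sequentially. max (Suc i) (Suc n) \<le> m k"
      using m unfolding filterlim_at_top by blast
    ultimately show "\<forall>\<^sub>F k in sequentially. dist (\<Sum>i<m k. proximity (m k) z (x k) i * f (z i)) (f l) < e"
    proof eventually_elim
      case (elim k)
      have mk: "0 < m k" "i < m k" "n < m k" using elim by auto
      have "4 / d < real (m k)" using n mk(3) by linarith
      then have inv: "1 / real (m k) < d / 4" using d(1) mk(1) by (simp add: field_simps)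
      have near: "\<bar>f (z j) - f l\<bar> < e / 2" if "proximity (m k) z (x k) j \<noteq> 0" for j
      proof -
        have "dist (x k) (z j) < dist (x k) (z i) + 1 / real (m k)"
          using soft_argmin_near_minimal that mk(2) unfolding proximity_def by blast
        moreover have "dist (x k) (z i) \<le> dist (x k) l + dist l (z i)" by (rule dist_triangle)
        moreover have "dist (z j) l \<le> dist (x k) (z j) + dist (x k) l"
          by (metis dist_commute dist_triangle)
        ultimately have "dist (z j) l < d" using elim(1) i inv by linarith
        then show ?thesis using d(2) by (simp add: dist_real_def)
      qed
      have one: "(\<Sum>j<m k. proximity (m k) z (x k) j) = 1"
        using mk(1) by (simp add: proximity_def sum_soft_argmin)
      have "(\<Sum>j<m k. proximity (m k) z (x k) j * f (z j)) - f l
          = (\<Sum>j<m k. proximity (m k) z (x k) j * (f (z j) - f l))"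
        using one by (simp add: right_diff_distrib sum_subtractf sum_distrib_right[symmetric])
      also have "\<bar>\<dots>\<bar> \<le> (\<Sum>j<m k. \<bar>proximity (m k) z (x k) j * (f (z j) - f l)\<bar>)"
        by (rule sum_abs)
      also have "\<dots> \<le> (\<Sum>j<m k. proximity (m k) z (x k) j * (e / 2))"
      proof (rule sum_mono)
        fix j
        show "\<bar>proximity (m k) z (x k) j * (f (z j) - f l)\<bar> \<le> proximity (m k) z (x k) j * (e / 2)"
          using near[of j] soft_argmin_nonneg[of "m k" "\<lambda>i. dist (x k) (z i)" j]
          by (cases "proximity (m k) z (x k) j = 0")
            (auto simp: abs_mult proximity_def intro!: mult_left_mono)
      qed
      also have "\<dots> = e / 2" by (simp only: sum_distrib_right[symmetric] one mult_1_left)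
      also have "\<dots> < e" using e by simp
      finally show ?case by (simp add: dist_real_def)
    qed
  qed
qed

text \<open>Integrating \<open>f\<close> against the discretization is integrating an average of
  \<open>f\<close> against \<open>M k\<close>, and these averages converge continuously to
  \<open>f\<close>.\<close>

lemma discretize_limit:
  fixes M :: "nat \<Rightarrow> 's::metric_space measure"
  assumes dense: "\<And>x e. 0 < e \<Longrightarrow> \<exists>i. dist x (z i) < e"
    and m: "filterlim m at_top sequentially" "\<And>k. 0 < m k"
    and M: "\<And>k. M k \<in> borel_probs" and lim: "limitin weak_topology M N sequentially"
  shows "limitin weak_topology (\<lambda>k. discretize (m k) z (M k)) N sequentially"
proof (rule limitin_weak_topologyI)
  show "discretize (m k) z (M k) \<in> borel_probs" for k using discretize_borel_probs[OF M m(2)] .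
  show "N \<in> borel_probs" using limitin_topspace[OF lim] by simp
  fix f :: "'s \<Rightarrow> real" and B assume f: "continuous_on UNIV f" "\<And>x. \<bar>f x\<bar> \<le> B"
  have fm: "f \<in> borel_measurable borel" using f(1) by (rule borel_measurable_continuous_onI)
  have "(\<lambda>k. \<integral>x. (\<Sum>i<m k. proximity (m k) z x i * f (z i)) \<partial>M k) \<longlonglongrightarrow> (\<integral>x. f x \<partial>N)"
  proof (rule cont_conv_integral_bounded[OF _ _ fm _ M lim])
    show "cont_conv (\<lambda>k x. \<Sum>i<m k. proximity (m k) z x i * f (z i)) f"
      using proximity_average_cont_conv[OF dense m(1) f(1)] .
    show "(\<lambda>x. \<Sum>i<m k. proximity (m k) z x i * f (z i)) \<in> borel_measurable borel" for k
      by (intro borel_measurable_continuous_onI continuous_intros proximity_continuous) auto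
    fix k x
    have "\<bar>\<Sum>i<m k. proximity (m k) z x i * f (z i)\<bar> \<le> (\<Sum>i<m k. \<bar>proximity (m k) z x i * f (z i)\<bar>)"
      by (rule sum_abs)
    also have "\<dots> \<le> (\<Sum>i<m k. proximity (m k) z x i * B)"
      by (intro sum_mono) (auto simp: abs_mult proximity_def soft_argmin_nonneg intro!: mult_left_mono f(2))
    also have "\<dots> = B"
      using m(2)[of k] by (simp add: sum_distrib_right[symmetric] proximity_def sum_soft_argmin)
    finally show "\<bar>\<Sum>i<m k. proximity (m k) z x i * f (z i)\<bar> \<le> B" .
  qed
  moreover have "(\<integral>x. (\<Sum>i<m k. proximity (m k) z x i * f (z i)) \<partial>M k) = (\<integral>x. f x \<partial>discretize (m k) z (M k))" for k
  proof -
    have "(\<integral>x. (\<Sum>i<m k. proximity (m k) z x i * f (z i)) \<partial>M k)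
        = (\<Sum>i<m k. \<integral>x. proximity (m k) z x i * f (z i) \<partial>M k)"
      using proximity_integrable[OF M] by (intro Bochner_Integration.integral_sum) auto
    then show ?thesis
      unfolding discretize_def by (simp add: integral_fin_meas[OF proximity_integral_nonneg fm])
  qed
  ultimately show "(\<lambda>k. \<integral>x. f x \<partial>discretize (m k) z (M k)) \<longlonglongrightarrow> (\<integral>x. f x \<partial>N)" by simp
qed

text \<open>
  Extends the identity of the standard simplex to the unit cube, so that Brouwer's theorem on the cube
  applies. Missing mass goes to the vertex 0.
\<close>

definition simplex_retract :: "nat \<Rightarrow> (nat \<Rightarrow> real) \<Rightarrow> nat \<Rightarrow> real" where
  "simplex_retract m r j = (r j + of_bool (j = 0) * max 0 (1 - (\<Sum>i<m. r i))) / max 1 (\<Sum>i<m. r i)"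

lemma simplex_retract_nonneg: "0 \<le> r j \<Longrightarrow> 0 \<le> simplex_retract m r j"
  unfolding simplex_retract_def by (intro divide_nonneg_nonneg add_nonneg_nonneg) auto

lemma sum_simplex_retract:
  assumes "0 < m" shows "(\<Sum>j<m. simplex_retract m r j) = 1"
proof -
  have "(\<Sum>j<m. r j + of_bool (j = 0) * max 0 (1 - (\<Sum>i<m. r i))) = max 1 (\<Sum>i<m. r i)"
    using assms by (simp add: sum.distrib sum_distrib_right[symmetric] of_bool_def sum.delta max_def)
  then show ?thesis by (simp add: simplex_retract_def sum_divide_distrib[symmetric] max_def)
qed

lemma simplex_retract_id: "(\<Sum>i<m. r i) = 1 \<Longrightarrow> simplex_retract m r = r"
  by (simp add: simplex_retract_def fun_eq_iff)

lemma tendsto_simplex_retract: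
  assumes "j < m" and q: "\<And>i. i < m \<Longrightarrow> ((\<lambda>k. q k i) \<longlongrightarrow> l i) F"
  shows "((\<lambda>k. simplex_retract m (q k) j) \<longlongrightarrow> simplex_retract m l j) F"
  unfolding simplex_retract_def using assms
  by (intro tendsto_intros tendsto_max q) (auto simp: max_def)

text \<open>The coordinates of the cube are the weights of all times, flattened by
  \<open>t * m + j\<close>. At a fixed point they are integrals of a partition of unity, so they
  already sum to 1 and the retraction leaves them alone.\<close>

theorem discretized_fixed_point:
  fixes \<Phi> :: "(nat \<Rightarrow> 's::metric_space measure) \<Rightarrow> nat \<Rightarrow> 's measure"
  assumes m: "0 < m"
    and into: "\<And>\<eta> t. (\<And>t. t \<le> T \<Longrightarrow> \<eta> t \<in> borel_probs) \<Longrightarrow> t \<le> T \<Longrightarrow> \<Phi> \<eta> t \<in> borel_probs"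
    and cont: "\<And>H \<eta> t. (\<And>k t. t \<le> T \<Longrightarrow> H k t \<in> borel_probs) \<Longrightarrow>
      (\<And>t. t \<le> T \<Longrightarrow> limitin weak_topology (\<lambda>k. H k t) (\<eta> t) sequentially) \<Longrightarrow> t \<le> T \<Longrightarrow>
      limitin weak_topology (\<lambda>k. \<Phi> (H k) t) (\<Phi> \<eta> t) sequentially"
  shows "\<exists>\<eta>. \<forall>t\<le>T. \<eta> t \<in> borel_probs \<and> \<eta> t = discretize m z (\<Phi> \<eta> t)"
proof -
  define n where "n = Suc T * m"
  have idx: "t * m + j < n" if "t \<le> T" "j < m" for t j
  proof -
    have "t * m + j < Suc t * m" using that(2) by simp
    also have "\<dots> \<le> n" unfolding n_def using that(1) by (intro mult_le_mono1) simp
    finally show ?thesis .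
  qed
  have unidx: "i div m \<le> T" "i mod m < m" if "i < n" for i
    using that m by (auto simp: n_def less_mult_imp_div_less less_Suc_eq_le[symmetric])
  define wt where "wt q t = simplex_retract m (\<lambda>j. q (t * m + j))" for q :: "nat \<Rightarrow> real" and t
  define dec where "dec q t = fin_meas m (wt q t) z" for q t
  define G where "G q i = (\<integral>x. proximity m z x (i mod m) \<partial>\<Phi> (dec q) (i div m))" for q i
  have wt_nonneg: "0 \<le> wt q t j" if "\<And>i. i < n \<Longrightarrow> q i \<in> {0..1}" "t \<le> T" "j < m" for q t j
    using that(1)[OF idx[OF that(2,3)]] unfolding wt_def by (intro simplex_retract_nonneg) simp
  have dec_prob: "dec q t \<in> borel_probs" if "\<And>i. i < n \<Longrightarrow> q i \<in> {0..1}" "t \<le> T" for q t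
    unfolding dec_def using wt_nonneg[OF that] sum_simplex_retract[OF m]
    by (intro fin_meas_borel_probs) (auto simp: wt_def)
  have "\<exists>q. \<forall>i<n. q i \<in> {0..1} \<and> G q i = q i"
  proof (rule brouwer_unit_cube)
    fix q i assume q: "\<And>j. j < n \<Longrightarrow> q j \<in> {0..1::real}" and i: "i < n"
    have P: "\<Phi> (dec q) (i div m) \<in> borel_probs" by (intro into dec_prob q unidx(1)[OF i])
    have "0 \<le> G q i" unfolding G_def by (rule proximity_integral_nonneg)
    moreover have "G q i \<le> (\<Sum>j<m. \<integral>x. proximity m z x j \<partial>\<Phi> (dec q) (i div m))"
      unfolding G_def using unidx(2)[OF i] by (intro member_le_sum proximity_integral_nonneg) auto
    ultimately show "G q i \<in> {0..1}" using sum_proximity_integral[OF P m] by simp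
  next
    fix Q q i assume Q: "\<And>k j. j < n \<Longrightarrow> Q k j \<in> {0..1::real}" and q: "\<And>j. j < n \<Longrightarrow> q j \<in> {0..1::real}"
      and lim: "\<And>j. j < n \<Longrightarrow> (\<lambda>k. Q k j) \<longlonglongrightarrow> q j" and i: "i < n"
    have "limitin weak_topology (\<lambda>k. dec (Q k) t) (dec q t) sequentially" if t: "t \<le> T" for t
    proof (rule limitin_weak_topologyI)
      show "dec (Q k) t \<in> borel_probs" for k using dec_prob[OF Q t] .
      show "dec q t \<in> borel_probs" using dec_prob[OF q t] .
      fix f :: "'s \<Rightarrow> real" assume "continuous_on UNIV f"
      then have fm: "f \<in> borel_measurable borel" by (rule borel_measurable_continuous_onI)
      have "(\<lambda>k. \<Sum>j<m. wt (Q k) t j * f (z j)) \<longlonglongrightarrow> (\<Sum>j<m. wt q t j * f (z j))"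
        unfolding wt_def by (intro tendsto_intros tendsto_simplex_retract lim idx[OF t]) auto
      then show "(\<lambda>k. \<integral>x. f x \<partial>dec (Q k) t) \<longlonglongrightarrow> (\<integral>x. f x \<partial>dec q t)"
        unfolding dec_def using wt_nonneg[OF Q t] wt_nonneg[OF q t] by (simp add: integral_fin_meas fm)
    qed
    then have "limitin weak_topology (\<lambda>k. \<Phi> (dec (Q k)) (i div m)) (\<Phi> (dec q) (i div m)) sequentially"
      using dec_prob[OF Q] unidx(1)[OF i] by (intro cont) auto
    from limitin_weak_topology_bounded[OF this proximity_continuous[OF unidx(2)[OF i]] proximity_bounds[OF unidx(2)[OF i]]]
    show "(\<lambda>k. G (Q k) i) \<longlonglongrightarrow> G q i" unfolding G_def .
  qed
  then obtain q where q: "\<And>i. i < n \<Longrightarrow> q i \<in> {0..1}" "\<And>i. i < n \<Longrightarrow> G q i = q i" by blast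
  have "dec q t = discretize m z (\<Phi> (dec q) t)" if t: "t \<le> T" for t
  proof -
    have P: "\<Phi> (dec q) t \<in> borel_probs" by (intro into dec_prob q(1) t)
    have eq: "q (t * m + j) = (\<integral>x. proximity m z x j \<partial>\<Phi> (dec q) t)" if "j < m" for j
      using q(2)[OF idx[OF t that]] that m by (simp add: G_def)
    then have "(\<Sum>j<m. q (t * m + j)) = 1" using sum_proximity_integral[OF P m] by simp
    then have "wt q t = (\<lambda>j. q (t * m + j))" unfolding wt_def by (rule simplex_retract_id)
    then have "point_measure {..<m} (\<lambda>i. ennreal (wt q t i))
        = point_measure {..<m} (\<lambda>i. ennreal (\<integral>x. proximity m z x i \<partial>\<Phi> (dec q) t))"
      unfolding point_measure_def using eq by (intro density_cong) (auto intro!: AE_I2)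
    then show ?thesis unfolding dec_def[of q t] discretize_def fin_meas_def by simp
  qed
  moreover have "dec q t \<in> borel_probs" if "t \<le> T" for t
    by (intro dec_prob q(1) that)
  ultimately show ?thesis by blast
qed

section \<open>Value functions\<close>

lemma integral_bind_borel_probs:
  fixes f :: "'t::topological_space \<Rightarrow> real"
  assumes M: "M \<in> borel_probs" and K: "K \<in> borel \<rightarrow>\<^sub>M prob_algebra borel"
    and f: "f \<in> borel_measurable borel" "\<And>x. \<bar>f x\<bar> \<le> B"
  shows "(\<integral>y. f y \<partial>(M \<bind> K)) = (\<integral>x. \<integral>y. f y \<partial>K x \<partial>M)"
proof (rule integral_bind[where K=borel and B=B and B'=1])
  interpret prob_space M using prob_space_borel_probs[OF M] .
  show "finite_measure M" by unfold_locales
  show "K \<in> M \<rightarrow>\<^sub>M subprob_algebra borel"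
    using measurable_prob_algebraD[OF K] sets_borel_probs[OF M] by (simp cong: measurable_cong_sets)
  show "AE x in M. emeasure (K x) (space (K x)) \<le> ennreal 1"
    using measurable_space[OF K] prob_space_borel_probs
    by (intro AE_I2) (simp add: prob_space.emeasure_space_1[OF prob_space_borel_probs])
qed (use f in auto)

lemma bind_borel_probs:
  "M \<in> borel_probs \<Longrightarrow> K \<in> borel \<rightarrow>\<^sub>M prob_algebra borel \<Longrightarrow> M \<bind> K \<in> borel_probs"
  using prob_space_bind'[of M borel K borel] sets_bind'[of M borel K borel] by (simp add: space_prob_algebra)

lemma kernel_integral_measurable:
  fixes f :: "'t::topological_space \<Rightarrow> real"
  assumes "K \<in> M \<rightarrow>\<^sub>M prob_algebra borel" "f \<in> borel_measurable borel"
  shows "(\<lambda>x. \<integral>y. f y \<partial>K x) \<in> borel_measurable M"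
  using measurable_compose[OF measurable_prob_algebraD[OF assms(1)] integral_measurable_subprob_algebra[OF assms(2)]] .

text \<open>The integral of a test function under \<open>M k \<bind> H k\<close> is the integral
  under \<open>M k\<close> of a bounded function of the starting point, and by \<open>conv\<close>
  these functions converge continuously.\<close>

lemma limitin_weak_topology_bind:
  fixes M :: "nat \<Rightarrow> 's::metric_space measure" and K :: "'s \<Rightarrow> 't::topological_space measure"
  assumes M: "\<And>k. M k \<in> borel_probs" and lim: "limitin weak_topology M N sequentially"
    and H: "\<And>k. H k \<in> borel \<rightarrow>\<^sub>M prob_algebra borel" and K: "K \<in> borel \<rightarrow>\<^sub>M prob_algebra borel"
    and conv: "\<And>(f :: 't \<Rightarrow> real) B. continuous_on UNIV f \<Longrightarrow> (\<And>y. \<bar>f y\<bar> \<le> B) \<Longrightarrow>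
      cont_conv (\<lambda>k x. \<integral>y. f y \<partial>H k x) (\<lambda>x. \<integral>y. f y \<partial>K x)"
  shows "limitin weak_topology (\<lambda>k. M k \<bind> H k) (N \<bind> K) sequentially"
proof (rule limitin_weak_topologyI)
  have N: "N \<in> borel_probs" using limitin_topspace[OF lim] by simp
  show "M k \<bind> H k \<in> borel_probs" for k using bind_borel_probs[OF M H] .
  show "N \<bind> K \<in> borel_probs" using bind_borel_probs[OF N K] .
  fix f :: "'t \<Rightarrow> real" and B assume f: "continuous_on UNIV f" "\<And>y. \<bar>f y\<bar> \<le> B"
  have fm: "f \<in> borel_measurable borel" using f(1) by (rule borel_measurable_continuous_onI)
  have bound: "\<bar>\<integral>y. f y \<partial>L x\<bar> \<le> B" if "L \<in> borel \<rightarrow>\<^sub>M prob_algebra borel" for L :: "'s \<Rightarrow> 't measure" and x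
  proof -
    have L: "L x \<in> borel_probs" using measurable_space[OF that] by simp
    interpret prob_space "L x" using prob_space_borel_probs[OF L] .
    have int: "integrable (L x) f" using borel_probs_integrable[OF L fm f(2)] .
    have "\<bar>\<integral>y. f y \<partial>L x\<bar> \<le> (\<integral>y. \<bar>f y\<bar> \<partial>L x)" by (rule integral_abs_bound)
    also have "\<dots> \<le> (\<integral>y. B \<partial>L x)" using int f(2) by (intro integral_mono) auto
    finally show ?thesis by (simp add: prob_space)
  qed
  have "(\<lambda>k. \<integral>x. \<integral>y. f y \<partial>H k x \<partial>M k) \<longlonglongrightarrow> (\<integral>x. \<integral>y. f y \<partial>K x \<partial>N)"
    by (rule cont_conv_integral_bounded[OF conv[OF f] kernel_integral_measurable[OF H fm]
          kernel_integral_measurable[OF K fm] bound[OF H] M lim])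
  then show "(\<lambda>k. \<integral>x. f x \<partial>(M k \<bind> H k)) \<longlonglongrightarrow> (\<integral>x. f x \<partial>(N \<bind> K))"
    by (simp add: integral_bind_borel_probs[OF M H fm f(2)] integral_bind_borel_probs[OF N K fm f(2)])
qed

section \<open>Minimization over a compact set of actions\<close>

definition action_min :: "('x \<times> 'a \<Rightarrow> real) \<Rightarrow> 'x \<Rightarrow> real" where
  "action_min g x = (INF a. g (x, a))"

lemma action_min_le: "(\<And>z. 0 \<le> g z) \<Longrightarrow> action_min g x \<le> g (x, a)"
  unfolding action_min_def by (intro cINF_lower bdd_belowI[of _ 0]) auto

lemma action_min_attained:
  fixes g :: "'x::topological_space \<times> 'a::topological_space \<Rightarrow> real"
  assumes A: "compact (UNIV :: 'a set)" and g: "continuous_on UNIV g" "\<And>z. 0 \<le> g z"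
  shows "\<exists>a. action_min g x = g (x, a)"
proof -
  have "continuous_on UNIV (\<lambda>a. g (x, a))"
    by (rule continuous_on_compose2[OF g(1)]) (auto intro!: continuous_intros)
  then obtain a where a: "\<And>b. g (x, a) \<le> g (x, b)"
    using continuous_attains_inf[OF A, of "\<lambda>a. g (x, a)"] by auto
  have "g (x, a) \<le> action_min g x" unfolding action_min_def by (intro cINF_greatest a) auto
  then show ?thesis using action_min_le[where g=g, OF g(2), of x a] by (intro exI[of _ a]) simp
qed

text \<open>A minimizer for the limit, kept fixed, bounds the minima from above. From below, if the
  minima were at most \<open>b\<close> infinitely often, compactness would make minimizers converge
  along a subsequence to an action whose limit value is at most \<open>b\<close>.\<close>

lemma cont_conv_action_min:
  fixes G :: "nat \<Rightarrow> 'x::metric_space \<times> 'a::metric_space \<Rightarrow> real"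
  assumes A: "compact (UNIV :: 'a set)" and conv: "cont_conv G g"
    and G: "\<And>k. continuous_on UNIV (G k)" "\<And>k z. 0 \<le> G k z"
    and g: "continuous_on UNIV g" "\<And>z. 0 \<le> g z"
  shows "cont_conv (\<lambda>k. action_min (G k)) (action_min g)"
  unfolding cont_conv_def
proof (intro allI impI order_tendstoI)
  fix x l b assume x: "x \<longlonglongrightarrow> (l :: 'x)" and b: "action_min g l < b"
  obtain a where a: "action_min g l = g (l, a)" using action_min_attained[OF A g] by blast
  have "(\<lambda>k. G k (x k, a)) \<longlonglongrightarrow> g (l, a)" by (intro cont_convD[OF conv] tendsto_intros x)
  then have "\<forall>\<^sub>F k in sequentially. G k (x k, a) < b" using b a by (intro order_tendstoD(2)) simp_all
  then show "\<forall>\<^sub>F k in sequentially. action_min (G k) (x k) < b"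
    by eventually_elim (rule le_less_trans[OF action_min_le[where g="G _", OF G(2)]])
next
  fix x l b assume x: "x \<longlonglongrightarrow> (l :: 'x)" and b: "b < action_min g l"
  show "\<forall>\<^sub>F k in sequentially. b < action_min (G k) (x k)"
  proof (rule ccontr)
    assume "\<not> ?thesis"
    then have "\<exists>\<^sub>F k in sequentially. action_min (G k) (x k) \<le> b"
      by (simp add: not_eventually not_less)
    then have "infinite {k. action_min (G k) (x k) \<le> b}"
      unfolding cofinite_eq_sequentially[symmetric] frequently_cofinite .
    from infinite_enumerate[OF this]
    obtain r :: "nat \<Rightarrow> nat" where r: "strict_mono r" "\<And>k. action_min (G (r k)) (x (r k)) \<le> b"
      unfolding mem_Collect_eq by blast
    have "\<forall>k. \<exists>a. action_min (G k) (x k) = G k (x k, a)"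
      using action_min_attained[OF A G] by blast
    then obtain a where a: "\<And>k. action_min (G k) (x k) = G k (x k, a k)" by metis
    obtain s a' where s: "strict_mono s" "((\<lambda>k. a (r k)) \<circ> s) \<longlonglongrightarrow> a'"
      using A unfolding compact_def by (metis UNIV_I)
    define u where "u = r \<circ> s"
    have u: "strict_mono u" unfolding u_def using r(1) s(1) by (rule strict_mono_o)
    have "(\<lambda>k. x (u k)) \<longlonglongrightarrow> l" using LIMSEQ_subseq_LIMSEQ[OF x u] by (simp add: o_def)
    moreover have "(\<lambda>k. a (u k)) \<longlonglongrightarrow> a'" using s(2) by (simp add: u_def o_def)
    ultimately have "(\<lambda>k. G (u k) (x (u k), a (u k))) \<longlonglongrightarrow> g (l, a')"
      by (intro cont_conv_subseq[OF conv u] tendsto_Pair)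
    moreover have "G (u k) (x (u k), a (u k)) \<le> b" for k
      using r(2)[of "s k"] a[of "u k"] by (simp add: u_def)
    ultimately have "g (l, a') \<le> b" by (intro tendsto_upperbound) auto
    then show False using b action_min_le[where g=g, OF g(2), of l a'] by linarith
  qed
qed

text \<open>The finite minimum is never below the full one. It is not above it in the limit either,
  since some fixed \<open>\<alpha> i\<close> is nearly optimal for the limit function and is among
  the candidates from some index on.\<close>

lemma cont_conv_finite_action_min:
  fixes G :: "nat \<Rightarrow> 'x::metric_space \<times> 'a::metric_space \<Rightarrow> real" and m :: "nat \<Rightarrow> nat"
  assumes A: "compact (UNIV :: 'a set)" and conv: "cont_conv G g"
    and G: "\<And>k. continuous_on UNIV (G k)" "\<And>k z. 0 \<le> G k z"
    and g: "continuous_on UNIV g" "\<And>z. 0 \<le> g z"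
    and dense: "\<And>a e. 0 < e \<Longrightarrow> \<exists>i. dist a (\<alpha> i) < e"
    and m: "filterlim m at_top sequentially" "\<And>k. 0 < m k"
  shows "cont_conv (\<lambda>k x. Min ((\<lambda>i. G k (x, \<alpha> i)) ` {..<m k})) (action_min g)"
  unfolding cont_conv_def
proof (intro allI impI order_tendstoI)
  fix x l b assume x: "x \<longlonglongrightarrow> (l :: 'x)" and b: "b < action_min g l"
  have "(\<lambda>k. action_min (G k) (x k)) \<longlonglongrightarrow> action_min g l"
    using cont_convD[OF cont_conv_action_min[OF A conv G g] x] .
  from order_tendstoD(1)[OF this b]
  show "\<forall>\<^sub>F k in sequentially. b < Min ((\<lambda>i. G k (x k, \<alpha> i)) ` {..<m k})"
  proof eventually_elim
    case (elim k)
    have "{..<m k} \<noteq> {}" using m(2)[of k] by auto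
    then show ?case using elim action_min_le[where g="G k", OF G(2), of "x k"] by (auto intro: less_le_trans)
  qed
next
  fix x l b assume x: "x \<longlonglongrightarrow> (l :: 'x)" and b: "action_min g l < b"
  obtain a where a: "action_min g l = g (l, a)" using action_min_attained[OF A g] by blast
  have "continuous_on UNIV (\<lambda>a. g (l, a))"
    by (rule continuous_on_compose2[OF g(1)]) (auto intro!: continuous_intros)
  moreover have "0 < b - g (l, a)" using a b by simp
  ultimately obtain d where d: "0 < d" "\<And>y. dist y a < d \<Longrightarrow> dist (g (l, y)) (g (l, a)) < b - g (l, a)"
    unfolding continuous_on_iff by (metis UNIV_I)
  obtain i where "dist a (\<alpha> i) < d" using dense[OF d(1)] by blast
  then have "dist (g (l, \<alpha> i)) (g (l, a)) < b - g (l, a)" by (intro d(2)) (simp add: dist_commute)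
  then have i: "g (l, \<alpha> i) < b" unfolding dist_real_def by linarith
  have "(\<lambda>k. G k (x k, \<alpha> i)) \<longlonglongrightarrow> g (l, \<alpha> i)" by (intro cont_convD[OF conv] tendsto_intros x)
  from order_tendstoD(2)[OF this i]
  have "\<forall>\<^sub>F k in sequentially. G k (x k, \<alpha> i) < b" .
  moreover have "\<forall>\<^sub>F k in sequentially. Suc i \<le> m k" using m(1) unfolding filterlim_at_top by blast
  ultimately show "\<forall>\<^sub>F k in sequentially. Min ((\<lambda>i. G k (x k, \<alpha> i)) ` {..<m k}) < b"
  proof eventually_elim
    case (elim k)
    have "Min ((\<lambda>i. G k (x k, \<alpha> i)) ` {..<m k}) \<le> G k (x k, \<alpha> i)" using elim(2) by (intro Min_le) auto
    with elim(1) show ?case by linarith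
  qed
qed

text \<open>The components change places: the pairs in a flow list the action law first, joint laws
  list the state first.\<close>

definition marginals :: "('x::topological_space \<times> 'a::topological_space) measure \<Rightarrow> 'a measure \<times> 'x measure" where
  "marginals \<nu> = (distr \<nu> borel snd, distr \<nu> borel fst)"

definition laws_conv :: "(nat \<Rightarrow> 'a::topological_space measure \<times> 'x::topological_space measure) \<Rightarrow>
    'a measure \<times> 'x measure \<Rightarrow> bool" where
  "laws_conv D d \<longleftrightarrow> (\<forall>k. D k \<in> borel_probs \<times> borel_probs) \<and>
     limitin weak_topology (\<lambda>k. fst (D k)) (fst d) sequentially \<and>
     limitin weak_topology (\<lambda>k. snd (D k)) (snd d) sequentially"

lemma laws_conv_limit: "laws_conv D d \<Longrightarrow> d \<in> borel_probs \<times> borel_probs"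
  unfolding laws_conv_def mem_Times_iff by (metis limitin_topspace topspace_weak_topology)

lemma laws_conv_const: "d \<in> borel_probs \<times> borel_probs \<Longrightarrow> laws_conv (\<lambda>_. d) d"
  unfolding laws_conv_def mem_Times_iff by (simp add: limitin_weak_topology_const)

lemma fst_snd_borel_measurable:
  "fst \<in> borel_measurable (borel :: ('x::topological_space \<times> 'a::topological_space) measure)"
  "snd \<in> borel_measurable (borel :: ('x \<times> 'a) measure)"
  by (intro borel_measurable_continuous_onI continuous_intros)+

lemma marginals_borel_probs: "\<nu> \<in> borel_probs \<Longrightarrow> marginals \<nu> \<in> borel_probs \<times> borel_probs"
  unfolding marginals_def by (intro SigmaI borel_probs_distr fst_snd_borel_measurable)

lemma laws_conv_marginals:
  assumes "\<And>k. M k \<in> borel_probs" "limitin weak_topology M N sequentially"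
  shows "laws_conv (\<lambda>k. marginals (M k)) (marginals N)"
  unfolding laws_conv_def
proof (intro conjI allI)
  show "marginals (M k) \<in> borel_probs \<times> borel_probs" for k
    by (rule marginals_borel_probs[OF assms(1)])
  have c: "continuous_on UNIV (fst :: 'a \<times> 'b \<Rightarrow> 'a)" "continuous_on UNIV (snd :: 'a \<times> 'b \<Rightarrow> 'b)"
    by (rule continuous_on_fst[OF continuous_on_id], rule continuous_on_snd[OF continuous_on_id])
  show "limitin weak_topology (\<lambda>k. fst (marginals (M k))) (fst (marginals N)) sequentially"
    unfolding marginals_def fst_conv by (rule limitin_weak_topology_distr[OF assms c(2)])
  show "limitin weak_topology (\<lambda>k. snd (marginals (M k))) (snd (marginals N)) sequentially"
    unfolding marginals_def snd_conv by (rule limitin_weak_topology_distr[OF assms c(1)])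
qed

text \<open>The hypotheses in the form in which they are used: \<open>w\<close> supplies compact
  sublevel sets and with them tightness, while \<open>v\<close> is the weight that bounds the costs
  and is propagated by the kernel. Continuity is stated along sequences, as continuous convergence
  asks for.\<close>

locale mean_field_game =
  fixes \<mu>0 :: "'x::polish_space measure"
    and \<rho> :: "('x, 'a::polish_space) kernel"
    and c :: "('x, 'a) running_cost"
    and \<phi> :: "('x, 'a) terminal_cost"
    and T :: nat
    and w v :: "'x \<Rightarrow> real"
    and \<alpha> R :: real
  assumes compact_actions: "compact (UNIV :: 'a set)"
    and \<mu>0: "\<mu>0 \<in> borel_probs"
    and kernel: "transition_kernel \<rho>"
    and w_cont: "continuous_on UNIV w" and w_compact: "\<And>r. compact {x. w x \<le> r}" and w_nonneg: "\<And>x. 0 \<le> w x"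
    and v_cont: "continuous_on UNIV v" and v_nonneg: "\<And>x. 0 \<le> v x"
    and v_integrable: "\<And>x a d. d \<in> borel_probs \<times> borel_probs \<Longrightarrow> integrable (\<rho> (x, a, d)) v"
    and v_drift: "\<And>x a d. d \<in> borel_probs \<times> borel_probs \<Longrightarrow> (\<integral>y. v y \<partial>\<rho> (x, a, d)) \<le> \<alpha> * v x"
    and c_bounds: "\<And>x a d. d \<in> borel_probs \<times> borel_probs \<Longrightarrow> 0 \<le> c (x, a, d) \<and> c (x, a, d) \<le> R * v x"
    and \<phi>_bounds: "\<And>x d. d \<in> borel_probs \<times> borel_probs \<Longrightarrow> 0 \<le> \<phi> (x, d) \<and> \<phi> (x, d) \<le> R * v x"
    and \<rho>_conv: "\<And>x x' a a' D d. x \<longlonglongrightarrow> x' \<Longrightarrow> a \<longlonglongrightarrow> a' \<Longrightarrow> laws_conv D d \<Longrightarrow>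
      limitin weak_topology (\<lambda>k. \<rho> (x k, a k, D k)) (\<rho> (x', a', d)) sequentially"
    and v_conv: "\<And>x x' a a' D d. x \<longlonglongrightarrow> x' \<Longrightarrow> a \<longlonglongrightarrow> a' \<Longrightarrow> laws_conv D d \<Longrightarrow>
      (\<lambda>k. \<integral>y. v y \<partial>\<rho> (x k, a k, D k)) \<longlonglongrightarrow> (\<integral>y. v y \<partial>\<rho> (x', a', d))"
    and c_conv: "\<And>x x' a a' D d. x \<longlonglongrightarrow> x' \<Longrightarrow> a \<longlonglongrightarrow> a' \<Longrightarrow> laws_conv D d \<Longrightarrow>
      (\<lambda>k. c (x k, a k, D k)) \<longlonglongrightarrow> c (x', a', d)"
    and \<phi>_conv: "\<And>x x' D d. x \<longlonglongrightarrow> x' \<Longrightarrow> laws_conv D d \<Longrightarrow>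
      (\<lambda>k. \<phi> (x k, D k)) \<longlonglongrightarrow> \<phi> (x', d)"
begin

section \<open>Transitions and action values for a given pair of laws\<close>

definition step_kernel :: "'a measure \<times> 'x measure \<Rightarrow> 'x \<times> 'a \<Rightarrow> 'x measure" where
  "step_kernel d z = \<rho> (fst z, snd z, d)"

lemma step_kernel_measurable:
  assumes "d \<in> borel_probs \<times> borel_probs"
  shows "step_kernel d \<in> borel \<rightarrow>\<^sub>M prob_algebra borel"
proof -
  have d: "fst d \<in> borel_probs" "snd d \<in> borel_probs" using assms by auto
  have "(\<lambda>z. (fst z, snd z, fst d, snd d)) \<in> (borel \<Otimes>\<^sub>M borel) \<rightarrow>\<^sub>M
      (borel \<Otimes>\<^sub>M borel \<Otimes>\<^sub>M prob_algebra borel \<Otimes>\<^sub>M prob_algebra borel :: ('x \<times> 'a \<times> _) measure)"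
    by (intro measurable_Pair measurable_fst measurable_snd measurable_const d)
  from measurable_compose[OF this kernel[unfolded transition_kernel_def]]
  have "(\<lambda>z. \<rho> (fst z, snd z, fst d, snd d)) \<in> (borel \<Otimes>\<^sub>M borel) \<rightarrow>\<^sub>M prob_algebra borel" .
  moreover have "step_kernel d = (\<lambda>z. \<rho> (fst z, snd z, fst d, snd d))"
    unfolding step_kernel_def prod.collapse ..
  ultimately show ?thesis by (simp only: borel_prod)
qed

lemma step_kernel_borel_probs: "d \<in> borel_probs \<times> borel_probs \<Longrightarrow> step_kernel d z \<in> borel_probs"
  using measurable_space[OF step_kernel_measurable] by simp

lemma step_kernel_cont_conv:
  fixes f :: "'x \<Rightarrow> real"
  assumes D: "laws_conv D d" and f: "continuous_on UNIV f" "\<And>y. \<bar>f y\<bar> \<le> B"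
  shows "cont_conv (\<lambda>k z. \<integral>y. f y \<partial>step_kernel (D k) z) (\<lambda>z. \<integral>y. f y \<partial>step_kernel d z)"
  unfolding cont_conv_def step_kernel_def
proof (intro allI impI)
  fix z l assume z: "z \<longlonglongrightarrow> (l :: 'x \<times> 'a)"
  show "(\<lambda>k. \<integral>y. f y \<partial>\<rho> (fst (z k), snd (z k), D k)) \<longlonglongrightarrow> (\<integral>y. f y \<partial>\<rho> (fst l, snd l, d))"
    by (rule limitin_weak_topology_bounded[OF \<rho>_conv[OF tendsto_fst[OF z] tendsto_snd[OF z] D] f])
qed

lemma bind_step_kernel_limit:
  assumes "\<And>k. M k \<in> borel_probs" "limitin weak_topology M N sequentially" "laws_conv D d"
  shows "limitin weak_topology (\<lambda>k. M k \<bind> step_kernel (D k)) (N \<bind> step_kernel d) sequentially"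
  using assms laws_conv_limit[OF assms(3)]
  by (intro limitin_weak_topology_bind step_kernel_measurable step_kernel_cont_conv) (auto simp: laws_conv_def)

definition action_value :: "'a measure \<times> 'x measure \<Rightarrow> ('x \<Rightarrow> real) \<Rightarrow> 'x \<times> 'a \<Rightarrow> real" where
  "action_value d f z = c (fst z, snd z, d) + (\<integral>y. f y \<partial>step_kernel d z)"

lemma action_value_bounds:
  assumes d: "d \<in> borel_probs \<times> borel_probs" and f: "f \<in> borel_measurable borel" "\<And>x. 0 \<le> f x \<and> f x \<le> C * v x"
  shows "integrable (step_kernel d z) f"
    and "0 \<le> action_value d f z \<and> action_value d f z \<le> (R + C * \<alpha>) * v (fst z)"
proof -
  have K: "step_kernel d z \<in> borel_probs" by (rule step_kernel_borel_probs[OF d])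
  have v: "integrable (step_kernel d z) v" unfolding step_kernel_def by (rule v_integrable[OF d])
  have fm: "f \<in> borel_measurable (step_kernel d z)" using f(1) sets_borel_probs[OF K] by (simp cong: measurable_cong_sets)
  show int: "integrable (step_kernel d z) f"
    by (rule Bochner_Integration.integrable_bound[where f="\<lambda>x. C * v x"]) (use v fm f(2) in \<open>auto simp: abs_of_nonneg intro: order_trans[OF conjunct2[OF f(2)] abs_ge_self]\<close>)
  have "0 \<le> (\<integral>y. f y \<partial>step_kernel d z)" using f(2) by simp
  moreover have "(\<integral>y. f y \<partial>step_kernel d z) \<le> C * \<alpha> * v (fst z)"
  proof (cases "0 \<le> C")
    case True
    have "(\<integral>y. f y \<partial>step_kernel d z) \<le> (\<integral>y. C * v y \<partial>step_kernel d z)"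
      using int v f(2) by (intro integral_mono) auto
    also have "\<dots> = C * (\<integral>y. v y \<partial>step_kernel d z)" by simp
    also have "\<dots> \<le> C * (\<alpha> * v (fst z))"
      unfolding step_kernel_def using True by (intro mult_left_mono v_drift[OF d])
    finally show ?thesis by simp
  next
    \<comment> \<open>No sign is imposed on \<open>R\<close>, so \<open>C\<close> may be negative;
      then \<open>0 \<le> f x \<and> f x \<le> C * v x\<close> forces both \<open>v\<close> and
      \<open>f\<close> to vanish.\<close>
    case False
    have v0: "v x = 0" for x
    proof (rule ccontr)
      assume "v x \<noteq> 0"
      then have "C * v x < 0" using False v_nonneg[of x] by (simp add: mult_less_0_iff)
      then show False using f(2)[of x] by linarith
    qed
    have "f x = 0" for x using f(2)[of x] v0[of x] by simp
    then show ?thesis using v0 by simp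
  qed
  ultimately show "0 \<le> action_value d f z \<and> action_value d f z \<le> (R + C * \<alpha>) * v (fst z)"
    using c_bounds[OF d, of "fst z" "snd z"] by (simp add: action_value_def distrib_right)
qed

text \<open>The functions \<open>F k\<close> are bounded only by a multiple of \<open>v\<close>, so
  weak convergence of the transitions is supplemented by \<open>v_conv\<close>, the convergence of
  the integrals of the bound.\<close>

lemma cont_conv_action_value:
  assumes D: "laws_conv D d" and F: "cont_conv F f"
    and meas: "\<And>k. F k \<in> borel_measurable borel" "f \<in> borel_measurable borel"
    and bounds: "\<And>k x. 0 \<le> F k x \<and> F k x \<le> C * v x"
  shows "cont_conv (\<lambda>k. action_value (D k) (F k)) (action_value d f)"
  unfolding cont_conv_def
proof (intro allI impI)
  fix z l assume z: "z \<longlonglongrightarrow> (l :: 'x \<times> 'a)"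
  have Dk: "D k \<in> borel_probs \<times> borel_probs" for k using D by (simp add: laws_conv_def)
  have d: "d \<in> borel_probs \<times> borel_probs" by (rule laws_conv_limit[OF D])
  note z' = tendsto_fst[OF z] tendsto_snd[OF z]
  have "(\<lambda>k. \<integral>y. F k y \<partial>step_kernel (D k) (z k)) \<longlonglongrightarrow> (\<integral>y. f y \<partial>step_kernel d l)"
  proof (rule cont_conv_integral_dominated[OF F meas, where B="\<lambda>y. C * v y"])
    show "\<bar>F k x\<bar> \<le> C * v x" for k x using bounds by (simp add: abs_of_nonneg)
    show "continuous_on UNIV (\<lambda>y. C * v y)" by (intro continuous_intros v_cont)
    show "step_kernel (D k) (z k) \<in> borel_probs" for k by (rule step_kernel_borel_probs[OF Dk])
    show "limitin weak_topology (\<lambda>k. step_kernel (D k) (z k)) (step_kernel d l) sequentially"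
      unfolding step_kernel_def by (rule \<rho>_conv[OF z' D])
    show "integrable (step_kernel (D k) (z k)) (\<lambda>y. C * v y)" for k
      unfolding step_kernel_def by (intro integrable_mult_right v_integrable[OF Dk])
    show "integrable (step_kernel d l) (\<lambda>y. C * v y)"
      unfolding step_kernel_def by (intro integrable_mult_right v_integrable[OF d])
    show "(\<lambda>k. \<integral>y. C * v y \<partial>step_kernel (D k) (z k)) \<longlonglongrightarrow> (\<integral>y. C * v y \<partial>step_kernel d l)"
      unfolding step_kernel_def using v_conv[OF z' D] by (auto intro!: tendsto_mult)
  qed
  then show "(\<lambda>k. action_value (D k) (F k) (z k)) \<longlonglongrightarrow> action_value d f l"
    unfolding action_value_def by (intro tendsto_add c_conv[OF z' D])
qed

text \<open>The index counts the stages that remain, which makes backward induction structural. Past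
  the horizon truncated subtraction repeats stage 0, so the regularity facts below hold for every
  \<open>n\<close>.\<close>

primrec value_to_go :: "('x, 'a) flow \<Rightarrow> nat \<Rightarrow> 'x \<Rightarrow> real" where
  "value_to_go \<delta> 0 = (\<lambda>x. \<phi> (x, \<delta> T))"
| "value_to_go \<delta> (Suc n) = action_min (action_value (\<delta> (T - Suc n)) (value_to_go \<delta> n))"

primrec growth :: "nat \<Rightarrow> real" where
  "growth 0 = R"
| "growth (Suc n) = R + growth n * \<alpha>"

definition flow_conv :: "(nat \<Rightarrow> ('x, 'a) flow) \<Rightarrow> ('x, 'a) flow \<Rightarrow> bool" where
  "flow_conv H \<delta> \<longleftrightarrow> (\<forall>t\<le>T. laws_conv (\<lambda>k. H k t) (\<delta> t))"

definition valid_flow :: "('x, 'a) flow \<Rightarrow> bool" where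
  "valid_flow \<delta> \<longleftrightarrow> (\<forall>t\<le>T. \<delta> t \<in> borel_probs \<times> borel_probs)"

lemma valid_flowD: "valid_flow \<delta> \<Longrightarrow> t \<le> T \<Longrightarrow> \<delta> t \<in> borel_probs \<times> borel_probs"
  unfolding valid_flow_def by blast

lemma flow_conv_const: "valid_flow \<delta> \<Longrightarrow> flow_conv (\<lambda>_. \<delta>) \<delta>"
  by (simp add: flow_conv_def laws_conv_const valid_flow_def)

lemma flow_conv_valid:
  assumes "flow_conv H \<delta>"
  shows "valid_flow (H k)" "valid_flow \<delta>"
  using assms laws_conv_limit[of "\<lambda>k. H k _" "\<delta> _"]
  unfolding flow_conv_def laws_conv_def valid_flow_def by blast+

text \<open>The induction hypothesis for the value recursion: convergence at one more stage needs
  measurability and the \<open>v\<close>-bound of the previous values, for the limit flow and for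
  every flow of the sequence. The latter are reached through constant sequences.\<close>

definition value_regular :: "nat \<Rightarrow> bool" where
  "value_regular n \<longleftrightarrow> (\<forall>H \<delta>. flow_conv H \<delta> \<longrightarrow>
    cont_conv (\<lambda>k. value_to_go (H k) n) (value_to_go \<delta> n) \<and>
    continuous_on UNIV (value_to_go \<delta> n) \<and> (\<forall>x. 0 \<le> value_to_go \<delta> n x \<and> value_to_go \<delta> n x \<le> growth n * v x))"

lemma action_value_regular:
  assumes reg: "value_regular n" and H: "flow_conv H \<delta>" and t: "t \<le> T"
  shows "cont_conv (\<lambda>k. action_value (H k t) (value_to_go (H k) n)) (action_value (\<delta> t) (value_to_go \<delta> n))"
    and "continuous_on UNIV (action_value (\<delta> t) (value_to_go \<delta> n))"
    and "0 \<le> action_value (\<delta> t) (value_to_go \<delta> n) z"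
    and "action_value (\<delta> t) (value_to_go \<delta> n) z \<le> growth (Suc n) * v (fst z)"
    and "integrable (step_kernel (\<delta> t) z) (value_to_go \<delta> n)"
proof -
  have conv: "cont_conv (\<lambda>k. action_value (H k t) (value_to_go (H k) n)) (action_value (\<delta> t) (value_to_go \<delta> n)) \<and>
      (\<forall>z. 0 \<le> action_value (\<delta> t) (value_to_go \<delta> n) z \<and>
        action_value (\<delta> t) (value_to_go \<delta> n) z \<le> growth (Suc n) * v (fst z) \<and>
        integrable (step_kernel (\<delta> t) z) (value_to_go \<delta> n))"
    if fc: "flow_conv H \<delta>" for H \<delta>
  proof -
    have *: "laws_conv (\<lambda>k. H k t) (\<delta> t)" using fc t by (simp add: flow_conv_def)
    have Hk: "flow_conv (\<lambda>_. H k) (H k)" for k by (rule flow_conv_const[OF flow_conv_valid(1)[OF fc]])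
    have reg_H: "continuous_on UNIV (value_to_go (H k) n)"
      "\<And>x. 0 \<le> value_to_go (H k) n x \<and> value_to_go (H k) n x \<le> growth n * v x" for k
      using reg Hk unfolding value_regular_def by blast+
    have reg_\<delta>: "cont_conv (\<lambda>k. value_to_go (H k) n) (value_to_go \<delta> n)" "continuous_on UNIV (value_to_go \<delta> n)"
      "\<And>x. 0 \<le> value_to_go \<delta> n x \<and> value_to_go \<delta> n x \<le> growth n * v x"
      using reg fc unfolding value_regular_def by blast+
    note meas = borel_measurable_continuous_onI[OF reg_H(1)] borel_measurable_continuous_onI[OF reg_\<delta>(2)]
    from cont_conv_action_value[OF * reg_\<delta>(1) meas reg_H(2)]
      action_value_bounds[OF valid_flowD[OF flow_conv_valid(2)[OF fc] t] meas(2) reg_\<delta>(3)]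
    show ?thesis by simp
  qed
  show "cont_conv (\<lambda>k. action_value (H k t) (value_to_go (H k) n)) (action_value (\<delta> t) (value_to_go \<delta> n))"
    "0 \<le> action_value (\<delta> t) (value_to_go \<delta> n) z"
    "action_value (\<delta> t) (value_to_go \<delta> n) z \<le> growth (Suc n) * v (fst z)"
    "integrable (step_kernel (\<delta> t) z) (value_to_go \<delta> n)"
    using conv[OF H] by blast+
  show "continuous_on UNIV (action_value (\<delta> t) (value_to_go \<delta> n))"
    using conv[OF flow_conv_const[OF flow_conv_valid(2)[OF H]]] by (intro continuous_on_cont_conv) blast
qed

lemma value_regular: "value_regular n"
proof (induction n)
  case 0
  show ?case unfolding value_regular_def
  proof (intro allI impI)
    fix H \<delta> assume fc: "flow_conv H \<delta>"
    then have *: "laws_conv (\<lambda>k. H k T) (\<delta> T)" by (simp add: flow_conv_def)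
    have d: "\<delta> T \<in> borel_probs \<times> borel_probs" by (rule laws_conv_limit[OF *])
    have "cont_conv (\<lambda>_. value_to_go \<delta> 0) (value_to_go \<delta> 0)"
      using \<phi>_conv[OF _ laws_conv_const[OF d]] by (simp add: cont_conv_def)
    moreover have "cont_conv (\<lambda>k. value_to_go (H k) 0) (value_to_go \<delta> 0)"
      using \<phi>_conv[OF _ *] by (simp add: cont_conv_def)
    ultimately show "cont_conv (\<lambda>k. value_to_go (H k) 0) (value_to_go \<delta> 0) \<and> continuous_on UNIV (value_to_go \<delta> 0) \<and>
        (\<forall>x. 0 \<le> value_to_go \<delta> 0 x \<and> value_to_go \<delta> 0 x \<le> growth 0 * v x)"
      using \<phi>_bounds[OF d] by (auto intro: continuous_on_cont_conv)
  qed
next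
  case (Suc n)
  show ?case unfolding value_regular_def
  proof (intro allI impI)
    fix H \<delta> assume fc: "flow_conv H \<delta>"
    define t where "t = T - Suc n"
    have t: "t \<le> T" by (simp add: t_def)
    have Hk: "flow_conv (\<lambda>_. H k) (H k)" for k by (rule flow_conv_const[OF flow_conv_valid(1)[OF fc]])
    define G where "G k = action_value (H k t) (value_to_go (H k) n)" for k
    define g where "g = action_value (\<delta> t) (value_to_go \<delta> n)"
    note G = action_value_regular(2,3)[OF Suc Hk t, folded G_def]
    note g = action_value_regular[OF Suc fc t, folded G_def g_def]
    have "cont_conv (\<lambda>k. action_min (G k)) (action_min g)"
      by (rule cont_conv_action_min[OF compact_actions g(1) G g(2,3)])
    moreover have "continuous_on UNIV (action_min g)"
      by (rule continuous_on_cont_conv[OF cont_conv_action_min[OF compact_actions cont_conv_const[OF g(2)] g(2,3) g(2,3)]])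
    moreover have "0 \<le> action_min g x \<and> action_min g x \<le> growth (Suc n) * v x" for x
    proof -
      obtain a where "action_min g x = g (x, a)"
        using action_min_attained[OF compact_actions g(2,3)] by blast
      then show ?thesis using g(3)[of "(x, a)"] g(4)[of "(x, a)"] by simp
    qed
    ultimately show "cont_conv (\<lambda>k. value_to_go (H k) (Suc n)) (value_to_go \<delta> (Suc n)) \<and>
        continuous_on UNIV (value_to_go \<delta> (Suc n)) \<and>
        (\<forall>x. 0 \<le> value_to_go \<delta> (Suc n) x \<and> value_to_go \<delta> (Suc n) x \<le> growth (Suc n) * v x)"
      unfolding value_to_go.simps t_def[symmetric] G_def[symmetric] g_def[symmetric] by blast
  qed
qed

lemma value_to_go_nonneg:
  "valid_flow \<delta> \<Longrightarrow> 0 \<le> value_to_go \<delta> n x"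
  using value_regular[of n] flow_conv_const unfolding value_regular_def by blast

lemma value_to_go_continuous:
  "valid_flow \<delta> \<Longrightarrow> continuous_on UNIV (value_to_go \<delta> n)"
  using value_regular[of n] flow_conv_const unfolding value_regular_def by blast

text \<open>At \<open>t = T\<close> the truncated subtraction makes \<open>Q \<delta> t\<close> a meaningless but harmless action value.\<close>

definition Q :: "('x, 'a) flow \<Rightarrow> nat \<Rightarrow> 'x \<times> 'a \<Rightarrow> real" where
  "Q \<delta> t = action_value (\<delta> t) (value_to_go \<delta> (T - Suc t))"

definition V :: "('x, 'a) flow \<Rightarrow> nat \<Rightarrow> 'x \<Rightarrow> real" where
  "V \<delta> t = value_to_go \<delta> (T - t)"

lemma V_eq: "t < T \<Longrightarrow> V \<delta> t = action_min (Q \<delta> t)"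
proof -
  assume t: "t < T"
  then have "T - t = Suc (T - Suc t)" "T - Suc (T - Suc t) = t" by auto
  then show ?thesis by (simp add: V_def Q_def)
qed

lemma Q_cont_conv:
  "flow_conv H \<delta> \<Longrightarrow> t \<le> T \<Longrightarrow> cont_conv (\<lambda>k. Q (H k) t) (Q \<delta> t)"
  unfolding Q_def by (rule action_value_regular(1)[OF value_regular])

lemma
  assumes \<delta>: "valid_flow \<delta>" and t: "t \<le> T"
  shows Q_continuous: "continuous_on UNIV (Q \<delta> t)"
    and Q_nonneg: "0 \<le> Q \<delta> t z"
    and value_integrable: "integrable (step_kernel (\<delta> t) z) (value_to_go \<delta> (T - Suc t))"
  unfolding Q_def using action_value_regular(2,3,5)[OF value_regular flow_conv_const[OF \<delta>] t] by simp_all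

section \<open>Approximate equilibria and their limit\<close>

definition flow_of :: "(nat \<Rightarrow> ('x \<times> 'a) measure) \<Rightarrow> ('x, 'a) flow" where
  "flow_of \<eta> t = marginals (\<eta> t)"

definition valid_laws :: "(nat \<Rightarrow> ('x \<times> 'a) measure) \<Rightarrow> bool" where
  "valid_laws \<eta> \<longleftrightarrow> (\<forall>t\<le>T. \<eta> t \<in> borel_probs)"

lemma valid_lawsD: "valid_laws \<eta> \<Longrightarrow> t \<le> T \<Longrightarrow> \<eta> t \<in> borel_probs"
  unfolding valid_laws_def by blast

lemma valid_flow_of: "valid_laws \<eta> \<Longrightarrow> valid_flow (flow_of \<eta>)"
  unfolding flow_of_def valid_laws_def valid_flow_def using marginals_borel_probs by blast

lemma flow_conv_flow_of:
  assumes "\<And>k. valid_laws (H k)"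
    and "\<And>t. t \<le> T \<Longrightarrow> limitin weak_topology (\<lambda>k. H k t) (\<eta> t) sequentially"
  shows "flow_conv (\<lambda>k. flow_of (H k)) (flow_of \<eta>)"
  unfolding flow_conv_def flow_of_def using assms by (intro allI impI laws_conv_marginals valid_lawsD)

text \<open>A kernel into state-action pairs, with the state repeated, so that binding a state law
  to it yields a joint law directly.\<close>

definition smoothed_policy :: "nat \<Rightarrow> (nat \<Rightarrow> 'a) \<Rightarrow> ('x, 'a) flow \<Rightarrow> nat \<Rightarrow> 'x \<Rightarrow> ('x \<times> 'a) measure" where
  "smoothed_policy m \<xi> \<delta> t x = fin_meas m (soft_argmin m (\<lambda>i. Q \<delta> t (x, \<xi> i))) (\<lambda>i. (x, \<xi> i))"

text \<open>
  The law at time \<open>Suc s\<close> is driven by \<open>\<eta> s\<close> and not by the response at time \<open>s\<close>: this avoids a recursion,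
  and at a fixed point the two differ only by a discretization that disappears in the limit.
\<close>

definition state_law :: "(nat \<Rightarrow> ('x \<times> 'a) measure) \<Rightarrow> nat \<Rightarrow> 'x measure" where
  "state_law \<eta> t = (case t of 0 \<Rightarrow> \<mu>0 | Suc s \<Rightarrow> \<eta> s \<bind> step_kernel (flow_of \<eta> s))"

definition smoothed_response ::
  "nat \<Rightarrow> (nat \<Rightarrow> 'a) \<Rightarrow> (nat \<Rightarrow> ('x \<times> 'a) measure) \<Rightarrow> nat \<Rightarrow> ('x \<times> 'a) measure" where
  "smoothed_response m \<xi> \<eta> t = state_law \<eta> t \<bind> smoothed_policy m \<xi> (flow_of \<eta>) t"

lemma Pair_continuous: "continuous_on UNIV f \<Longrightarrow> continuous_on UNIV (\<lambda>x. f (x, a))"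
  by (rule continuous_on_compose2[of UNIV f]) (auto intro!: continuous_intros)

lemma smoothed_weights_continuous:
  assumes \<delta>: "valid_flow \<delta>" and t: "t \<le> T" and i: "i < m"
  shows "continuous_on UNIV (\<lambda>x. soft_argmin m (\<lambda>i. Q \<delta> t (x, \<xi> i)) i)"
  by (rule continuous_soft_argmin[OF i Pair_continuous[OF Q_continuous[OF \<delta> t]]])

lemma smoothed_policy_kernel:
  assumes \<delta>: "valid_flow \<delta>" and t: "t \<le> T" and m: "0 < m"
  shows "smoothed_policy m \<xi> \<delta> t \<in> borel \<rightarrow>\<^sub>M prob_algebra borel"
proof -
  have "(\<lambda>x. smoothed_policy m \<xi> \<delta> t x) \<in> borel \<rightarrow>\<^sub>M prob_algebra borel"
    unfolding smoothed_policy_def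
  proof (rule fin_meas_kernel)
    show "(\<lambda>x. soft_argmin m (\<lambda>i. Q \<delta> t (x, \<xi> i)) i) \<in> borel_measurable borel" if "i < m" for i
      by (rule borel_measurable_continuous_onI[OF smoothed_weights_continuous[OF \<delta> t that]])
    show "(\<lambda>x. (x, \<xi> i)) \<in> borel_measurable borel" for i
      by (intro borel_measurable_continuous_onI continuous_intros)
  qed (simp_all add: soft_argmin_nonneg sum_soft_argmin[OF m])
  then show ?thesis .
qed

lemma integral_smoothed_policy:
  "f \<in> borel_measurable borel \<Longrightarrow> (\<integral>z. f z \<partial>smoothed_policy m \<xi> \<delta> t x) =
    (\<Sum>i<m. soft_argmin m (\<lambda>i. Q \<delta> t (x, \<xi> i)) i * (f (x, \<xi> i) :: real))"
  unfolding smoothed_policy_def by (rule integral_fin_meas[OF soft_argmin_nonneg])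

lemma state_law_borel_probs:
  assumes \<eta>: "valid_laws \<eta>" and t: "t \<le> T"
  shows "state_law \<eta> t \<in> borel_probs"
proof (cases t)
  case (Suc s)
  then have s: "s \<le> T" using t by simp
  show ?thesis unfolding state_law_def Suc nat.case
    by (rule bind_borel_probs[OF valid_lawsD[OF \<eta> s] step_kernel_measurable[OF valid_flowD[OF valid_flow_of[OF \<eta>] s]]])
qed (simp add: state_law_def \<mu>0)

lemma smoothed_response_borel_probs:
  assumes \<eta>: "valid_laws \<eta>" and t: "t \<le> T" and m: "0 < m"
  shows "smoothed_response m \<xi> \<eta> t \<in> borel_probs"
  unfolding smoothed_response_def
  by (rule bind_borel_probs[OF state_law_borel_probs[OF \<eta> t] smoothed_policy_kernel[OF valid_flow_of[OF \<eta>] t m]])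

lemma state_law_limit:
  assumes H: "\<And>k s. s < t \<Longrightarrow> H k s \<in> borel_probs"
    and lim: "\<And>s. s < t \<Longrightarrow> limitin weak_topology (\<lambda>k. H k s) (\<eta> s) sequentially"
  shows "limitin weak_topology (\<lambda>k. state_law (H k) t) (state_law \<eta> t) sequentially"
proof (cases t)
  case (Suc s)
  have "laws_conv (\<lambda>k. flow_of (H k) s) (flow_of \<eta> s)"
    unfolding flow_of_def by (intro laws_conv_marginals H lim) (simp_all add: Suc)
  then show ?thesis unfolding state_law_def Suc nat.case
    by (intro bind_step_kernel_limit H lim) (simp_all add: Suc)
qed (simp add: state_law_def \<mu>0 limitin_weak_topology_const)

text \<open>The flow seen by the policy varies along with the state law. Its action values converge
  continuously, and the softened weights follow them, where an exact minimizer could jump.\<close>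

lemma smoothed_response_limit:
  assumes m: "0 < m" and H: "\<And>k. valid_laws (H k)"
    and lim: "\<And>t. t \<le> T \<Longrightarrow> limitin weak_topology (\<lambda>k. H k t) (\<eta> t) sequentially" and t: "t \<le> T"
  shows "limitin weak_topology (\<lambda>k. smoothed_response m \<xi> (H k) t) (smoothed_response m \<xi> \<eta> t) sequentially"
proof -
  have \<eta>: "valid_laws \<eta>" unfolding valid_laws_def using limitin_topspace[OF lim] by simp
  show ?thesis
    unfolding smoothed_response_def
  proof (rule limitin_weak_topology_bind)
    show "state_law (H k) t \<in> borel_probs" for k by (rule state_law_borel_probs[OF H t])
    show "limitin weak_topology (\<lambda>k. state_law (H k) t) (state_law \<eta> t) sequentially"
      by (rule state_law_limit) (use valid_lawsD[OF H] lim t in auto)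
    show "smoothed_policy m \<xi> (flow_of (H k)) t \<in> borel \<rightarrow>\<^sub>M prob_algebra borel" for k
      by (rule smoothed_policy_kernel[OF valid_flow_of[OF H] t m])
    show "smoothed_policy m \<xi> (flow_of \<eta>) t \<in> borel \<rightarrow>\<^sub>M prob_algebra borel"
      by (rule smoothed_policy_kernel[OF valid_flow_of[OF \<eta>] t m])
    fix f :: "'x \<times> 'a \<Rightarrow> real" assume f: "continuous_on UNIV f"
    then have fm: "f \<in> borel_measurable borel" by (rule borel_measurable_continuous_onI)
    note conv = Q_cont_conv[OF flow_conv_flow_of[OF H lim] t]
    show "cont_conv (\<lambda>k x. \<integral>z. f z \<partial>smoothed_policy m \<xi> (flow_of (H k)) t x)
        (\<lambda>x. \<integral>z. f z \<partial>smoothed_policy m \<xi> (flow_of \<eta>) t x)"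
      unfolding integral_smoothed_policy[OF fm] cont_conv_def
    proof (intro allI impI tendsto_sum tendsto_mult)
      fix x l i assume x: "x \<longlonglongrightarrow> (l :: 'x)" and i: "i \<in> {..<m}"
      show "(\<lambda>k. soft_argmin m (\<lambda>i. Q (flow_of (H k)) t (x k, \<xi> i)) i) \<longlonglongrightarrow>
          soft_argmin m (\<lambda>i. Q (flow_of \<eta>) t (l, \<xi> i)) i"
        by (rule tendsto_soft_argmin) (use i in \<open>auto intro!: cont_convD[OF conv] tendsto_Pair x\<close>)
      have "(\<lambda>k. (x k, \<xi> i)) \<longlonglongrightarrow> (l, \<xi> i)" by (intro tendsto_Pair x tendsto_const)
      then show "(\<lambda>k. f (x k, \<xi> i)) \<longlonglongrightarrow> f (l, \<xi> i)"
        using continuous_on_tendsto_compose[OF f] by simp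
    qed
  qed
qed

lemma fst_smoothed_response:
  assumes \<eta>: "valid_laws \<eta>" and t: "t \<le> T" and m: "0 < m"
  shows "distr (smoothed_response m \<xi> \<eta> t) borel fst = state_law \<eta> t"
proof (rule borel_probs_eqI)
  note R = smoothed_response_borel_probs[OF \<eta> t m] and S = state_law_borel_probs[OF \<eta> t]
  show "distr (smoothed_response m \<xi> \<eta> t) borel fst \<in> borel_probs"
    by (rule borel_probs_distr[OF R fst_snd_borel_measurable(1)])
  show "state_law \<eta> t \<in> borel_probs" by (rule S)
  fix f :: "'x \<Rightarrow> real" and B assume f: "continuous_on UNIV f" "\<And>x. \<bar>f x\<bar> \<le> B"
  have fm: "f \<in> borel_measurable borel" using f(1) by (rule borel_measurable_continuous_onI)
  have ffm: "(\<lambda>z :: 'x \<times> 'a. f (fst z)) \<in> borel_measurable borel"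
    by (rule measurable_compose[OF fst_snd_borel_measurable(1) fm])
  have fstm: "fst \<in> smoothed_response m \<xi> \<eta> t \<rightarrow>\<^sub>M borel"
    using fst_snd_borel_measurable(1) sets_borel_probs[OF R] by (simp cong: measurable_cong_sets)
  have "(\<integral>x. f x \<partial>distr (smoothed_response m \<xi> \<eta> t) borel fst) = (\<integral>z. f (fst z) \<partial>smoothed_response m \<xi> \<eta> t)"
    by (rule integral_distr[OF fstm fm])
  also have "\<dots> = (\<integral>x. \<integral>z. f (fst z) \<partial>smoothed_policy m \<xi> (flow_of \<eta>) t x \<partial>state_law \<eta> t)"
    unfolding smoothed_response_def using f(2)
    by (intro integral_bind_borel_probs[OF S smoothed_policy_kernel[OF valid_flow_of[OF \<eta>] t m] ffm])
  also have "\<dots> = (\<integral>x. f x \<partial>state_law \<eta> t)"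
    by (simp add: integral_smoothed_policy[OF ffm] sum_distrib_right[symmetric] sum_soft_argmin[OF m])
  finally show "(\<integral>x. f x \<partial>distr (smoothed_response m \<xi> \<eta> t) borel fst) = (\<integral>x. f x \<partial>state_law \<eta> t)" .
qed

text \<open>The comparison is with the first \<open>m\<close> actions only, so an action outside
  this list may do better; the truncation at 0 keeps the function nonnegative, as Fatou's lemma
  requires.\<close>

definition regret :: "nat \<Rightarrow> (nat \<Rightarrow> 'a) \<Rightarrow> ('x, 'a) flow \<Rightarrow> nat \<Rightarrow> 'x \<times> 'a \<Rightarrow> real" where
  "regret m \<xi> \<delta> t z = max 0 (Q \<delta> t z - Min ((\<lambda>i. Q \<delta> t (fst z, \<xi> i)) ` {..<m}))"

lemma regret_measurable:
  assumes \<delta>: "valid_flow \<delta>" and t: "t \<le> T" and m: "0 < m"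
  shows "regret m \<xi> \<delta> t \<in> borel_measurable borel"
proof -
  have q: "continuous_on UNIV (\<lambda>z. Q \<delta> t (fst z, \<xi> i))" for i
    by (rule continuous_on_compose2[OF Q_continuous[OF \<delta> t]]) (auto intro!: continuous_intros)
  have "continuous_on UNIV (\<lambda>z. Min ((\<lambda>i. Q \<delta> t (fst z, \<xi> i)) ` {..<m}))"
    using q unfolding continuous_on_def by (auto intro!: tendsto_Min_image[OF m])
  then have "continuous_on UNIV (\<lambda>z. regret m \<xi> \<delta> t z)"
    unfolding regret_def by (intro continuous_intros Q_continuous[OF \<delta> t])
  then show ?thesis by (rule borel_measurable_continuous_onI)
qed

text \<open>The weights vanish at actions worse than the finite minimum by \<open>1 / m\<close> or
  more, so the integrand is at most \<open>1 / m\<close> wherever the response has mass.\<close>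

lemma smoothed_response_regret:
  assumes \<eta>: "valid_laws \<eta>" and t: "t \<le> T" and m: "0 < m"
  shows "(\<integral>\<^sup>+z. ennreal (regret m \<xi> (flow_of \<eta>) t z) \<partial>smoothed_response m \<xi> \<eta> t) \<le> ennreal (1 / real m)"
proof -
  note S = state_law_borel_probs[OF \<eta> t]
  interpret prob_space "state_law \<eta> t" using prob_space_borel_probs[OF S] .
  let ?r = "regret m \<xi> (flow_of \<eta>) t" and ?p = "\<lambda>x. soft_argmin m (\<lambda>i. Q (flow_of \<eta>) t (x, \<xi> i))"
  have rm: "(\<lambda>z. ennreal (?r z)) \<in> borel_measurable borel"
    using regret_measurable[OF valid_flow_of[OF \<eta>] t m] by simp
  have K: "smoothed_policy m \<xi> (flow_of \<eta>) t \<in> state_law \<eta> t \<rightarrow>\<^sub>M subprob_algebra borel"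
    using measurable_prob_algebraD[OF smoothed_policy_kernel[OF valid_flow_of[OF \<eta>] t m]] sets_borel_probs[OF S]
    by (simp cong: measurable_cong_sets)
  have point: "?r (x, \<xi> i) \<le> 1 / real m" if p: "?p x i \<noteq> 0" for x i
  proof -
    have "Min ((\<lambda>i. Q (flow_of \<eta>) t (x, \<xi> i)) ` {..<m}) \<in> (\<lambda>i. Q (flow_of \<eta>) t (x, \<xi> i)) ` {..<m}"
      using m by (intro Min_in) auto
    then obtain j where "j < m" "Min ((\<lambda>i. Q (flow_of \<eta>) t (x, \<xi> i)) ` {..<m}) = Q (flow_of \<eta>) t (x, \<xi> j)"
      by auto
    then show ?thesis using soft_argmin_near_minimal[OF p, of j] by (simp add: regret_def)
  qed
  have "(\<integral>\<^sup>+z. ennreal (?r z) \<partial>smoothed_response m \<xi> \<eta> t)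
      = (\<integral>\<^sup>+x. \<integral>\<^sup>+z. ennreal (?r z) \<partial>smoothed_policy m \<xi> (flow_of \<eta>) t x \<partial>state_law \<eta> t)"
    unfolding smoothed_response_def by (rule nn_integral_bind[OF rm K])
  also have "\<dots> \<le> (\<integral>\<^sup>+x. ennreal (1 / real m) \<partial>state_law \<eta> t)"
  proof (rule nn_integral_mono)
    fix x
    have "(\<integral>\<^sup>+z. ennreal (?r z) \<partial>smoothed_policy m \<xi> (flow_of \<eta>) t x)
        = (\<Sum>i<m. ennreal (?r (x, \<xi> i)) * ennreal (?p x i))"
      unfolding smoothed_policy_def by (rule nn_integral_fin_meas[OF rm])
    also have "\<dots> \<le> (\<Sum>i<m. ennreal (1 / real m) * ennreal (?p x i))"
    proof (rule sum_mono)
      fix i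
      show "ennreal (?r (x, \<xi> i)) * ennreal (?p x i) \<le> ennreal (1 / real m) * ennreal (?p x i)"
        using point[of x i] by (cases "?p x i = 0") (auto intro!: mult_right_mono ennreal_leI)
    qed
    also have "\<dots> = ennreal (1 / real m) * ennreal (\<Sum>i<m. ?p x i)"
      by (simp add: sum_distrib_left[symmetric] sum_ennreal soft_argmin_nonneg)
    finally show "(\<integral>\<^sup>+z. ennreal (?r z) \<partial>smoothed_policy m \<xi> (flow_of \<eta>) t x) \<le> ennreal (1 / real m)"
      by (simp add: sum_soft_argmin[OF m])
  qed
  also have "\<dots> = ennreal (1 / real m)" by (simp add: emeasure_space_1)
  finally show ?thesis .
qed

text \<open>Two families run in parallel: the responses \<open>\<theta> k\<close> have the state
  marginals prescribed by \<open>\<eta> k\<close> and small regret, while their discretizations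
  \<open>\<eta> k\<close> determine the flow and the next states. Convergence of the responses
  forces the same limit on the discretizations, and this closes the consistency equation.\<close>

theorem equilibrium_occupation_measures:
  "\<exists>\<nu>. valid_laws \<nu> \<and> (\<forall>t\<le>T. distr (\<nu> t) borel fst = state_law \<nu> t) \<and>
    (\<forall>t<T. AE z in \<nu> t. Q (flow_of \<nu>) t z = V (flow_of \<nu>) t (fst z))"
proof -
  obtain \<xi> :: "nat \<Rightarrow> 'a" where \<xi>: "\<And>a e. 0 < e \<Longrightarrow> \<exists>i. dist a (\<xi> i) < e"
    using dense_sequence_exists by blast
  obtain \<zeta> :: "nat \<Rightarrow> 'x \<times> 'a" where \<zeta>: "\<And>z e. 0 < e \<Longrightarrow> \<exists>i. dist z (\<zeta> i) < e"
    using dense_sequence_exists by blast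
  have "\<exists>\<eta>. \<forall>t\<le>T. \<eta> t \<in> borel_probs \<and> \<eta> t = discretize (Suc k) \<zeta> (smoothed_response (Suc k) \<xi> \<eta> t)" for k
  proof (rule discretized_fixed_point[OF zero_less_Suc])
    fix \<eta> :: "nat \<Rightarrow> ('x \<times> 'a) measure" and t assume "\<And>t. t \<le> T \<Longrightarrow> \<eta> t \<in> borel_probs" "t \<le> T"
    then show "smoothed_response (Suc k) \<xi> \<eta> t \<in> borel_probs"
      by (intro smoothed_response_borel_probs zero_less_Suc) (auto simp: valid_laws_def)
  next
    fix H :: "nat \<Rightarrow> nat \<Rightarrow> ('x \<times> 'a) measure" and \<eta> t assume "\<And>k t. t \<le> T \<Longrightarrow> H k t \<in> borel_probs"
      "\<And>t. t \<le> T \<Longrightarrow> limitin weak_topology (\<lambda>k. H k t) (\<eta> t) sequentially" "t \<le> T"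
    then show "limitin weak_topology (\<lambda>n. smoothed_response (Suc k) \<xi> (H n) t) (smoothed_response (Suc k) \<xi> \<eta> t) sequentially"
      by (intro smoothed_response_limit zero_less_Suc) (auto simp: valid_laws_def)
  qed
  then have "\<exists>\<eta>. valid_laws \<eta> \<and> (\<forall>t\<le>T. \<eta> t = discretize (Suc k) \<zeta> (smoothed_response (Suc k) \<xi> \<eta> t))" for k
    unfolding valid_laws_def by meson
  then obtain \<eta> where \<eta>: "\<And>k. valid_laws (\<eta> k)"
    and fixed: "\<And>k t. t \<le> T \<Longrightarrow> \<eta> k t = discretize (Suc k) \<zeta> (smoothed_response (Suc k) \<xi> (\<eta> k) t)"
    by metis
  define \<theta> where "\<theta> k = smoothed_response (Suc k) \<xi> (\<eta> k)" for k
  have \<theta>: "\<theta> k t \<in> borel_probs" if "t \<le> T" for k t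
    unfolding \<theta>_def by (rule smoothed_response_borel_probs[OF \<eta> that zero_less_Suc])
  have Suc_lim: "filterlim (\<lambda>k. Suc (r k)) at_top sequentially" if "strict_mono r" for r
    using filterlim_compose[OF filterlim_Suc filterlim_subseq[OF that]] .
  have \<eta>_lim: "limitin weak_topology (\<lambda>k. \<eta> (r k) t) N sequentially"
    if r: "strict_mono r" and t: "t \<le> T" and lim: "limitin weak_topology (\<lambda>k. \<theta> (r k) t) N sequentially" for r t N
  proof -
    have "limitin weak_topology (\<lambda>k. discretize (Suc (r k)) \<zeta> (\<theta> (r k) t)) N sequentially"
      by (rule discretize_limit[OF \<zeta> Suc_lim[OF r] zero_less_Suc \<theta>[OF t] lim])
    moreover have "discretize (Suc (r k)) \<zeta> (\<theta> (r k) t) = \<eta> (r k) t" for k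
      unfolding \<theta>_def using fixed[OF t] by simp
    ultimately show ?thesis by simp
  qed
  define P where "P t r \<longleftrightarrow> (\<exists>N. limitin weak_topology (\<lambda>k. \<theta> (r k) t) N sequentially)" for t and r :: "nat \<Rightarrow> nat"
  have "\<exists>r. strict_mono r \<and> (\<forall>t<Suc T. P t r)"
  proof (rule finite_diagonal_subsequence)
    fix t and r :: "nat \<Rightarrow> nat" assume "t < Suc T" and r: "strict_mono r" and prev: "\<And>s. s < t \<Longrightarrow> P s r"
    then have t: "t \<le> T" by simp
    obtain N where N: "\<And>s. s < t \<Longrightarrow> limitin weak_topology (\<lambda>k. \<theta> (r k) s) (N s) sequentially"
      using prev unfolding P_def by metis
    have "limitin weak_topology (\<lambda>k. state_law (\<eta> (r k)) t) (state_law N t) sequentially"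
      by (rule state_law_limit) (use valid_lawsD[OF \<eta>] \<eta>_lim[OF r] N t in auto)
    moreover have "distr (\<theta> (r k) t) borel fst = state_law (\<eta> (r k)) t" for k
      unfolding \<theta>_def by (rule fst_smoothed_response[OF \<eta> t zero_less_Suc])
    ultimately have "limitin weak_topology (\<lambda>k. distr (\<theta> (r k) t) borel fst) (state_law N t) sequentially"
      by simp
    from fst_marginal_convergent_subsequence[OF w_cont w_compact w_nonneg compact_actions \<theta>[OF t] this]
    show "\<exists>s. strict_mono s \<and> P t (r \<circ> s)" unfolding P_def o_def by blast
  next
    fix t and r s :: "nat \<Rightarrow> nat" assume "P t r" "strict_mono s"
    then show "P t (r \<circ> s)" unfolding P_def using limitin_subseq by (fastforce simp: o_def)
  qed
  then obtain r where r: "strict_mono r" and "\<And>t. t \<le> T \<Longrightarrow> P t r" by (auto simp: less_Suc_eq_le)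
  then obtain \<nu> where \<nu>: "\<And>t. t \<le> T \<Longrightarrow> limitin weak_topology (\<lambda>k. \<theta> (r k) t) (\<nu> t) sequentially"
    unfolding P_def by metis
  have \<nu>_prob: "valid_laws \<nu>" unfolding valid_laws_def using limitin_topspace[OF \<nu>] by simp
  note \<eta>_\<nu> = \<eta>_lim[OF r _ \<nu>]
  have marg: "distr (\<nu> t) borel fst = state_law \<nu> t" if t: "t \<le> T" for t
  proof (rule limitin_weak_topology_unique)
    have "continuous_on UNIV (fst :: 'x \<times> 'a \<Rightarrow> 'x)" by (rule continuous_on_fst[OF continuous_on_id])
    from limitin_weak_topology_distr[OF \<theta>[OF t] \<nu>[OF t] this]
    show "limitin weak_topology (\<lambda>k. distr (\<theta> (r k) t) borel fst) (distr (\<nu> t) borel fst) sequentially" .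
    have "limitin weak_topology (\<lambda>k. state_law (\<eta> (r k)) t) (state_law \<nu> t) sequentially"
      by (rule state_law_limit) (use valid_lawsD[OF \<eta>] \<eta>_\<nu> t in auto)
    moreover have "distr (\<theta> (r k) t) borel fst = state_law (\<eta> (r k)) t" for k
      unfolding \<theta>_def by (rule fst_smoothed_response[OF \<eta> t zero_less_Suc])
    ultimately show "limitin weak_topology (\<lambda>k. distr (\<theta> (r k) t) borel fst) (state_law \<nu> t) sequentially"
      by simp
  qed
  have opt: "AE z in \<nu> t. Q (flow_of \<nu>) t z = V (flow_of \<nu>) t (fst z)" if t: "t < T" for t
  proof -
    have t': "t \<le> T" using t by simp
    let ?q = "Q (flow_of \<nu>) t"
    have q: "continuous_on UNIV ?q" "\<And>z. 0 \<le> ?q z"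
      by (rule Q_continuous[OF valid_flow_of[OF \<nu>_prob] t'] Q_nonneg[OF valid_flow_of[OF \<nu>_prob] t'])+
    define F where "F k = regret (Suc (r k)) \<xi> (flow_of (\<eta> (r k))) t" for k
    \<comment> \<open>In the limit the comparison is with all actions, by density of
      \<open>\<xi>\<close>, so \<open>f z = 0\<close> expresses exact optimality.\<close>
    define f where "f z = max 0 (?q z - action_min ?q (fst z))" for z
    have conv: "cont_conv (\<lambda>k. Q (flow_of (\<eta> (r k))) t) ?q"
      by (rule Q_cont_conv[OF flow_conv_flow_of t']) (use \<eta> \<eta>_\<nu> in auto)
    have min_conv: "cont_conv (\<lambda>k x. Min ((\<lambda>i. Q (flow_of (\<eta> (r k))) t (x, \<xi> i)) ` {..<Suc (r k)})) (action_min ?q)"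
      by (rule cont_conv_finite_action_min[OF compact_actions conv _ _ _ _ \<xi> Suc_lim[OF r] zero_less_Suc])
        (rule Q_continuous[OF valid_flow_of[OF \<eta>] t'] Q_nonneg[OF valid_flow_of[OF \<eta>] t'] q)+
    have "cont_conv F f"
      unfolding cont_conv_def F_def f_def regret_def
      by (intro allI impI tendsto_max tendsto_diff tendsto_const cont_convD[OF conv] cont_convD[OF min_conv] tendsto_fst)
    moreover have "0 \<le> F k z" for k z by (simp add: F_def regret_def)
    ultimately have "(\<integral>\<^sup>+z. ennreal (f z) \<partial>\<nu> t) \<le> liminf (\<lambda>k. \<integral>\<^sup>+z. ennreal (F k z) \<partial>\<theta> (r k) t)"
      by (rule weak_fatou[OF _ _ \<theta>[OF t'] \<nu>[OF t']])
    also have "\<dots> \<le> liminf (\<lambda>k. ennreal (1 / real (Suc (r k))))"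
      unfolding F_def \<theta>_def
      by (intro Liminf_mono always_eventually allI smoothed_response_regret[OF \<eta> t' zero_less_Suc])
    also have "\<dots> = 0"
    proof -
      have "(\<lambda>k. 1 / real (Suc (r k))) \<longlonglongrightarrow> 0"
        using LIMSEQ_subseq_LIMSEQ[OF LIMSEQ_inverse_real_of_nat r] by (simp add: o_def inverse_eq_divide)
      from tendsto_ennrealI[OF this] have "(\<lambda>k. ennreal (1 / real (Suc (r k)))) \<longlonglongrightarrow> 0" by simp
      then show ?thesis by (rule lim_imp_Liminf[rotated]) simp
    qed
    finally have "(\<integral>\<^sup>+z. ennreal (f z) \<partial>\<nu> t) = 0" by simp
    moreover have "f \<in> borel_measurable (\<nu> t)"
    proof -
      have "continuous_on UNIV (action_min ?q)"
        by (rule continuous_on_cont_conv[OF cont_conv_action_min[OF compact_actions cont_conv_const[OF q(1)] q q]])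
      then have "continuous_on UNIV (\<lambda>z :: 'x \<times> 'a. action_min ?q (fst z))"
        by (rule continuous_on_compose2) (auto intro!: continuous_intros)
      then have "continuous_on UNIV f" unfolding f_def by (intro continuous_intros q(1))
      then show ?thesis
        using borel_measurable_continuous_onI sets_borel_probs[OF valid_lawsD[OF \<nu>_prob t']] by (simp cong: measurable_cong_sets)
    qed
    ultimately have "AE z in \<nu> t. ennreal (f z) = 0" by (simp add: nn_integral_0_iff_AE)
    then show ?thesis
    proof eventually_elim
      case (elim z)
      then have "?q z \<le> action_min ?q (fst z)" by (simp add: f_def ennreal_eq_0_iff max_def split: if_splits)
      moreover have "action_min ?q (fst z) \<le> ?q (fst z, snd z)"
        by (rule action_min_le[where g="?q", OF q(2)])
      ultimately show ?case by (simp add: V_eq[OF t])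
    qed
  qed
  show ?thesis using \<nu>_prob marg opt by blast
qed

end

section \<open>Path laws and optimality\<close>

lemma nn_integral_bind_kernel:
  assumes "sets M = sets L" "K \<in> L \<rightarrow>\<^sub>M prob_algebra B" "f \<in> borel_measurable B"
  shows "(\<integral>\<^sup>+y. f y \<partial>(M \<bind> K)) = (\<integral>\<^sup>+x. \<integral>\<^sup>+y. f y \<partial>K x \<partial>M)"
  using measurable_prob_algebraD[OF assms(2)] assms(1)
  by (intro nn_integral_bind[OF assms(3)]) (simp cong: measurable_cong_sets)

lemma nn_integral_kernel_measurable:
  "K \<in> L \<rightarrow>\<^sub>M prob_algebra B \<Longrightarrow> f \<in> borel_measurable B \<Longrightarrow> (\<lambda>x. \<integral>\<^sup>+y. f y \<partial>K x) \<in> borel_measurable L"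
  using measurable_compose[OF measurable_prob_algebraD nn_integral_measurable_subprob_algebra] .

lemma nn_integral_graph_kernel:
  assumes K: "K \<in> borel \<rightarrow>\<^sub>M prob_algebra borel"
    and f: "f \<in> borel_measurable (borel \<Otimes>\<^sub>M borel)" and M: "sets M = sets borel"
  shows "(\<integral>\<^sup>+z. f z \<partial>(M \<bind> (\<lambda>x. K x \<bind> (\<lambda>a. return (borel \<Otimes>\<^sub>M borel) (x, a))))) = (\<integral>\<^sup>+x. \<integral>\<^sup>+a. f (x, a) \<partial>K x \<partial>M)"
proof -
  have "(\<lambda>x. K x \<bind> (\<lambda>a. return (borel \<Otimes>\<^sub>M borel) (x, a))) \<in> borel \<rightarrow>\<^sub>M prob_algebra (borel \<Otimes>\<^sub>M borel)"
    by (intro measurable_bind_prob_space2[OF K]) measurable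
  from nn_integral_bind_kernel[OF M this f]
  have "(\<integral>\<^sup>+z. f z \<partial>(M \<bind> (\<lambda>x. K x \<bind> (\<lambda>a. return (borel \<Otimes>\<^sub>M borel) (x, a)))))
      = (\<integral>\<^sup>+x. \<integral>\<^sup>+z. f z \<partial>(K x \<bind> (\<lambda>a. return (borel \<Otimes>\<^sub>M borel) (x, a))) \<partial>M)" .
  also have "\<dots> = (\<integral>\<^sup>+x. \<integral>\<^sup>+a. f (x, a) \<partial>K x \<partial>M)"
  proof (rule nn_integral_cong)
    fix x
    have Kx: "sets (K x) = sets borel" using measurable_space[OF K, of x] by (simp add: space_prob_algebra)
    have "(\<lambda>a. return (borel \<Otimes>\<^sub>M borel) (x, a)) \<in> borel \<rightarrow>\<^sub>M prob_algebra (borel \<Otimes>\<^sub>M borel)" by measurable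
    from nn_integral_bind_kernel[OF Kx this f]
    show "(\<integral>\<^sup>+z. f z \<partial>(K x \<bind> (\<lambda>a. return (borel \<Otimes>\<^sub>M borel) (x, a)))) = (\<integral>\<^sup>+a. f (x, a) \<partial>K x)"
      using f by (simp add: nn_integral_return space_pair_measure)
  qed
  finally show ?thesis .
qed

context mean_field_game begin

abbreviation path_space :: "nat \<Rightarrow> ((nat \<Rightarrow> 'x) \<times> (nat \<Rightarrow> 'a)) measure" where
  "path_space \<equiv> path_algebra"

lemma policies_measurable:
  "\<pi> \<in> policies T \<Longrightarrow> t \<le> T \<Longrightarrow> \<pi> t \<in> PiM {..t} (\<lambda>_. borel) \<rightarrow>\<^sub>M prob_algebra borel"
  by (simp add: policies_def)

lemma path_coordinates_measurable:
  "s \<le> t \<Longrightarrow> (\<lambda>p. fst p s) \<in> path_space t \<rightarrow>\<^sub>M borel"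
  "s \<le> t \<Longrightarrow> (\<lambda>p. snd p s) \<in> path_space t \<rightarrow>\<^sub>M borel"
  by (auto intro!: measurable_compose[OF measurable_fst] measurable_compose[OF measurable_snd]
      measurable_component_singleton)

lemma path_state_action_measurable:
  "s \<le> t \<Longrightarrow> (\<lambda>p. (fst p s, snd p s)) \<in> path_space t \<rightarrow>\<^sub>M borel"
  unfolding borel_prod[symmetric] by (intro measurable_Pair path_coordinates_measurable)

lemma path_extend_measurable:
  "(\<lambda>((p, x), a). ((fst p)(Suc t := x), (snd p)(Suc t := a)))
    \<in> (path_space t \<Otimes>\<^sub>M borel) \<Otimes>\<^sub>M borel \<rightarrow>\<^sub>M path_space (Suc t)"
  unfolding atMost_Suc split_beta' by measurable

lemma state_extend_measurable:
  "(\<lambda>(p, x). (fst p)(Suc t := x)) \<in> path_space t \<Otimes>\<^sub>M borel \<rightarrow>\<^sub>M PiM {..Suc t} (\<lambda>_. borel)"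
  unfolding atMost_Suc split_beta' by measurable

lemma transition_measurable:
  assumes \<delta>: "valid_flow \<delta>" and t: "t \<le> T"
  shows "(\<lambda>p. \<rho> (fst p t, snd p t, \<delta> t)) \<in> path_space t \<rightarrow>\<^sub>M prob_algebra borel"
  using measurable_compose[OF path_state_action_measurable[OF order_refl] step_kernel_measurable[OF valid_flowD[OF \<delta> t]]]
  by (simp add: step_kernel_def)

text \<open>Isolates the choice of the action once the next state is known, so that one step of the
  path law is a composition of two kernels.\<close>

definition action_step :: "('x, 'a) policy \<Rightarrow> nat \<Rightarrow> ((nat \<Rightarrow> 'x) \<times> (nat \<Rightarrow> 'a)) \<times> 'x \<Rightarrow> ((nat \<Rightarrow> 'x) \<times> (nat \<Rightarrow> 'a)) measure" where
  "action_step \<pi> t = (\<lambda>(p, x). \<pi> (Suc t) ((fst p)(Suc t := x)) \<bind>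
     (\<lambda>a. return (path_space (Suc t)) ((fst p)(Suc t := x), (snd p)(Suc t := a))))"

lemma path_law_Suc:
  "path_law \<mu>0 \<rho> \<delta> \<pi> (Suc t) =
     path_law \<mu>0 \<rho> \<delta> \<pi> t \<bind> (\<lambda>p. \<rho> (fst p t, snd p t, \<delta> t) \<bind> (\<lambda>x. action_step \<pi> t (p, x)))"
  by (simp add: action_step_def split_beta')

lemma action_step_measurable:
  assumes \<pi>: "\<pi> \<in> policies T" and t: "t < T"
  shows "action_step \<pi> t \<in> path_space t \<Otimes>\<^sub>M borel \<rightarrow>\<^sub>M prob_algebra (path_space (Suc t))"
proof -
  have "Suc t \<le> T" using t by simp
  from measurable_compose[OF state_extend_measurable policies_measurable[OF \<pi> this]]
  have "(\<lambda>z. \<pi> (Suc t) ((fst (fst z))(Suc t := snd z))) \<in> path_space t \<Otimes>\<^sub>M borel \<rightarrow>\<^sub>M prob_algebra borel"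
    by (simp add: split_beta')
  then show ?thesis
    unfolding action_step_def split_beta'
  proof (rule measurable_bind_prob_space2)
    show "(\<lambda>(z, a). return (path_space (Suc t)) ((fst (fst z))(Suc t := snd z), (snd (fst z))(Suc t := a)))
      \<in> (path_space t \<Otimes>\<^sub>M borel) \<Otimes>\<^sub>M borel \<rightarrow>\<^sub>M prob_algebra (path_space (Suc t))"
      using measurable_compose[OF path_extend_measurable measurable_return_prob_space] by (simp add: split_beta')
  qed
qed

lemma transition_step_measurable:
  assumes \<delta>: "valid_flow \<delta>" and \<pi>: "\<pi> \<in> policies T" and t: "t < T"
  shows "(\<lambda>p. \<rho> (fst p t, snd p t, \<delta> t) \<bind> (\<lambda>x. action_step \<pi> t (p, x)))
    \<in> path_space t \<rightarrow>\<^sub>M prob_algebra (path_space (Suc t))"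
  using action_step_measurable[OF \<pi> t]
  by (intro measurable_bind_prob_space2[OF transition_measurable[OF \<delta> less_imp_le[OF t]]]) simp

lemma nn_integral_action_step:
  assumes \<pi>: "\<pi> \<in> policies T" and t: "t < T" and p: "p \<in> space (path_space t)"
    and f: "f \<in> borel_measurable (path_space (Suc t))"
  shows "(\<integral>\<^sup>+q. f q \<partial>action_step \<pi> t (p, x)) =
    (\<integral>\<^sup>+a. f ((fst p)(Suc t := x), (snd p)(Suc t := a)) \<partial>\<pi> (Suc t) ((fst p)(Suc t := x)))"
proof -
  have st: "Suc t \<le> T" using t by simp
  have px: "(p, x) \<in> space (path_space t \<Otimes>\<^sub>M borel)" using p by (simp add: space_pair_measure)
  have "(fst p)(Suc t := x) \<in> space (PiM {..Suc t} (\<lambda>_. borel))"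
    using measurable_space[OF state_extend_measurable px] by simp
  from measurable_space[OF policies_measurable[OF \<pi> st] this]
  have sets: "sets (\<pi> (Suc t) ((fst p)(Suc t := x))) = sets borel" by (rule sets_borel_probs)
  have ext: "(\<lambda>a. ((fst p)(Suc t := x), (snd p)(Suc t := a))) \<in> borel \<rightarrow>\<^sub>M path_space (Suc t)"
    using measurable_compose[OF measurable_Pair1'[OF px] path_extend_measurable] by simp
  show ?thesis
    unfolding action_step_def prod.case
    using nn_integral_bind_kernel[OF sets measurable_compose[OF ext measurable_return_prob_space] f]
      measurable_space[OF ext] by (simp add: nn_integral_return f)
qed

lemma nn_integral_path_law_Suc:
  assumes \<delta>: "valid_flow \<delta>" and \<pi>: "\<pi> \<in> policies T" and t: "t < T"
    and L: "sets (path_law \<mu>0 \<rho> \<delta> \<pi> t) = sets (path_space t)"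
    and f: "f \<in> borel_measurable (path_space (Suc t))"
  shows "(\<integral>\<^sup>+q. f q \<partial>path_law \<mu>0 \<rho> \<delta> \<pi> (Suc t)) =
    (\<integral>\<^sup>+p. \<integral>\<^sup>+x. \<integral>\<^sup>+a. f ((fst p)(Suc t := x), (snd p)(Suc t := a)) \<partial>\<pi> (Suc t) ((fst p)(Suc t := x))
      \<partial>\<rho> (fst p t, snd p t, \<delta> t) \<partial>path_law \<mu>0 \<rho> \<delta> \<pi> t)"
  unfolding path_law_Suc nn_integral_bind_kernel[OF L transition_step_measurable[OF \<delta> \<pi> t] f]
proof (rule nn_integral_cong)
  fix p assume "p \<in> space (path_law \<mu>0 \<rho> \<delta> \<pi> t)"
  then have p: "p \<in> space (path_space t)" using sets_eq_imp_space_eq[OF L] by simp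
  have sets: "sets (\<rho> (fst p t, snd p t, \<delta> t)) = sets borel"
    using measurable_space[OF transition_measurable[OF \<delta> less_imp_le[OF t]] p] by (rule sets_borel_probs)
  have "(\<lambda>x. action_step \<pi> t (p, x)) \<in> borel \<rightarrow>\<^sub>M prob_algebra (path_space (Suc t))"
    using measurable_compose[OF measurable_Pair1'[OF p] action_step_measurable[OF \<pi> t]] .
  from nn_integral_bind_kernel[OF sets this f]
  show "(\<integral>\<^sup>+q. f q \<partial>(\<rho> (fst p t, snd p t, \<delta> t) \<bind> (\<lambda>x. action_step \<pi> t (p, x)))) =
      (\<integral>\<^sup>+x. \<integral>\<^sup>+a. f ((fst p)(Suc t := x), (snd p)(Suc t := a)) \<partial>\<pi> (Suc t) ((fst p)(Suc t := x))
      \<partial>\<rho> (fst p t, snd p t, \<delta> t))"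
    unfolding nn_integral_action_step[OF \<pi> t p f] .
qed

lemma initial_path_measurable: "(\<lambda>x. \<lambda>i\<in>{..0::nat}. x) \<in> borel \<rightarrow>\<^sub>M PiM {..0} (\<lambda>_. borel)"
  by measurable

lemma initial_action_measurable:
  assumes \<pi>: "\<pi> \<in> policies T"
  shows "(\<lambda>x. \<pi> 0 (\<lambda>i\<in>{..0}. x)) \<in> borel \<rightarrow>\<^sub>M prob_algebra borel"
  by (rule measurable_compose[OF initial_path_measurable policies_measurable[OF \<pi>]]) simp

lemma initial_step_measurable:
  assumes \<pi>: "\<pi> \<in> policies T"
  shows "(\<lambda>x. \<pi> 0 (\<lambda>i\<in>{..0}. x) \<bind> (\<lambda>a. return (path_space 0) (\<lambda>i\<in>{..0}. x, \<lambda>i\<in>{..0}. a)))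
    \<in> borel \<rightarrow>\<^sub>M prob_algebra (path_space 0)"
proof (rule measurable_bind_prob_space2[OF initial_action_measurable[OF \<pi>]])
  have "(\<lambda>z. (\<lambda>i\<in>{..0}. fst z, \<lambda>i\<in>{..0}. snd z)) \<in> borel \<Otimes>\<^sub>M borel \<rightarrow>\<^sub>M path_space 0"
    by (intro measurable_Pair measurable_compose[OF measurable_fst initial_path_measurable]
        measurable_compose[OF measurable_snd initial_path_measurable])
  from measurable_compose[OF this measurable_return_prob_space]
  show "(\<lambda>(x, a). return (path_space 0) (\<lambda>i\<in>{..0}. x, \<lambda>i\<in>{..0}. a)) \<in> borel \<Otimes>\<^sub>M borel \<rightarrow>\<^sub>M prob_algebra (path_space 0)"
    by (simp add: split_beta')
qed

lemma nn_integral_path_law_0: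
  assumes \<pi>: "\<pi> \<in> policies T" and f: "f \<in> borel_measurable (path_space 0)"
  shows "(\<integral>\<^sup>+q. f q \<partial>path_law \<mu>0 \<rho> \<delta> \<pi> 0) =
    (\<integral>\<^sup>+x. \<integral>\<^sup>+a. f (\<lambda>i\<in>{..0}. x, \<lambda>i\<in>{..0}. a) \<partial>\<pi> 0 (\<lambda>i\<in>{..0}. x) \<partial>\<mu>0)"
  unfolding path_law.simps nn_integral_bind_kernel[OF sets_borel_probs[OF \<mu>0] initial_step_measurable[OF \<pi>] f]
proof (rule nn_integral_cong)
  fix x
  have sets: "sets (\<pi> 0 (\<lambda>i\<in>{..0}. x)) = sets borel"
    using measurable_space[OF initial_action_measurable[OF \<pi>]] by (intro sets_borel_probs) simp
  have ext: "(\<lambda>a. (\<lambda>i\<in>{..0}. x, \<lambda>i\<in>{..0}. a)) \<in> borel \<rightarrow>\<^sub>M path_space 0"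
    using measurable_space[OF initial_path_measurable, of x]
    by (intro measurable_Pair initial_path_measurable measurable_const) simp
  show "(\<integral>\<^sup>+q. f q \<partial>(\<pi> 0 (\<lambda>i\<in>{..0}. x) \<bind> (\<lambda>a. return (path_space 0) (\<lambda>i\<in>{..0}. x, \<lambda>i\<in>{..0}. a)))) =
      (\<integral>\<^sup>+a. f (\<lambda>i\<in>{..0}. x, \<lambda>i\<in>{..0}. a) \<partial>\<pi> 0 (\<lambda>i\<in>{..0}. x))"
    unfolding nn_integral_bind_kernel[OF sets measurable_compose[OF ext measurable_return_prob_space] f]
    by (intro nn_integral_cong nn_integral_return[OF measurable_space[OF ext] f]) simp
qed

lemma path_law_space:
  assumes \<delta>: "valid_flow \<delta>" and \<pi>: "\<pi> \<in> policies T"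
  shows "t \<le> T \<Longrightarrow> path_law \<mu>0 \<rho> \<delta> \<pi> t \<in> space (prob_algebra (path_space t))"
proof (induction t)
  case 0
  show ?case
    using prob_space_bind'[OF \<mu>0 initial_step_measurable[OF \<pi>]] sets_bind'[OF \<mu>0 initial_step_measurable[OF \<pi>]]
    by (simp add: space_prob_algebra)
next
  case (Suc t)
  then have t: "t < T" and L: "path_law \<mu>0 \<rho> \<delta> \<pi> t \<in> space (prob_algebra (path_space t))" by auto
  show ?case unfolding path_law_Suc
    using prob_space_bind'[OF L transition_step_measurable[OF \<delta> \<pi> t]]
      sets_bind'[OF L transition_step_measurable[OF \<delta> \<pi> t]]
    by (simp add: space_prob_algebra)
qed

lemma sets_path_law:
  "valid_flow \<delta> \<Longrightarrow> \<pi> \<in> policies T \<Longrightarrow> t \<le> T \<Longrightarrow> sets (path_law \<mu>0 \<rho> \<delta> \<pi> t) = sets (path_space t)"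
  using path_law_space by (simp add: space_prob_algebra)

section \<open>Verification by dynamic programming\<close>

definition accumulated_cost :: "('x, 'a) flow \<Rightarrow> nat \<Rightarrow> (nat \<Rightarrow> 'x) \<times> (nat \<Rightarrow> 'a) \<Rightarrow> real" where
  "accumulated_cost \<delta> t p = (\<Sum>s<t. c (fst p s, snd p s, \<delta> s))"

lemma accumulated_cost_measurable:
  assumes \<delta>: "valid_flow \<delta>" and t: "t \<le> T" and u: "t \<le> Suc u"
  shows "accumulated_cost \<delta> t \<in> borel_measurable (path_space u)"
proof -
  have "(\<lambda>p. c (fst p s, snd p s, \<delta> s)) \<in> borel_measurable (path_space u)" if "s < t" for s
  proof -
    have d: "\<delta> s \<in> borel_probs \<times> borel_probs" using valid_flowD[OF \<delta>] that t by simp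
    have "cont_conv (\<lambda>_ z. c (fst z, snd z, \<delta> s)) (\<lambda>z. c (fst z, snd z, \<delta> s))"
      unfolding cont_conv_def using c_conv[OF tendsto_fst tendsto_snd laws_conv_const[OF d]] by blast
    then have "(\<lambda>z. c (fst z, snd z, \<delta> s)) \<in> borel_measurable borel"
      by (intro borel_measurable_continuous_onI continuous_on_cont_conv)
    from measurable_compose[OF path_state_action_measurable this, of s u] that u show ?thesis by simp
  qed
  then show ?thesis unfolding accumulated_cost_def by (intro borel_measurable_sum) auto
qed

lemma accumulated_cost_nonneg: "valid_flow \<delta> \<Longrightarrow> t \<le> T \<Longrightarrow> 0 \<le> accumulated_cost \<delta> t p"
  unfolding accumulated_cost_def using c_bounds valid_flowD by (intro sum_nonneg) auto

text \<open>Costs before \<open>t\<close> plus the optimal cost from then on. As \<open>t\<close>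
  grows it runs from the integral of \<open>V \<delta> 0\<close> under \<open>\<mu>0\<close>, the
  same for all policies, to the cost of \<open>\<pi>\<close>. It never decreases, and it stays
  constant if \<open>\<pi>\<close> almost surely picks minimizers; optimality among
  history-dependent policies rests on this.\<close>

definition cost_so_far :: "('x, 'a) flow \<Rightarrow> ('x, 'a) policy \<Rightarrow> nat \<Rightarrow> ennreal" where
  "cost_so_far \<delta> \<pi> t = (\<integral>\<^sup>+p. ennreal (accumulated_cost \<delta> t p + V \<delta> t (fst p t)) \<partial>path_law \<mu>0 \<rho> \<delta> \<pi> t)"

lemma cost_so_far_measurable:
  assumes \<delta>: "valid_flow \<delta>" and t: "t \<le> T"
  shows "(\<lambda>p. ennreal (accumulated_cost \<delta> t p + V \<delta> t (fst p t))) \<in> borel_measurable (path_space t)"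
proof -
  have "V \<delta> t \<in> borel_measurable borel"
    unfolding V_def by (intro borel_measurable_continuous_onI value_to_go_continuous[OF \<delta>])
  from measurable_compose[OF path_coordinates_measurable(1)[OF order_refl] this]
  show ?thesis using accumulated_cost_measurable[OF \<delta> t, of t] by simp
qed

lemma cost_so_far_0:
  assumes \<delta>: "valid_flow \<delta>" and \<pi>: "\<pi> \<in> policies T"
  shows "cost_so_far \<delta> \<pi> 0 = (\<integral>\<^sup>+x. ennreal (V \<delta> 0 x) \<partial>\<mu>0)"
proof -
  have "emeasure (\<pi> 0 (\<lambda>i\<in>{..0}. x)) (space (\<pi> 0 (\<lambda>i\<in>{..0}. x))) = 1" for x
    using prob_space.emeasure_space_1[OF prob_space_borel_probs]
      measurable_space[OF initial_action_measurable[OF \<pi>], of x] by simp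
  then show ?thesis
    unfolding cost_so_far_def nn_integral_path_law_0[OF \<pi> cost_so_far_measurable[OF \<delta> le0]]
    by (simp add: accumulated_cost_def)
qed

text \<open>The integrand at \<open>Suc t\<close> does not involve the newest action, which
  integrates out to 1. The newest state turns \<open>V\<close> into the expectation inside
  \<open>Q\<close>, and the running cost at \<open>t\<close> moves from the accumulated part into
  \<open>Q\<close>.\<close>

lemma cost_so_far_Suc:
  assumes \<delta>: "valid_flow \<delta>" and \<pi>: "\<pi> \<in> policies T" and t: "t < T"
  shows "cost_so_far \<delta> \<pi> (Suc t) =
    (\<integral>\<^sup>+p. ennreal (accumulated_cost \<delta> t p + Q \<delta> t (fst p t, snd p t)) \<partial>path_law \<mu>0 \<rho> \<delta> \<pi> t)"
proof -
  have st: "Suc t \<le> T" and t': "t \<le> T" using t by auto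
  note L = sets_path_law[OF \<delta> \<pi> t']
  show ?thesis
    unfolding cost_so_far_def nn_integral_path_law_Suc[OF \<delta> \<pi> t L cost_so_far_measurable[OF \<delta> st]]
  proof (rule nn_integral_cong)
    fix p assume "p \<in> space (path_law \<mu>0 \<rho> \<delta> \<pi> t)"
    then have p: "p \<in> space (path_space t)" using sets_eq_imp_space_eq[OF L] by simp
    let ?z = "(fst p t, snd p t)"
    have K: "step_kernel (\<delta> t) ?z \<in> borel_probs" by (rule step_kernel_borel_probs[OF valid_flowD[OF \<delta> t']])
    interpret K: prob_space "step_kernel (\<delta> t) ?z" using prob_space_borel_probs[OF K] .
    have V: "V \<delta> (Suc t) = value_to_go \<delta> (T - Suc t)" by (simp add: V_def)
    have int: "integrable (step_kernel (\<delta> t) ?z) (V \<delta> (Suc t))"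
      unfolding V by (rule value_integrable[OF \<delta> t'])
    have V_nonneg: "0 \<le> V \<delta> (Suc t) x" for x unfolding V by (rule value_to_go_nonneg[OF \<delta>])
    have acc: "accumulated_cost \<delta> (Suc t) ((fst p)(Suc t := x), (snd p)(Suc t := a)) = accumulated_cost \<delta> (Suc t) p" for x a
      unfolding accumulated_cost_def by (intro sum.cong) auto
    have one: "emeasure (\<pi> (Suc t) ((fst p)(Suc t := x))) (space (\<pi> (Suc t) ((fst p)(Suc t := x)))) = 1" for x
    proof -
      have "(p, x) \<in> space (path_space t \<Otimes>\<^sub>M borel)" using p by (simp add: space_pair_measure)
      from measurable_space[OF state_extend_measurable this]
      have "(fst p)(Suc t := x) \<in> space (PiM {..Suc t} (\<lambda>_. borel))" by simp
      from measurable_space[OF policies_measurable[OF \<pi> st] this]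
      show ?thesis by (rule prob_space.emeasure_space_1[OF prob_space_borel_probs])
    qed
    let ?C = "accumulated_cost \<delta> (Suc t) p"
    have "(\<integral>\<^sup>+x. \<integral>\<^sup>+a. ennreal (accumulated_cost \<delta> (Suc t) ((fst p)(Suc t := x), (snd p)(Suc t := a)) +
        V \<delta> (Suc t) (fst ((fst p)(Suc t := x), (snd p)(Suc t := a)) (Suc t))) \<partial>\<pi> (Suc t) ((fst p)(Suc t := x))
        \<partial>\<rho> (fst p t, snd p t, \<delta> t)) = (\<integral>\<^sup>+x. ennreal (?C + V \<delta> (Suc t) x) \<partial>step_kernel (\<delta> t) ?z)"
      unfolding acc by (simp add: one step_kernel_def)
    also have "\<dots> = ennreal (\<integral>x. ?C + V \<delta> (Suc t) x \<partial>step_kernel (\<delta> t) ?z)"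
      using int accumulated_cost_nonneg[OF \<delta> st] V_nonneg by (intro nn_integral_eq_integral) auto
    also have "(\<integral>x. ?C + V \<delta> (Suc t) x \<partial>step_kernel (\<delta> t) ?z) = ?C + (\<integral>x. V \<delta> (Suc t) x \<partial>step_kernel (\<delta> t) ?z)"
      using int by (simp add: K.prob_space)
    also have "\<dots> = accumulated_cost \<delta> t p + Q \<delta> t ?z"
      by (simp add: accumulated_cost_def Q_def action_value_def V)
    finally show "(\<integral>\<^sup>+x. \<integral>\<^sup>+a. ennreal (accumulated_cost \<delta> (Suc t) ((fst p)(Suc t := x), (snd p)(Suc t := a)) +
        V \<delta> (Suc t) (fst ((fst p)(Suc t := x), (snd p)(Suc t := a)) (Suc t))) \<partial>\<pi> (Suc t) ((fst p)(Suc t := x))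
        \<partial>\<rho> (fst p t, snd p t, \<delta> t)) = ennreal (accumulated_cost \<delta> t p + Q \<delta> t ?z)" .
  qed
qed

lemma cost_so_far_T: "cost_so_far \<delta> \<pi> T = cost T \<mu>0 \<rho> c \<phi> \<pi> \<delta>"
  by (simp add: cost_so_far_def cost_def accumulated_cost_def V_def split_beta')

lemma cost_ge_value:
  assumes \<delta>: "valid_flow \<delta>" and \<pi>: "\<pi> \<in> policies T"
  shows "(\<integral>\<^sup>+x. ennreal (V \<delta> 0 x) \<partial>\<mu>0) \<le> cost T \<mu>0 \<rho> c \<phi> \<pi> \<delta>"
proof -
  have "cost_so_far \<delta> \<pi> 0 \<le> cost_so_far \<delta> \<pi> t" if "t \<le> T" for t
    using that
  proof (induction t)
    case (Suc t)
    then have t: "t < T" by simp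
    have "V \<delta> t (fst p t) \<le> Q \<delta> t (fst p t, snd p t)" for p
      unfolding V_eq[OF t] by (rule action_min_le[where g="Q \<delta> t", OF Q_nonneg[OF \<delta> less_imp_le[OF t]]])
    then have "cost_so_far \<delta> \<pi> t \<le> cost_so_far \<delta> \<pi> (Suc t)"
      unfolding cost_so_far_Suc[OF \<delta> \<pi> t] unfolding cost_so_far_def
      by (intro nn_integral_mono ennreal_leI add_left_mono)
    with Suc show ?case by simp
  qed simp
  from this[OF order_refl] show ?thesis by (simp add: cost_so_far_T cost_so_far_0[OF \<delta> \<pi>])
qed

lemma cost_eq_value:
  assumes \<delta>: "valid_flow \<delta>" and \<pi>: "\<pi> \<in> policies T"
    and opt: "\<And>t. t < T \<Longrightarrow> AE p in path_law \<mu>0 \<rho> \<delta> \<pi> t. Q \<delta> t (fst p t, snd p t) = V \<delta> t (fst p t)"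
  shows "cost T \<mu>0 \<rho> c \<phi> \<pi> \<delta> = (\<integral>\<^sup>+x. ennreal (V \<delta> 0 x) \<partial>\<mu>0)"
proof -
  have "cost_so_far \<delta> \<pi> t = cost_so_far \<delta> \<pi> 0" if "t \<le> T" for t
    using that
  proof (induction t)
    case (Suc t)
    then have t: "t < T" by simp
    have "cost_so_far \<delta> \<pi> (Suc t) = cost_so_far \<delta> \<pi> t"
      unfolding cost_so_far_Suc[OF \<delta> \<pi> t] unfolding cost_so_far_def
      by (rule nn_integral_cong_AE, use opt[OF t] in eventually_elim) simp
    with Suc show ?case by simp
  qed simp
  from this[OF order_refl] show ?thesis by (simp add: cost_so_far_T cost_so_far_0[OF \<delta> \<pi>])
qed

text \<open>The policy looks at the current state only and the kernel at the current pair only, so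
  the induction closes on one-time laws although path laws keep the whole history. The limit laws
  are thereby the laws that the policy really produces.\<close>

lemma state_action_law_eq:
  assumes \<delta>: "valid_flow (flow_of \<nu>)" and \<nu>: "valid_laws \<nu>" and marg: "\<And>t. t \<le> T \<Longrightarrow> distr (\<nu> t) borel fst = state_law \<nu> t"
    and K: "\<And>t. t \<le> T \<Longrightarrow> K t \<in> borel \<rightarrow>\<^sub>M prob_algebra borel"
    and dis: "\<And>t. t \<le> T \<Longrightarrow> \<nu> t = distr (\<nu> t) borel fst \<bind> (\<lambda>x. K t x \<bind> (\<lambda>a. return (borel \<Otimes>\<^sub>M borel) (x, a)))"
    and \<pi>: "(\<lambda>t h. K t (h t)) \<in> policies T"
  shows "t \<le> T \<Longrightarrow> state_action_law \<mu>0 \<rho> (flow_of \<nu>) (\<lambda>t h. K t (h t)) t = \<nu> t"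
proof (induction t)
  let ?L = "path_law \<mu>0 \<rho> (flow_of \<nu>) (\<lambda>t h. K t (h t))"
  have dis_int: "(\<integral>\<^sup>+z. f z \<partial>\<nu> t) = (\<integral>\<^sup>+x. \<integral>\<^sup>+a. f (x, a) \<partial>K t x \<partial>state_law \<nu> t)"
    if t: "t \<le> T" and f: "f \<in> borel_measurable (borel \<Otimes>\<^sub>M borel)" for t f
    using nn_integral_graph_kernel[OF K[OF t] f, of "state_law \<nu> t"] dis[OF t] marg[OF t]
      sets_borel_probs[OF state_law_borel_probs[OF \<nu> t]] by simp
  have transfer: "state_action_law \<mu>0 \<rho> (flow_of \<nu>) (\<lambda>t h. K t (h t)) t = \<nu> t"
    if t: "t \<le> T" and eq: "\<And>f. f \<in> borel_measurable (borel \<Otimes>\<^sub>M borel) \<Longrightarrow>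
      (\<integral>\<^sup>+p. f (fst p t, snd p t) \<partial>?L t) = (\<integral>\<^sup>+z. f z \<partial>\<nu> t)" for t
  proof (rule measure_eqI)
    have sets_\<nu>: "sets (\<nu> t) = sets (borel \<Otimes>\<^sub>M borel)"
      using sets_borel_probs[OF valid_lawsD[OF \<nu> t]] by (simp only: borel_prod)
    then show "sets (state_action_law \<mu>0 \<rho> (flow_of \<nu>) (\<lambda>t h. K t (h t)) t) = sets (\<nu> t)"
      by (simp add: state_action_law_def)
    fix A assume "A \<in> sets (state_action_law \<mu>0 \<rho> (flow_of \<nu>) (\<lambda>t h. K t (h t)) t)"
    then have A: "A \<in> sets (borel \<Otimes>\<^sub>M borel)" by (simp add: state_action_law_def)
    have m: "(\<lambda>p. (fst p t, snd p t)) \<in> ?L t \<rightarrow>\<^sub>M borel \<Otimes>\<^sub>M borel"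
      using path_state_action_measurable[of t t] sets_path_law[OF \<delta> \<pi> t]
      by (simp add: borel_prod cong: measurable_cong_sets)
    have "emeasure (state_action_law \<mu>0 \<rho> (flow_of \<nu>) (\<lambda>t h. K t (h t)) t) A
        = (\<integral>\<^sup>+z. indicator A z \<partial>distr (?L t) (borel \<Otimes>\<^sub>M borel) (\<lambda>p. (fst p t, snd p t)))"
      using A by (simp add: state_action_law_def split_beta')
    also have "\<dots> = (\<integral>\<^sup>+p. indicator A (fst p t, snd p t) \<partial>?L t)"
      using A by (intro nn_integral_distr[OF m]) simp
    also have "\<dots> = (\<integral>\<^sup>+z. indicator A z \<partial>\<nu> t)" using A by (intro eq) simp
    also have "\<dots> = emeasure (\<nu> t) A" using A sets_\<nu> by simp
    finally show "emeasure (state_action_law \<mu>0 \<rho> (flow_of \<nu>) (\<lambda>t h. K t (h t)) t) A = emeasure (\<nu> t) A" .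
  qed
  have path_meas: "(\<lambda>p. f (fst p t, snd p t)) \<in> borel_measurable (path_space t)"
    if "f \<in> borel_measurable (borel \<Otimes>\<^sub>M borel)" for f :: "'x \<times> 'a \<Rightarrow> ennreal" and t
    using measurable_compose[OF path_state_action_measurable[OF order_refl] that[unfolded borel_prod]] .
  {
    case 0
    show ?case
    proof (rule transfer[OF le0])
      fix f :: "'x \<times> 'a \<Rightarrow> ennreal" assume f: "f \<in> borel_measurable (borel \<Otimes>\<^sub>M borel)"
      show "(\<integral>\<^sup>+p. f (fst p 0, snd p 0) \<partial>?L 0) = (\<integral>\<^sup>+z. f z \<partial>\<nu> 0)"
        unfolding nn_integral_path_law_0[OF \<pi> path_meas[OF f]] dis_int[OF le0 f]
        by (simp add: state_law_def)
    qed
  next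
    case (Suc t)
    then have t: "t < T" "t \<le> T" by auto
    have IH: "distr (?L t) (borel \<Otimes>\<^sub>M borel) (\<lambda>p. (fst p t, snd p t)) = \<nu> t"
      using Suc.IH[OF t(2)] by (simp add: state_action_law_def split_beta')
    show ?case
    proof (rule transfer[OF Suc.prems])
      fix f :: "'x \<times> 'a \<Rightarrow> ennreal" assume f: "f \<in> borel_measurable (borel \<Otimes>\<^sub>M borel)"
      \<comment> \<open>The action at \<open>Suc t\<close> is integrated out first; what remains is
        a function of the new state, whose law is \<open>state_law \<nu> (Suc t)\<close> by the
        induction hypothesis.\<close>
      define g where "g x = (\<integral>\<^sup>+a. f (x, a) \<partial>K (Suc t) x)" for x
      have g: "g \<in> borel_measurable borel"
      proof -
        have "(\<lambda>x. K (Suc t) x \<bind> (\<lambda>a. return (borel \<Otimes>\<^sub>M borel) (x, a))) \<in> borel \<rightarrow>\<^sub>M prob_algebra (borel \<Otimes>\<^sub>M borel)"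
          by (intro measurable_bind_prob_space2[OF K[OF Suc.prems]]) measurable
        from nn_integral_kernel_measurable[OF this f]
        have "(\<lambda>x. \<integral>\<^sup>+z. f z \<partial>(K (Suc t) x \<bind> (\<lambda>a. return (borel \<Otimes>\<^sub>M borel) (x, a)))) \<in> borel_measurable borel" .
        moreover have "(\<integral>\<^sup>+z. f z \<partial>(K (Suc t) x \<bind> (\<lambda>a. return (borel \<Otimes>\<^sub>M borel) (x, a)))) = g x" for x
        proof -
          have sets: "sets (K (Suc t) x) = sets borel"
            using measurable_space[OF K[OF Suc.prems], of x] by (intro sets_borel_probs) simp
          have "(\<lambda>a. return (borel \<Otimes>\<^sub>M borel) (x, a)) \<in> borel \<rightarrow>\<^sub>M prob_algebra (borel \<Otimes>\<^sub>M borel)" by measurable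
          from nn_integral_bind_kernel[OF sets this f] show ?thesis
            using f by (simp add: g_def nn_integral_return space_pair_measure)
        qed
        ultimately show ?thesis by simp
      qed
      note S = step_kernel_measurable[OF valid_flowD[OF \<delta> t(2)]]
      have sets_\<nu>: "sets (\<nu> t) = sets borel" by (rule sets_borel_probs[OF valid_lawsD[OF \<nu> t(2)]])
      have m: "(\<lambda>p. (fst p t, snd p t)) \<in> ?L t \<rightarrow>\<^sub>M borel \<Otimes>\<^sub>M borel"
        using path_state_action_measurable[of t t] sets_path_law[OF \<delta> \<pi> t(2)]
        by (simp add: borel_prod cong: measurable_cong_sets)
      have "(\<integral>\<^sup>+p. f (fst p (Suc t), snd p (Suc t)) \<partial>?L (Suc t))
          = (\<integral>\<^sup>+p. \<integral>\<^sup>+x. g x \<partial>step_kernel (flow_of \<nu> t) (fst p t, snd p t) \<partial>?L t)"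
        unfolding nn_integral_path_law_Suc[OF \<delta> \<pi> t(1) sets_path_law[OF \<delta> \<pi> t(2)] path_meas[OF f]]
        by (simp add: g_def step_kernel_def)
      also have "\<dots> = (\<integral>\<^sup>+z. \<integral>\<^sup>+x. g x \<partial>step_kernel (flow_of \<nu> t) z \<partial>\<nu> t)"
        unfolding IH[symmetric]
        using nn_integral_kernel_measurable[OF S g]
        by (subst nn_integral_distr[OF m]) (simp_all add: borel_prod IH)
      also have "\<dots> = (\<integral>\<^sup>+x. g x \<partial>state_law \<nu> (Suc t))"
        unfolding state_law_def nat.case by (rule nn_integral_bind_kernel[OF sets_\<nu> S g, symmetric])
      also have "\<dots> = (\<integral>\<^sup>+z. f z \<partial>\<nu> (Suc t))" unfolding g_def dis_int[OF Suc.prems f] ..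
      finally show "(\<integral>\<^sup>+p. f (fst p (Suc t), snd p (Suc t)) \<partial>?L (Suc t)) = (\<integral>\<^sup>+z. f z \<partial>\<nu> (Suc t))" .
    qed
  }
qed

section \<open>Existence of an equilibrium\<close>

theorem equilibrium_exists: "\<exists>\<pi> \<delta>. mfg_equilibrium T \<mu>0 \<rho> c \<phi> \<pi> \<delta>"
proof -
  obtain \<nu> where \<nu>: "valid_laws \<nu>" and marg: "\<And>t. t \<le> T \<Longrightarrow> distr (\<nu> t) borel fst = state_law \<nu> t"
    and opt: "\<And>t. t < T \<Longrightarrow> AE z in \<nu> t. Q (flow_of \<nu>) t z = V (flow_of \<nu>) t (fst z)"
    using equilibrium_occupation_measures by blast
  have \<delta>: "valid_flow (flow_of \<nu>)" by (rule valid_flow_of[OF \<nu>])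
  have "\<forall>t. \<exists>K. t \<le> T \<longrightarrow> K \<in> borel \<rightarrow>\<^sub>M prob_algebra borel \<and>
      \<nu> t = distr (\<nu> t) borel fst \<bind> (\<lambda>x. K x \<bind> (\<lambda>a. return (borel \<Otimes>\<^sub>M borel) (x, a)))"
    using disintegration[OF compact_actions valid_lawsD[OF \<nu>]] by blast
  from choice[OF this] obtain K where K: "\<And>t. t \<le> T \<Longrightarrow> K t \<in> borel \<rightarrow>\<^sub>M prob_algebra borel"
    and dis: "\<And>t. t \<le> T \<Longrightarrow> \<nu> t = distr (\<nu> t) borel fst \<bind> (\<lambda>x. K t x \<bind> (\<lambda>a. return (borel \<Otimes>\<^sub>M borel) (x, a)))"
    by blast
  define \<pi> where "\<pi> = (\<lambda>t (h :: nat \<Rightarrow> 'x). K t (h t))"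
  have "\<pi> t \<in> PiM {..t} (\<lambda>_. borel) \<rightarrow>\<^sub>M prob_algebra borel" if "t \<le> T" for t
    unfolding \<pi>_def using K[OF that] by (intro measurable_compose[OF measurable_component_singleton]) auto
  then have \<pi>: "\<pi> \<in> policies T" by (simp add: policies_def)
  then have markov: "\<pi> \<in> markov_policies T"
    unfolding markov_policies_def using K by (auto simp: \<pi>_def)
  have law: "state_action_law \<mu>0 \<rho> (flow_of \<nu>) \<pi> t = \<nu> t" if "t \<le> T" for t
    unfolding \<pi>_def by (rule state_action_law_eq[OF \<delta> \<nu> marg K dis \<pi>[unfolded \<pi>_def] that])
  have opt_path: "AE p in path_law \<mu>0 \<rho> (flow_of \<nu>) \<pi> t.
      Q (flow_of \<nu>) t (fst p t, snd p t) = V (flow_of \<nu>) t (fst p t)" if t: "t < T" for t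
  proof -
    have t': "t \<le> T" using t by simp
    have m: "(\<lambda>p. (fst p t, snd p t)) \<in> path_law \<mu>0 \<rho> (flow_of \<nu>) \<pi> t \<rightarrow>\<^sub>M borel \<Otimes>\<^sub>M borel"
      using path_state_action_measurable[of t t] sets_path_law[OF \<delta> \<pi> t']
      by (simp add: borel_prod cong: measurable_cong_sets)
    have "distr (path_law \<mu>0 \<rho> (flow_of \<nu>) \<pi> t) (borel \<Otimes>\<^sub>M borel) (\<lambda>p. (fst p t, snd p t)) = \<nu> t"
      using law[OF t'] by (simp add: state_action_law_def split_beta')
    from AE_distrD[OF m, unfolded this, OF opt[OF t]] show ?thesis by simp
  qed
  have "\<pi> \<in> optimal_policies T \<mu>0 \<rho> c \<phi> (flow_of \<nu>)"
    unfolding optimal_policies_def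
    using \<pi> cost_eq_value[OF \<delta> \<pi> opt_path] cost_ge_value[OF \<delta>] by auto
  moreover have "is_mean_field_flow T \<mu>0 \<rho> \<pi> (flow_of \<nu>)"
    unfolding is_mean_field_flow_def
  \<comment> \<open>The disintegration kernels are conditional action laws, because the joint law of
    state and action under \<open>\<pi>\<close> is \<open>\<nu> t\<close>.\<close>
  proof (intro exI[of _ K] conjI allI impI)
    have snd_flow: "snd (flow_of \<nu> t) = distr (\<nu> t) borel fst" for t by (simp add: flow_of_def marginals_def)
    have m: "sets (distr (\<nu> t) borel fst) = sets borel" for t by simp
    show "is_conditional_action_law \<mu>0 \<rho> (flow_of \<nu>) \<pi> t (K t)" if t: "t \<le> T" for t
      unfolding is_conditional_action_law_def law[OF t] using K[OF t] dis[OF t] by blast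
    show "snd (flow_of \<nu> 0) = \<mu>0" unfolding snd_flow marg[OF le0] by (simp add: state_law_def)
    show "fst (flow_of \<nu> t) = snd (flow_of \<nu> t) \<bind> K t" if t: "t \<le> T" for t
    proof (rule measure_eqI)
      have D: "snd (flow_of \<nu> t) \<in> borel_probs" using valid_flowD[OF \<delta> t] by auto
      show "sets (fst (flow_of \<nu> t)) = sets (snd (flow_of \<nu> t) \<bind> K t)"
        using sets_bind'[OF D K[OF t]] by (simp add: flow_of_def marginals_def)
      fix A assume "A \<in> sets (fst (flow_of \<nu> t))"
      then have A: "A \<in> sets borel" by (simp add: flow_of_def marginals_def)
      have f: "(\<lambda>z. indicator A (snd z)) \<in> borel_measurable ((borel :: 'x measure) \<Otimes>\<^sub>M borel)"
        using A by measurable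
      have sm: "snd \<in> \<nu> t \<rightarrow>\<^sub>M borel"
        using fst_snd_borel_measurable(2) sets_borel_probs[OF valid_lawsD[OF \<nu> t]] by (simp cong: measurable_cong_sets)
      have "emeasure (fst (flow_of \<nu> t)) A = (\<integral>\<^sup>+z. indicator A z \<partial>distr (\<nu> t) borel snd)"
        using A by (simp add: flow_of_def marginals_def)
      also have "\<dots> = (\<integral>\<^sup>+z. indicator A (snd z) \<partial>\<nu> t)"
        using A by (intro nn_integral_distr[OF sm]) simp
      also have "\<dots> = (\<integral>\<^sup>+x. \<integral>\<^sup>+a. indicator A (snd (x, a)) \<partial>K t x \<partial>distr (\<nu> t) borel fst)"
        using nn_integral_graph_kernel[OF K[OF t] f m, of t] dis[OF t] by simp
      also have "\<dots> = (\<integral>\<^sup>+a. indicator A a \<partial>(distr (\<nu> t) borel fst \<bind> K t))"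
        using A by (simp add: nn_integral_bind_kernel[OF m K[OF t]] del: nn_integral_indicator)
      also have "\<dots> = emeasure (snd (flow_of \<nu> t) \<bind> K t) A"
        using A sets_bind'[OF D K[OF t]] by (simp add: snd_flow)
      finally show "emeasure (fst (flow_of \<nu> t)) A = emeasure (snd (flow_of \<nu> t) \<bind> K t) A" .
    qed
    show "snd (flow_of \<nu> (Suc t)) = snd (flow_of \<nu> t) \<bind> (\<lambda>x. K t x \<bind> (\<lambda>a. \<rho> (x, a, flow_of \<nu> t)))"
      if t: "t < T" for t
    proof (rule measure_eqI)
      have t': "t \<le> T" "Suc t \<le> T" using t by auto
      note S = step_kernel_measurable[OF valid_flowD[OF \<delta> t'(1)]]
      have D: "snd (flow_of \<nu> t) \<in> borel_probs" using valid_flowD[OF \<delta> t'(1)] by auto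
      have S': "(\<lambda>(x, a). \<rho> (x, a, flow_of \<nu> t)) \<in> borel \<Otimes>\<^sub>M borel \<rightarrow>\<^sub>M prob_algebra borel"
        using S by (simp add: step_kernel_def[abs_def] split_beta' borel_prod)
      have KS: "(\<lambda>x. K t x \<bind> (\<lambda>a. \<rho> (x, a, flow_of \<nu> t))) \<in> borel \<rightarrow>\<^sub>M prob_algebra borel"
        by (rule measurable_bind_prob_space2[OF K[OF t'(1)] S'])
      show "sets (snd (flow_of \<nu> (Suc t))) = sets (snd (flow_of \<nu> t) \<bind> (\<lambda>x. K t x \<bind> (\<lambda>a. \<rho> (x, a, flow_of \<nu> t))))"
        unfolding sets_bind'[OF D KS] by (simp add: snd_flow)
      fix A assume "A \<in> sets (snd (flow_of \<nu> (Suc t)))"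
      then have A: "A \<in> sets borel" by (simp add: snd_flow)
      have f: "(\<lambda>z. emeasure (step_kernel (flow_of \<nu> t) z) A) \<in> borel_measurable (borel \<Otimes>\<^sub>M borel)"
        using measurable_compose[OF measurable_prob_algebraD[OF S] measurable_emeasure_subprob_algebra[OF A]]
        by (simp add: borel_prod)
      have "emeasure (snd (flow_of \<nu> (Suc t))) A = emeasure (\<nu> t \<bind> step_kernel (flow_of \<nu> t)) A"
        unfolding snd_flow marg[OF t'(2)] by (simp add: state_law_def)
      also have "\<dots> = (\<integral>\<^sup>+z. emeasure (step_kernel (flow_of \<nu> t) z) A \<partial>\<nu> t)"
        by (rule emeasure_bind_prob_algebra[OF valid_lawsD[OF \<nu> t'(1)] S A])
      also have "\<dots> = (\<integral>\<^sup>+x. \<integral>\<^sup>+a. emeasure (step_kernel (flow_of \<nu> t) (x, a)) A \<partial>K t x \<partial>distr (\<nu> t) borel fst)"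
        using nn_integral_graph_kernel[OF K[OF t'(1)] f m, of t] dis[OF t'(1)] by simp
      also have "\<dots> = (\<integral>\<^sup>+x. emeasure (K t x \<bind> (\<lambda>a. \<rho> (x, a, flow_of \<nu> t))) A \<partial>snd (flow_of \<nu> t))"
        unfolding snd_flow
      proof (rule nn_integral_cong)
        fix x
        have Kx: "K t x \<in> borel_probs" using measurable_space[OF K[OF t'(1)]] by simp
        have "(\<lambda>a. \<rho> (x, a, flow_of \<nu> t)) \<in> borel \<rightarrow>\<^sub>M prob_algebra borel"
          using measurable_compose[OF measurable_Pair1' S', of x] by simp
        from emeasure_bind_prob_algebra[OF Kx this A]
        show "(\<integral>\<^sup>+a. emeasure (step_kernel (flow_of \<nu> t) (x, a)) A \<partial>K t x)
            = emeasure (K t x \<bind> (\<lambda>a. \<rho> (x, a, flow_of \<nu> t))) A"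
          by (simp add: step_kernel_def)
      qed
      also have "\<dots> = emeasure (snd (flow_of \<nu> t) \<bind> (\<lambda>x. K t x \<bind> (\<lambda>a. \<rho> (x, a, flow_of \<nu> t)))) A"
        by (rule emeasure_bind_prob_algebra[OF D KS A, symmetric])
      finally show "emeasure (snd (flow_of \<nu> (Suc t))) A
          = emeasure (snd (flow_of \<nu> t) \<bind> (\<lambda>x. K t x \<bind> (\<lambda>a. \<rho> (x, a, flow_of \<nu> t)))) A" .
    qed
  qed
  ultimately show ?thesis
    unfolding mfg_equilibrium_def using markov valid_flowD[OF \<delta>] by blast
qed

end

section \<open>From the hypotheses of the theorem to the locale\<close>

lemma moment_function_compact_sublevel:
  assumes "continuous_moment_function (w :: 'x::polish_space \<Rightarrow> real)"
  shows "compact {x. w x \<le> r}"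
proof -
  obtain H :: "nat \<Rightarrow> 'x set" where H: "\<And>n. compact (H n)" "(\<lambda>n. INF x \<in> - H n. ereal (w x)) \<longlonglongrightarrow> \<infinity>"
    and w: "continuous_on UNIV w"
    using assms unfolding continuous_moment_function_def by blast
  have "\<forall>\<^sub>F n in sequentially. ereal r < (INF x \<in> - H n. ereal (w x))"
    using order_tendstoD(1)[OF H(2), of "ereal r"] by simp
  then obtain n where n: "ereal r < (INF x \<in> - H n. ereal (w x))"
    unfolding eventually_sequentially by blast
  \<comment> \<open>Off \<open>H n\<close> every value of \<open>w\<close> exceeds \<open>r\<close>,
    so the sublevel set is a closed subset of a compact set.\<close>
  have "{x. w x \<le> r} \<subseteq> H n"
  proof (rule ccontr)
    assume "\<not> ?thesis"
    then obtain x where "w x \<le> r" "x \<in> - H n" by blast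
    then show False using n INF_lower[of x "- H n" "\<lambda>x. ereal (w x)"] by (meson ereal_less_eq(3) leD order_trans)
  qed
  moreover have "closed {x. w x \<le> r}"
    using w by (intro closed_Collect_le continuous_on_const) auto
  ultimately show ?thesis using H(1) compact_Int_closed[of "H n" "{x. w x \<le> r}"] by (simp add: inf_absorb2)
qed

lemma limitin_arg_topology:
  assumes "x \<longlonglongrightarrow> x'" "a \<longlonglongrightarrow> a'" "laws_conv D d"
  shows "limitin arg_topology (\<lambda>k. (x k, a k, D k)) (x', a', d) sequentially"
  using assms by (simp add: arg_topology_def limitin_pairwise laws_conv_def o_def)

lemma limitin_terminal_arg_topology:
  assumes "x \<longlonglongrightarrow> x'" "laws_conv D d"
  shows "limitin terminal_arg_topology (\<lambda>k. (x k, D k)) (x', d) sequentially"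
  using assms by (simp add: terminal_arg_topology_def limitin_pairwise laws_conv_def o_def)

lemma topspace_arg_topology: "z \<in> topspace arg_topology \<longleftrightarrow> snd (snd z) \<in> borel_probs \<times> borel_probs"
  by (cases z) (auto simp: arg_topology_def)

lemma topspace_terminal_arg_topology: "z \<in> topspace terminal_arg_topology \<longleftrightarrow> snd z \<in> borel_probs \<times> borel_probs"
  by (cases z) (auto simp: terminal_arg_topology_def)

theorem theorem2p4:
  fixes \<mu>0 :: "'x::polish_space measure"
    and \<rho> :: "('x, 'a::polish_space) kernel"
    and c :: "('x, 'a) running_cost"
    and \<phi> :: "('x, 'a) terminal_cost"
    and T :: nat
    and w v :: "'x \<Rightarrow> real"
    and \<alpha> :: real
  assumes "0 < T"
    and "\<mu>0 \<in> borel_probs"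
    and "transition_kernel \<rho>"
    and "\<forall>z \<in> topspace arg_topology. 0 \<le> c z"
    and "\<forall>z \<in> topspace terminal_arg_topology. 0 \<le> \<phi> z"
    and "continuous_moment_function w"
    and "v = (if bounded (c ` topspace arg_topology) \<and> bounded (\<phi> ` topspace terminal_arg_topology)
              then (\<lambda>_. 1) else w)"
    \<comment> \<open>(i)\<close>
    and "continuous_map arg_topology euclideanreal c"
    and "continuous_map terminal_arg_topology euclideanreal \<phi>"
    \<comment> \<open>(ii)\<close>
    and "compact (UNIV :: 'a set)"
    and "locally_compact_space (euclidean :: 'x topology)"
    \<comment> \<open>(iii)\<close>
    and "1 \<le> \<alpha>"
    and "\<forall>x. (SUP (a, \<delta>) \<in> UNIV \<times> borel_probs \<times> borel_probs.
                \<integral>\<^sup>+ y. ennreal (w y) \<partial>\<rho> (x, a, \<delta>)) \<le> ennreal (\<alpha> * w x)"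
    \<comment> \<open>(iv)\<close>
    and "\<forall>z l. range z \<subseteq> topspace arg_topology \<longrightarrow> limitin arg_topology z l sequentially \<longrightarrow>
                limitin weak_topology (\<lambda>n. \<rho> (z n)) (\<rho> l) sequentially"
    and "continuous_map arg_topology euclideanreal (\<lambda>z. \<integral>y. w y \<partial>\<rho> z)"
    \<comment> \<open>(v)\<close>
    and "(\<integral>\<^sup>+ x. ennreal (v x) \<partial>\<mu>0) < \<infinity>"
    \<comment> \<open>(vi)\<close>
    and "\<exists>R::real. \<forall>x.
           (SUP (a, \<delta>) \<in> UNIV \<times> borel_probs \<times> borel_probs. ereal (c (x, a, \<delta>)))
             \<le> ereal (R * v x) \<and>
           (SUP \<delta> \<in> borel_probs \<times> borel_probs. ereal (\<phi> (x, \<delta>))) \<le> ereal (R * v x)"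
  shows "\<exists>(\<pi> :: ('x, 'a) policy) (\<delta> :: ('x, 'a) flow). mfg_equilibrium T \<mu>0 \<rho> c \<phi> \<pi> \<delta>"
proof -
  have w: "continuous_on UNIV w" "1 \<le> w x" for x
    using assms(6) unfolding continuous_moment_function_def by blast+
  have v_cases: "v = (\<lambda>_. 1) \<or> v = w" using assms(7) by auto
  then have v: "continuous_on UNIV v" "1 \<le> v x" for x using w by auto
  have \<rho>_meas: "\<rho> (x, a, d) \<in> borel_probs" if "d \<in> borel_probs \<times> borel_probs" for x a d
    using assms(3) that unfolding transition_kernel_def
    by (intro measurable_space[where f=\<rho>]) (auto simp: space_pair_measure)
  have drift: "integrable (\<rho> (x, a, d)) v \<and> (\<integral>y. v y \<partial>\<rho> (x, a, d)) \<le> \<alpha> * v x"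
    if d: "d \<in> borel_probs \<times> borel_probs" for x a d
  proof -
    interpret prob_space "\<rho> (x, a, d)" using prob_space_borel_probs[OF \<rho>_meas[OF d]] .
    show ?thesis
    proof (cases "v = (\<lambda>_. 1)")
      \<comment> \<open>For the constant weight 1 the drift bound reduces to
        \<open>1 \<le> \<alpha>\<close>.\<close>
      case True
      then show ?thesis using assms(12) by (simp add: prob_space)
    next
      case False
      then have vw: "v = w" using v_cases by simp
      have meas: "w \<in> borel_measurable (\<rho> (x, a, d))"
        using borel_measurable_continuous_onI[OF w(1)] sets_borel_probs[OF \<rho>_meas[OF d]]
        by (simp cong: measurable_cong_sets)
      have "(\<integral>\<^sup>+y. ennreal (w y) \<partial>\<rho> (x, a, d))
          \<le> (SUP (a, \<delta>) \<in> UNIV \<times> borel_probs \<times> borel_probs. \<integral>\<^sup>+y. ennreal (w y) \<partial>\<rho> (x, a, \<delta>))"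
        using d by (intro SUP_upper2[of "(a, d)"]) auto
      also have "\<dots> \<le> ennreal (\<alpha> * w x)" using assms(13) by blast
      finally have le: "(\<integral>\<^sup>+y. ennreal (w y) \<partial>\<rho> (x, a, d)) \<le> ennreal (\<alpha> * w x)" .
      have w0: "0 \<le> w y" for y using w(2)[of y] by linarith
      have int: "integrable (\<rho> (x, a, d)) w"
        using le meas w0 by (intro integrableI_nonneg) (auto intro: le_less_trans)
      moreover have "(\<integral>y. w y \<partial>\<rho> (x, a, d)) \<le> \<alpha> * w x"
      proof -
        have "ennreal (\<integral>y. w y \<partial>\<rho> (x, a, d)) \<le> ennreal (\<alpha> * w x)"
          using le int w0 by (simp add: nn_integral_eq_integral)
        then show ?thesis using assms(12) w0[of x] by (simp add: ennreal_le_iff)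
      qed
      ultimately show ?thesis by (simp add: vw)
    qed
  qed
  obtain R where R: "\<And>x. (SUP (a, \<delta>) \<in> UNIV \<times> borel_probs \<times> borel_probs. ereal (c (x, a, \<delta>))) \<le> ereal (R * v x)"
    "\<And>x. (SUP \<delta> \<in> borel_probs \<times> borel_probs. ereal (\<phi> (x, \<delta>))) \<le> ereal (R * v x)"
    using assms(17) by blast
  have c_bounds: "0 \<le> c (x, a, d) \<and> c (x, a, d) \<le> R * v x" if d: "d \<in> borel_probs \<times> borel_probs" for x a d
  proof
    show "0 \<le> c (x, a, d)" using assms(4) d by (simp add: topspace_arg_topology)
    have "ereal (c (x, a, d)) \<le> (SUP (a, \<delta>) \<in> UNIV \<times> borel_probs \<times> borel_probs. ereal (c (x, a, \<delta>)))"
      using d by (intro SUP_upper2[of "(a, d)"]) auto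
    also note R(1)
    finally show "c (x, a, d) \<le> R * v x" by simp
  qed
  have \<phi>_bounds: "0 \<le> \<phi> (x, d) \<and> \<phi> (x, d) \<le> R * v x" if d: "d \<in> borel_probs \<times> borel_probs" for x d
  proof
    show "0 \<le> \<phi> (x, d)" using assms(5) d by (simp add: topspace_terminal_arg_topology)
    have "ereal (\<phi> (x, d)) \<le> (SUP \<delta> \<in> borel_probs \<times> borel_probs. ereal (\<phi> (x, \<delta>)))"
      using d by (intro SUP_upper)
    also note R(2)
    finally show "\<phi> (x, d) \<le> R * v x" by simp
  qed
  interpret mean_field_game \<mu>0 \<rho> c \<phi> T w v \<alpha> R
  proof
    show "compact (UNIV :: 'a set)" "\<mu>0 \<in> borel_probs" "transition_kernel \<rho>" by fact+
    show "continuous_on UNIV w" "continuous_on UNIV v" by (rule w(1), rule v(1))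
    show "compact {x. w x \<le> r}" for r by (rule moment_function_compact_sublevel[OF assms(6)])
    show "0 \<le> w x" "0 \<le> v x" for x using w(2)[of x] v(2)[of x] by linarith+
    fix x :: "nat \<Rightarrow> 'x" and x' and a :: "nat \<Rightarrow> 'a" and a' and D :: "nat \<Rightarrow> 'a measure \<times> 'x measure" and d
    assume x: "x \<longlonglongrightarrow> x'" and a: "a \<longlonglongrightarrow> a'" and D: "laws_conv D d"
    note lim = limitin_arg_topology[OF x a D]
    have range: "range (\<lambda>k. (x k, a k, D k)) \<subseteq> topspace arg_topology"
      using D by (auto simp: topspace_arg_topology laws_conv_def)
    show "limitin weak_topology (\<lambda>k. \<rho> (x k, a k, D k)) (\<rho> (x', a', d)) sequentially"
      using assms(14) range lim by blast
    show "(\<lambda>k. c (x k, a k, D k)) \<longlonglongrightarrow> c (x', a', d)"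
      using continuous_map_limit[OF assms(8) lim] by (simp add: o_def)
    show "(\<lambda>k. \<integral>y. v y \<partial>\<rho> (x k, a k, D k)) \<longlonglongrightarrow> (\<integral>y. v y \<partial>\<rho> (x', a', d))"
    proof (cases "v = (\<lambda>_. 1)")
      case True
      have "D k \<in> borel_probs \<times> borel_probs" for k using D by (simp add: laws_conv_def)
      then have "(\<integral>y. v y \<partial>\<rho> (x k, a k, D k)) = 1" for k
        using prob_space.prob_space[OF prob_space_borel_probs[OF \<rho>_meas]] True by simp
      moreover have "(\<integral>y. v y \<partial>\<rho> (x', a', d)) = 1"
        using prob_space.prob_space[OF prob_space_borel_probs[OF \<rho>_meas[OF laws_conv_limit[OF D]]]] True by simp
      ultimately show ?thesis by simp
    next
      case False
      then have "v = w" using v_cases by simp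
      then show ?thesis using continuous_map_limit[OF assms(15) lim] by (simp add: o_def)
    qed
  next
    fix x :: "nat \<Rightarrow> 'x" and x' and D :: "nat \<Rightarrow> 'a measure \<times> 'x measure" and d
    assume x: "x \<longlonglongrightarrow> x'" and D: "laws_conv D d"
    show "(\<lambda>k. \<phi> (x k, D k)) \<longlonglongrightarrow> \<phi> (x', d)"
      using continuous_map_limit[OF assms(9) limitin_terminal_arg_topology[OF x D]] by (simp add: o_def)
  qed (use drift c_bounds \<phi>_bounds in auto)
  show ?thesis by (rule equilibrium_exists)
qed

end
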